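(* Let $Y=[y_{ij}]$ and $Z=[z_{ij}]$ be two random $M\times N$ matrices with $\lim_{N\to\infty}d_N\in(0,\infty)\setminus\{1\}$, $H^Y=Y^\dagger Y$, $H^Z=Z^\dagger Z$, with Green functions $G^Y=(H^Y-z)^{-1}$, $G^Z=(H^Z-z)^{-1}$ and $m^Y=\frac1N\operatorname{Tr}G^Y$, $m^Z=\frac1N\operatorname{Tr}G^Z$. Assume: (A) For each $X\in\{Y,Z\}$ and any $\zeta>0$ there is a constant $C_\zeta$ such that, with $\zeta$-high probability (and with $\Lambda,\Lambda_o,\Lambda_d,\lambda_j$ formed from $X$), (i) $\Lambda(z)\le\varphi^{C_\zeta}\frac1{N\eta}$ for all $z\in\mathbf S(C_\zeta)$; (ii) $\Lambda_o(z)+\Lambda_d(z)\le\varphi^{C_\zeta}\bigl(\sqrt{\Im m_c(z)/(N\eta)}+\frac1{N\eta}\bigr)$ for all $z\in\mathbf S(C_\zeta)$; (iii) $\lambda_--N^{-2/3}\varphi^{C_\zeta}\le\min_{j\le\min\{M,N\}}\lambda_j\le\max_j\lambda_j\le\lambda_++N^{-2/3}\varphi^{C_\zeta}$. (B) For every $F:\mathbb R\to\mathbb R$ and constant $C_1>0$ with $\max_x|F^{(\alpha)}(x)|(|x|+1)^{-C_1}\le C_1$, $\alpha=1,2,3,4$, there exist $\varepsilon_0>0$, $N_0\in\mathbb N$ depending only on $C_1$, and a constant $C$, such that for any $0<\varepsilon<\varepsilon_0$, $N\ge N_0$, any real $E,E_1,E_2$ within distance $N^{-2/3+\varepsilon}$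 of $\lambda_+$, and $\eta=N^{-2/3-\varepsilon}$, $z=E+i\eta$, $$\bigl|\mathbb E F(N\eta\,\Im m^Y(z))-\mathbb EF(N\eta\,\Im m^Z(z))\bigr|\le CN^{-1/6+C\varepsilon},$$ $$\Bigl|\mathbb EF\Bigl(N\int_{E_1}^{E_2}\Im m^Y(y+i\eta)\,\mathrm dy\Bigr)-\mathbb EF\Bigl(N\int_{E_1}^{E_2}\Im m^Z(y+i\eta)\,\mathrm dy\Bigr)\Bigr|\le CN^{-1/6+C\varepsilon}.$$ (C) For every fixed $k\ge1$ and every bounded smooth $F:\mathbb R^k\to\mathbb R$ with bounded derivatives there exist $\varepsilon_0>0$, $N_0\in\mathbb N$ such that for any $0<\varepsilon<\varepsilon_0$ and $N\ge N_0$ there exists $\delta>0$ such that for any real $E_k<\cdots<E_1<E_0$ with $|E_j-\lambda_+|\le N^{-2/3+\varepsilon}$, $j=0,\ldots,k$, and $\eta=N^{-2/3-\varepsilon}$, $$\Bigl|\mathbb EF\Bigl(N\int_{E_1}^{E_0}\Im m^Y(y+i\eta)\,\mathrm dy,\ldots,N\int_{E_k}^{E_0}\Im m^Y(y+i\eta)\,\mathrm dy\Bigr)-\mathbb EF\Bigl(N\int_{E_1}^{E_0}\Im m^Z(y+i\eta)\,\mathrm dy,\ldots,N\int_{E_k}^{E_0}\Im m^Z(y+i\eta)\,\mathrm dy\Bigr)\Bigr|\le N^{-\delta}.$$ Assume also the counterparts of (B) and (C) at the lower edge ($\lambda_+$ replaced by $\lambda_-$, with, in (C), $E_0<E_1<\cdots<E_k$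 and integrals $\int_{E_0}^{E_j}$). Then the asymptotic eigenvalue distributions of $H^Y$ and $H^Z$ at the edge are identical, in the following sense. There are $\varepsilon>0$ and $\delta>0$ such that for any real $s$ (which may depend on $N$) and all $N\ge N_0$ with $N_0$ independent of $s$, $$\mathbb P\bigl(N^{2/3}(\lambda_1^Y-\lambda_+)\le s-N^{-\varepsilon}\bigr)-N^{-\delta}\le\mathbb P\bigl(N^{2/3}(\lambda_1^Z-\lambda_+)\le s\bigr)\le\mathbb P\bigl(N^{2/3}(\lambda_1^Y-\lambda_+)\le s+N^{-\varepsilon}\bigr)+N^{-\delta},$$ and the same holds with $\lambda_1^{Y}-\lambda_+$, $\lambda_1^Z-\lambda_+$ replaced by $\lambda^Y_{\min\{M,N\}}-\lambda_-$, $\lambda^Z_{\min\{M,N\}}-\lambda_-$. Here $\lambda^Y_1\ge\cdots\ge\lambda^Y_{\min\{M,N\}}$ and $\lambda_1^Z\ge\cdots\ge\lambda_{\min\{M,N\}}^Z$ are the nontrivial eigenvalues of $H^Y$ and $H^Z$.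
   Context: $M=M_N$, $N$ positive integers, $d=d_N=N/M$, with $\theta<d_N<\theta^{-1}$ for all $N$ for a fixed small $\theta>0$; $\lambda_\pm=(1\pm\sqrt d)^2$. For an $M\times N$ matrix $X$ and $z=E+i\eta$, $\eta>0$: $G(z)=(X^\dagger X-z)^{-1}$, $m(z)=\frac1N\operatorname{Tr}G(z)$; $m_c(z)$ is the unique solution with $\Im m_c(z)>0$ (for $\Im z>0$) of $m_c(z)+\frac1{z-(1-d)+zd\,m_c(z)}=0$; $\Lambda_d=\max_k|G_{kk}-m_c|$, $\Lambda_o=\max_{k\ne\ell}|G_{k\ell}|$, $\Lambda=|m-m_c|$. $\lambda_1\ge\lambda_2\ge\cdots$ are the eigenvalues of $X^\dagger X$. $\varphi=(\log N)^{\log\log N}$. $\mathbf S(\zeta)=\{z=E+i\eta:\ \mathbf 1_{d>1}(\lambda_-/5)\le E\le5\lambda_+,\ \varphi^\zeta N^{-1}\le\eta\le10(1+d)\}$. An event $\Omega=\Omega_N$ holds with $\zeta$-high probability if there is a constant $C>0$ with $\mathbb P(\Omega^c)\le N^C\exp(-\varphi^\zeta)$ for large enough $N$. *)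

theory Defs
  imports
    "HOL-Probability.Probability"
    "Jordan_Normal_Form.Schur_Decomposition"
    "Jordan_Normal_Form.Char_Poly"
begin

section \<open>Sample covariance matrices\<close>

text \<open>Matrices are complex, so real data matrices are the special case of real entries.\<close>

definition random_mat :: "'a measure \<Rightarrow> nat \<Rightarrow> nat \<Rightarrow> ('a \<Rightarrow> complex mat) \<Rightarrow> bool" where
  "random_mat P m n X \<longleftrightarrow>
     prob_space P \<and>
     (\<forall>\<omega>\<in>space P. X \<omega> \<in> carrier_mat m n) \<and>
     (\<forall>i<m. \<forall>j<n. (\<lambda>\<omega>. X \<omega> $$ (i, j)) \<in> borel_measurable P)"

definition sample_cov :: "complex mat \<Rightarrow> complex mat" where
  "sample_cov X = mat_adjoint X * X"

text \<open>For \<open>Im z > 0\<close> the matrix \<open>X\<^sup>\<dagger> X - z\<close> is invertible, so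
  \<^const>\<open>mat_inverse\<close> returns its inverse and not \<^const>\<open>None\<close>.\<close>

definition green :: "complex mat \<Rightarrow> complex \<Rightarrow> complex mat" where
  "green X z = the (mat_inverse (sample_cov X - z \<cdot>\<^sub>m 1\<^sub>m (dim_col X)))"

definition emp_stieltjes :: "complex mat \<Rightarrow> complex \<Rightarrow> complex" where
  "emp_stieltjes X z = (\<Sum>k<dim_col X. green X z $$ (k, k)) / of_nat (dim_col X)"

text \<open>The \<open>j\<close>-th largest eigenvalue of \<open>X\<^sup>\<dagger> X\<close>, counted from \<open>j = 1\<close> and with multiplicity.
  The matrix is Hermitian, so taking real parts of the characteristic roots loses nothing.\<close>

definition cov_eigval :: "complex mat \<Rightarrow> nat \<Rightarrow> real" where
  "cov_eigval X j =
     rev (sorted_list_of_multiset (image_mset Re (proots (char_poly (sample_cov X))))) ! (j - 1)"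

section \<open>The Marchenko--Pastur law\<close>

definition aspect :: "nat \<Rightarrow> nat \<Rightarrow> real" where
  "aspect m n = real n / real m"

definition lam_plus :: "real \<Rightarrow> real" where
  "lam_plus d = (1 + sqrt d)\<^sup>2"

definition lam_minus :: "real \<Rightarrow> real" where
  "lam_minus d = (1 - sqrt d)\<^sup>2"

definition mp_stieltjes :: "real \<Rightarrow> complex \<Rightarrow> complex" where
  "mp_stieltjes d z =
     (THE m. Im m > 0 \<and> m + 1 / (z - (1 - of_real d) + z * of_real d * m) = 0)"

section \<open>The local law\<close>

definition phi :: "nat \<Rightarrow> real" where
  "phi N = ln (real N) powr ln (ln (real N))"

definition spec_dom :: "real \<Rightarrow> nat \<Rightarrow> real \<Rightarrow> complex set" where
  "spec_dom d N \<zeta> =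
     {z. (if d > 1 then lam_minus d / 5 else 0) \<le> Re z \<and> Re z \<le> 5 * lam_plus d \<and>
         phi N powr \<zeta> / real N \<le> Im z \<and> Im z \<le> 10 * (1 + d)}"

definition high_prob :: "(nat \<Rightarrow> 'a measure) \<Rightarrow> real \<Rightarrow> (nat \<Rightarrow> 'a set) \<Rightarrow> bool" where
  "high_prob P \<zeta> \<Omega> \<longleftrightarrow>
     (\<exists>C>0. eventually (\<lambda>N. \<Omega> N \<in> sets (P N) \<and>
        measure (P N) (space (P N) - \<Omega> N) \<le> real N powr C * exp (- (phi N powr \<zeta>))) sequentially)"

definition Lam :: "real \<Rightarrow> complex mat \<Rightarrow> complex \<Rightarrow> real" where
  "Lam d X z = cmod (emp_stieltjes X z - mp_stieltjes d z)"

definition Lam_d :: "real \<Rightarrow> complex mat \<Rightarrow> complex \<Rightarrow> real" where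
  "Lam_d d X z = Max {cmod (green X z $$ (k, k) - mp_stieltjes d z) | k. k < dim_col X}"

text \<open>The set below is empty when \<open>X\<close> has a single column. This is harmless, since the local law
  only concerns large \<open>N\<close>.\<close>

definition Lam_o :: "complex mat \<Rightarrow> complex \<Rightarrow> real" where
  "Lam_o X z =
     Max {cmod (green X z $$ (k, l)) | k l. k < dim_col X \<and> l < dim_col X \<and> k \<noteq> l}"

definition local_law ::
  "(nat \<Rightarrow> nat) \<Rightarrow> (nat \<Rightarrow> 'a measure) \<Rightarrow> (nat \<Rightarrow> 'a \<Rightarrow> complex mat) \<Rightarrow> bool" where
  "local_law M P X \<longleftrightarrow>
    (\<forall>\<zeta>>0. \<exists>C::real. high_prob P \<zeta> (\<lambda>N. {\<omega> \<in> space (P N).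
       let d = aspect (M N) N in
       (\<forall>z \<in> spec_dom d N C.
          Lam d (X N \<omega>) z \<le> phi N powr C * (1 / (real N * Im z))) \<and>
       (\<forall>z \<in> spec_dom d N C.
          Lam_o (X N \<omega>) z + Lam_d d (X N \<omega>) z
            \<le> phi N powr C * (sqrt (Im (mp_stieltjes d z) / (real N * Im z)) + 1 / (real N * Im z))) \<and>
       lam_minus d - real N powr (-2/3) * phi N powr C \<le> Min (cov_eigval (X N \<omega>) ` {1..min (M N) N}) \<and>
       Min (cov_eigval (X N \<omega>) ` {1..min (M N) N}) \<le> Max (cov_eigval (X N \<omega>) ` {1..N}) \<and>
       Max (cov_eigval (X N \<omega>) ` {1..N}) \<le> lam_plus d + real N powr (-2/3) * phi N powr C}))"

section \<open>Green function comparison at an edge\<close>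

definition C4_growth :: "real \<Rightarrow> (real \<Rightarrow> real) \<Rightarrow> bool" where
  "C4_growth C1 F \<longleftrightarrow>
     (\<forall>\<alpha><4. \<forall>x. (deriv ^^ \<alpha>) F differentiable at x) \<and>
     (\<forall>\<alpha>\<in>{1..4}. \<forall>x. \<bar>(deriv ^^ \<alpha>) F x\<bar> * (\<bar>x\<bar> + 1) powr (- C1) \<le> C1)"

text \<open>\<open>N \<integral>\<^bsub>a\<^esub>\<^bsup>b\<^esup> Im m(y + i\<eta>) dy\<close> as an oriented integral, so \<open>a > b\<close> is allowed.\<close>

definition im_integral :: "complex mat \<Rightarrow> real \<Rightarrow> real \<Rightarrow> real \<Rightarrow> real" where
  "im_integral X \<eta> a b =
     real (dim_col X) * (LBINT y=ereal a..ereal b. Im (emp_stieltjes X (Complex y \<eta>)))"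

text \<open>Here \<open>e N\<close> is the location of the edge. The constants \<open>\<epsilon>0\<close> and \<open>N0\<close> depend on \<open>C1\<close> only,
  whereas \<open>C\<close> may depend on \<open>F\<close>.\<close>

definition green_comparison ::
  "(nat \<Rightarrow> real) \<Rightarrow> (nat \<Rightarrow> 'a measure) \<Rightarrow> (nat \<Rightarrow> 'a \<Rightarrow> complex mat) \<Rightarrow>
   (nat \<Rightarrow> 'b measure) \<Rightarrow> (nat \<Rightarrow> 'b \<Rightarrow> complex mat) \<Rightarrow> bool" where
  "green_comparison e P Y Q Z \<longleftrightarrow>
    (\<forall>C1>0. \<exists>\<epsilon>0>0. \<exists>N0. \<forall>F. C4_growth C1 F \<longrightarrow> (\<exists>C::real.
      \<forall>\<epsilon> N. 0 < \<epsilon> \<longrightarrow> \<epsilon> < \<epsilon>0 \<longrightarrow> N \<ge> N0 \<longrightarrow>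
      (\<forall>E E1 E2. \<bar>E - e N\<bar> \<le> real N powr (-2/3 + \<epsilon>) \<longrightarrow>
         \<bar>E1 - e N\<bar> \<le> real N powr (-2/3 + \<epsilon>) \<longrightarrow> \<bar>E2 - e N\<bar> \<le> real N powr (-2/3 + \<epsilon>) \<longrightarrow>
       (let \<eta> = real N powr (-2/3 - \<epsilon>) in
         \<bar>(\<integral>\<omega>. F (real N * \<eta> * Im (emp_stieltjes (Y N \<omega>) (Complex E \<eta>))) \<partial>P N)
          - (\<integral>\<omega>. F (real N * \<eta> * Im (emp_stieltjes (Z N \<omega>) (Complex E \<eta>))) \<partial>Q N)\<bar>
           \<le> C * real N powr (-1/6 + C * \<epsilon>) \<and>
         \<bar>(\<integral>\<omega>. F (im_integral (Y N \<omega>) \<eta> E1 E2) \<partial>P N)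
          - (\<integral>\<omega>. F (im_integral (Z N \<omega>) \<eta> E1 E2) \<partial>Q N)\<bar>
           \<le> C * real N powr (-1/6 + C * \<epsilon>)))))"

text \<open>Since \<open>k\<close> is quantified inside the hypotheses, a function on \<open>\<real>\<^sup>k\<close> is encoded as a function of
  sequences that depends only on the coordinates \<open>1, \<dots>, k\<close>. For such functions continuity in the
  product topology on \<open>nat \<Rightarrow> real\<close> is continuity on \<open>\<real>\<^sup>k\<close>. Smooth means that all iterated partial
  derivatives exist and are continuous; the list \<open>is\<close> gives the order of differentiation, and the
  empty list accounts for boundedness of \<open>F\<close> itself.\<close>

definition partial_deriv :: "nat \<Rightarrow> ((nat \<Rightarrow> real) \<Rightarrow> real) \<Rightarrow> (nat \<Rightarrow> real) \<Rightarrow> real" where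
  "partial_deriv i F x = deriv (\<lambda>t. F (x(i := t))) (x i)"

definition iter_partial :: "nat list \<Rightarrow> ((nat \<Rightarrow> real) \<Rightarrow> real) \<Rightarrow> (nat \<Rightarrow> real) \<Rightarrow> real" where
  "iter_partial is F = foldr partial_deriv is F"

definition bounded_smooth :: "nat \<Rightarrow> ((nat \<Rightarrow> real) \<Rightarrow> real) \<Rightarrow> bool" where
  "bounded_smooth k F \<longleftrightarrow>
     (\<forall>x y. (\<forall>i\<in>{1..k}. x i = y i) \<longrightarrow> F x = F y) \<and>
     (\<forall>is. set is \<subseteq> {1..k} \<longrightarrow>
        continuous_on UNIV (iter_partial is F) \<and>
        bounded (range (iter_partial is F)) \<and>
        (\<forall>i\<in>{1..k}. \<forall>x. (\<lambda>t. iter_partial is F (x(i := t))) differentiable at (x i)))"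

text \<open>The exponent \<open>\<delta>\<close> is chosen after \<open>\<epsilon>\<close> and \<open>N\<close>, but before \<open>E\<close>. As these predicates serve as
  hypotheses, this is weaker than asking for a \<open>\<delta>\<close> independent of \<open>N\<close>. The values of the argument
  of \<open>F\<close> at indices outside \<open>{1..k}\<close> are irrelevant.\<close>

definition multi_comparison_upper ::
  "(nat \<Rightarrow> real) \<Rightarrow> (nat \<Rightarrow> 'a measure) \<Rightarrow> (nat \<Rightarrow> 'a \<Rightarrow> complex mat) \<Rightarrow>
   (nat \<Rightarrow> 'b measure) \<Rightarrow> (nat \<Rightarrow> 'b \<Rightarrow> complex mat) \<Rightarrow> bool" where
  "multi_comparison_upper e P Y Q Z \<longleftrightarrow>
    (\<forall>k\<ge>1. \<forall>F. bounded_smooth k F \<longrightarrow> (\<exists>\<epsilon>0>0. \<exists>N0.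
      \<forall>\<epsilon> N. 0 < \<epsilon> \<longrightarrow> \<epsilon> < \<epsilon>0 \<longrightarrow> N \<ge> N0 \<longrightarrow> (\<exists>\<delta>>0.
      \<forall>E::nat \<Rightarrow> real. (\<forall>j<k. E (Suc j) < E j) \<longrightarrow>
         (\<forall>j\<le>k. \<bar>E j - e N\<bar> \<le> real N powr (-2/3 + \<epsilon>)) \<longrightarrow>
       (let \<eta> = real N powr (-2/3 - \<epsilon>) in
         \<bar>(\<integral>\<omega>. F (\<lambda>j. im_integral (Y N \<omega>) \<eta> (E j) (E 0)) \<partial>P N)
          - (\<integral>\<omega>. F (\<lambda>j. im_integral (Z N \<omega>) \<eta> (E j) (E 0)) \<partial>Q N)\<bar> \<le> real N powr (- \<delta>)))))"

definition multi_comparison_lower ::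
  "(nat \<Rightarrow> real) \<Rightarrow> (nat \<Rightarrow> 'a measure) \<Rightarrow> (nat \<Rightarrow> 'a \<Rightarrow> complex mat) \<Rightarrow>
   (nat \<Rightarrow> 'b measure) \<Rightarrow> (nat \<Rightarrow> 'b \<Rightarrow> complex mat) \<Rightarrow> bool" where
  "multi_comparison_lower e P Y Q Z \<longleftrightarrow>
    (\<forall>k\<ge>1. \<forall>F. bounded_smooth k F \<longrightarrow> (\<exists>\<epsilon>0>0. \<exists>N0.
      \<forall>\<epsilon> N. 0 < \<epsilon> \<longrightarrow> \<epsilon> < \<epsilon>0 \<longrightarrow> N \<ge> N0 \<longrightarrow> (\<exists>\<delta>>0.
      \<forall>E::nat \<Rightarrow> real. (\<forall>j<k. E j < E (Suc j)) \<longrightarrow>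
         (\<forall>j\<le>k. \<bar>E j - e N\<bar> \<le> real N powr (-2/3 + \<epsilon>)) \<longrightarrow>
       (let \<eta> = real N powr (-2/3 - \<epsilon>) in
         \<bar>(\<integral>\<omega>. F (\<lambda>j. im_integral (Y N \<omega>) \<eta> (E 0) (E j)) \<partial>P N)
          - (\<integral>\<omega>. F (\<lambda>j. im_integral (Z N \<omega>) \<eta> (E 0) (E j)) \<partial>Q N)\<bar> \<le> real N powr (- \<delta>)))))"

text \<open>The rescaled distribution function of the \<open>j\<close>-th eigenvalue around the edge \<open>e\<close>.\<close>

definition edge_cdf :: "nat \<Rightarrow> 'a measure \<Rightarrow> ('a \<Rightarrow> complex mat) \<Rightarrow> nat \<Rightarrow> real \<Rightarrow> real \<Rightarrow> real" where
  "edge_cdf N P X j e s =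
     measure P {\<omega> \<in> space P. real N powr (2/3) * (cov_eigval (X \<omega>) j - e) \<le> s}"

end

theory Submission
  imports Defs "HOL-Real_Asymp.Real_Asymp"
begin

text \<open>
  The distribution function of the extreme eigenvalue \<open>U\<close> at an edge \<open>e\<close> is sandwiched between
  expectations of a smooth functional of the Green function, and these are nearly the same for both
  ensembles by the comparison hypothesis for one-dimensional functions.

  All spectral quantities are expressed through the eigenvalues \<open>\<lambda>\<^sub>j\<close>: since the trace of the
  resolvent is a logarithmic derivative of the characteristic polynomial, \<open>N Im m(E + i\<eta>)\<close> is the sum of the
  Poisson kernels \<open>\<eta> / ((\<lambda>\<^sub>j - E)\<^sup>2 + \<eta>\<^sup>2)\<close>, and \<open>N \<integral> Im m(y + i\<eta>) dy\<close> over \<open>[a, b]\<close> is a sum of differences of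
  arctangents, that is \<open>\<pi>\<close> times a smoothed count of the eigenvalues in \<open>[a, b]\<close>. Take \<open>\<eta> = N\<^bsup>-2/3 - \<epsilon>\<^esup>\<close>
  and, at the upper edge, \<open>[a, b] = [E, e + \<kappa>]\<close> with \<open>\<kappa>\<close> slightly larger than \<open>N\<^bsup>-2/3\<^esup>\<close>. Let \<open>w\<close> be slightly smaller
  than \<open>N\<^bsup>-2/3\<^esup>\<close>. If \<open>U \<ge> E + w\<close> then \<open>U\<close> alone contributes at least \<open>\<pi>/2\<close>. If \<open>U \<le> E - w\<close> then all
  eigenvalues are at distance at least \<open>w\<close> from the interval, and comparing the tails of the narrow
  kernels with kernels of width \<open>\<kappa>\<close> centred at \<open>e\<close> bounds the integral by a multiple of
  \<open>(\<kappa>\<^sup>2 \<eta> / w\<^sup>2) N Im m(e + i\<kappa>)\<close>, which is a negative power of \<open>N\<close> (\<open>smoothed_count_le_poisson_sum\<close>). Hence a cutoff function of the integral that is \<open>1\<close> at \<open>0\<close> and vanishes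
  from \<open>1\<close> on distinguishes \<open>U \<le> E - w\<close> from \<open>U \<ge> E + w\<close> (\<open>edge_test_eigval\<close>), which yields the
  sandwich with a shift \<open>2 w = o(N\<^bsup>-2/3\<^esup>)\<close>. The lower edge is the mirror image, once one knows that the
  eigenvalues of index larger than \<open>M\<close> are zero (\<open>cov_eigval_zero\<close>) and that the edge stays away from zero.

  The local law enters only at the points \<open>e + i\<eta>\<close>. There the Marchenko--Pastur transform has a
  square-root singularity, \<open>Im m\<^sub>c \<approx> \<surd>\<eta>\<close> (\<open>mp_stieltjes_edge\<close>), and the local law transports this to \<open>Im m\<close>
  for \<open>\<eta>\<close> slightly above \<open>N\<^bsup>-2/3\<^esup>\<close>. The upper bound is what the tail estimate needs. The lower bound forces
  an eigenvalue within \<open>N\<^bsup>-2/3 + \<epsilon>/20\<^esup>\<close> of the edge, because without one the Poisson sum would be linear in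
  \<open>\<eta>\<close> (\<open>poisson_sum_gap\<close>). Together with the assumed location of the spectrum this confines \<open>U\<close> to a
  small neighbourhood of \<open>e\<close> with high probability, so for \<open>s\<close> outside the range where the comparison is
  available both distribution functions are close to \<open>0\<close> or to \<open>1\<close>. Finally, the events involved are measurable
  because the resolvent entries are quotients of minors and eigenvalue counts are limits of
  smoothed counts.
\<close>

unbundle no vec_syntax

section \<open>Eigenvalues and resolvent of the sample covariance matrix\<close>


lemma sample_cov_carrier: "X \<in> carrier_mat m n \<Longrightarrow> sample_cov X \<in> carrier_mat n n"
  by (auto simp: sample_cov_def mat_adjoint_def mat_of_rows_def)

lemma mat_adjoint_index:
  assumes "X \<in> carrier_mat m n" "i < n" "j < m"
  shows "mat_adjoint X $$ (i, j) = cnj (X $$ (j, i))"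
  using assms by (auto simp: mat_adjoint_def mat_of_rows_index)

lemma sample_cov_index:
  assumes X: "X \<in> carrier_mat m n" and "i < n" "j < n"
  shows "sample_cov X $$ (i, j) = (\<Sum>k<m. cnj (X $$ (k, i)) * X $$ (k, j))"
proof -
  have adj: "mat_adjoint X \<in> carrier_mat n m"
    using X by (auto simp: mat_adjoint_def mat_of_rows_def)
  have "sample_cov X $$ (i, j) = (\<Sum>k<m. mat_adjoint X $$ (i, k) * X $$ (k, j))"
    using X adj assms unfolding sample_cov_def
    by (auto simp: scalar_prod_def atLeast0LessThan intro!: sum.cong)
  also have "\<dots> = (\<Sum>k<m. cnj (X $$ (k, i)) * X $$ (k, j))"
    by (intro sum.cong refl) (use X assms in \<open>auto simp: mat_adjoint_index\<close>)
  finally show ?thesis .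
qed

text \<open>Pairing the eigenvalue equation with an eigenvector \<open>v\<close> gives \<open>a |v|\<^sup>2 = |X v|\<^sup>2\<close>.\<close>

lemma eigenvalue_sample_cov:
  assumes X: "X \<in> carrier_mat m n" and ev: "eigenvalue (sample_cov X) a"
  shows "Im a = 0" "Re a \<ge> 0"
proof -
  let ?H = "sample_cov X"
  obtain v where v: "v \<in> carrier_vec n" "v \<noteq> 0\<^sub>v n" "?H *\<^sub>v v = a \<cdot>\<^sub>v v"
    using ev sample_cov_carrier[OF X] unfolding eigenvalue_def eigenvector_def by auto
  define w where "w k = (\<Sum>j<n. X $$ (k, j) * v $ j)" for k
  have Hv: "(\<Sum>j<n. ?H $$ (i, j) * v $ j) = a * v $ i" if "i < n" for i
  proof -
    have "(?H *\<^sub>v v) $ i = (\<Sum>j<n. ?H $$ (i, j) * v $ j)"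
      using that v(1) sample_cov_carrier[OF X]
      by (auto simp: scalar_prod_def atLeast0LessThan intro!: sum.cong)
    then show ?thesis using v that by auto
  qed
  have "(\<Sum>i<n. cnj (v $ i) * (\<Sum>j<n. ?H $$ (i, j) * v $ j)) =
        (\<Sum>i<n. \<Sum>j<n. \<Sum>k<m. cnj (X $$ (k, i) * v $ i) * (X $$ (k, j) * v $ j))"
    by (simp add: sample_cov_index[OF X] sum_distrib_left sum_distrib_right mult_ac)
  also have "\<dots> = (\<Sum>i<n. \<Sum>k<m. \<Sum>j<n. cnj (X $$ (k, i) * v $ i) * (X $$ (k, j) * v $ j))"
    by (intro sum.cong refl sum.swap)
  also have "\<dots> = (\<Sum>k<m. \<Sum>i<n. \<Sum>j<n. cnj (X $$ (k, i) * v $ i) * (X $$ (k, j) * v $ j))"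
    by (rule sum.swap)
  also have "\<dots> = (\<Sum>k<m. cnj (w k) * w k)"
    unfolding w_def cnj_sum sum_product ..
  also have "\<dots> = of_real (\<Sum>k<m. (cmod (w k))\<^sup>2)"
    by (simp add: complex_norm_square[unfolded of_real_power] mult.commute)
  finally have 1: "(\<Sum>i<n. cnj (v $ i) * (\<Sum>j<n. ?H $$ (i, j) * v $ j)) = of_real (\<Sum>k<m. (cmod (w k))\<^sup>2)" .
  have "(\<Sum>i<n. cnj (v $ i) * (\<Sum>j<n. ?H $$ (i, j) * v $ j)) = (\<Sum>i<n. cnj (v $ i) * (a * v $ i))"
    by (intro sum.cong refl) (simp add: Hv)
  also have "\<dots> = a * (\<Sum>i<n. cnj (v $ i) * v $ i)"
    by (simp add: sum_distrib_left mult_ac)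
  also have "(\<Sum>i<n. cnj (v $ i) * v $ i) = of_real (\<Sum>i<n. (cmod (v $ i))\<^sup>2)"
    by (simp add: complex_norm_square[unfolded of_real_power] mult.commute)
  finally have 2: "a * of_real (\<Sum>i<n. (cmod (v $ i))\<^sup>2) = of_real (\<Sum>k<m. (cmod (w k))\<^sup>2)"
    using 1 by simp
  have "\<exists>i<n. v $ i \<noteq> 0"
    using v(1,2) by (metis carrier_vecD eq_vecI index_zero_vec(1) index_zero_vec(2))
  then have pos: "(\<Sum>i<n. (cmod (v $ i))\<^sup>2) > 0"
    by (auto intro!: sum_pos2)
  define R S where "R = (\<Sum>k<m. (cmod (w k))\<^sup>2)" and "S = (\<Sum>i<n. (cmod (v $ i))\<^sup>2)"
  have "S > 0" "R \<ge> 0" using pos by (auto simp: R_def S_def intro: sum_nonneg)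
  have "a * of_real S = of_real R" using 2 unfolding R_def S_def .
  then have "a = of_real R / of_real S" using \<open>S > 0\<close> by (simp add: divide_simps)
  then have "a = of_real (R / S)" by simp
  then have "Im a = 0 \<and> Re a \<ge> 0"
    using \<open>S > 0\<close> \<open>R \<ge> 0\<close> by simp
  then show "Im a = 0" "Re a \<ge> 0" by auto
qed

lemma poly_char_poly_eq_det:
  fixes A :: "complex mat"
  assumes A: "A \<in> carrier_mat n n"
  shows "poly (char_poly A) z = det (z \<cdot>\<^sub>m 1\<^sub>m n - A)"
proof -
  have h: "comm_ring_hom (\<lambda>p. poly p z)" by unfold_locales auto
  have "poly (char_poly A) z = det (map_mat (\<lambda>p. poly p z) (char_poly_matrix A))"
    unfolding char_poly_def by (rule comm_ring_hom.hom_det[OF h, symmetric])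
  also have "map_mat (\<lambda>p. poly p z) (char_poly_matrix A) = z \<cdot>\<^sub>m 1\<^sub>m n - A"
    using A by (intro eq_matI) (auto simp: char_poly_matrix_def)
  finally show ?thesis .
qed

text \<open>Block elimination in the matrix \<open>[[z, A], [B, 1]]\<close>, along either diagonal block, evaluates its
  determinant in two ways. With \<open>A = X\<^sup>\<dagger>\<close> and \<open>B = X\<close> the result says that \<open>X\<^sup>\<dagger> X\<close> and \<open>X X\<^sup>\<dagger>\<close> have
  the same nonzero eigenvalues with multiplicity.\<close>

lemma char_poly_mult_swap:
  fixes A B :: "complex mat"
  assumes A: "A \<in> carrier_mat n m" and B: "B \<in> carrier_mat m n"
  shows "monom 1 m * char_poly (A * B) = monom 1 n * char_poly (B * A)"
proof -
  have AB: "A * B \<in> carrier_mat n n" and BA: "B * A \<in> carrier_mat m m"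
    using A B by auto
  have eq: "z ^ m * poly (char_poly (A * B)) z = z ^ n * poly (char_poly (B * A)) z"
    if z: "z \<noteq> 0" for z
  proof -
    \<comment> \<open>\<open>K\<close> is the block matrix; \<open>R\<close> clears its lower left block from the right and \<open>L\<close> from the left.\<close>
    define K where "K = four_block_mat (z \<cdot>\<^sub>m 1\<^sub>m n) A B (1\<^sub>m m)"
    define R where "R = four_block_mat (1\<^sub>m n) (0\<^sub>m n m) (- B) (1\<^sub>m m)"
    define L where "L = four_block_mat (1\<^sub>m n) (0\<^sub>m n m) (- (1 / z) \<cdot>\<^sub>m B) (1\<^sub>m m)"
    have K: "K \<in> carrier_mat (n + m) (n + m)" and R: "R \<in> carrier_mat (n + m) (n + m)"
      and L: "L \<in> carrier_mat (n + m) (n + m)"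
      unfolding K_def R_def L_def using A B by auto
    have "det R = 1" unfolding R_def
      by (subst det_four_block_mat_upper_right_zero[where n = n and m = m]) (use B in auto)
    moreover have "det L = 1" unfolding L_def
      by (subst det_four_block_mat_upper_right_zero[where n = n and m = m]) (use B in auto)
    moreover have "K * R = four_block_mat (z \<cdot>\<^sub>m 1\<^sub>m n - A * B) A (0\<^sub>m m n) (1\<^sub>m m)"
      unfolding K_def R_def
      by (subst mult_four_block_mat[where ?nr1.0 = n and ?n1.0 = n and ?n2.0 = m and ?nr2.0 = m
            and ?nc1.0 = n and ?nc2.0 = m])
         (use A B in \<open>auto intro!: arg_cong4[where f = four_block_mat]\<close>)
    moreover have "L * K = four_block_mat (z \<cdot>\<^sub>m 1\<^sub>m n) A (0\<^sub>m m n) (1\<^sub>m m - (1 / z) \<cdot>\<^sub>m (B * A))"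
      unfolding K_def L_def
      by (subst mult_four_block_mat[where ?nr1.0 = n and ?n1.0 = n and ?n2.0 = m and ?nr2.0 = m
            and ?nc1.0 = n and ?nc2.0 = m])
         (use A B z in auto)
    moreover have "det (four_block_mat (z \<cdot>\<^sub>m 1\<^sub>m n - A * B) A (0\<^sub>m m n) (1\<^sub>m m)) = det (z \<cdot>\<^sub>m 1\<^sub>m n - A * B)"
      by (subst det_four_block_mat_lower_left_zero[where n = n and m = m]) (use A B in auto)
    moreover have "det (four_block_mat (z \<cdot>\<^sub>m 1\<^sub>m n) A (0\<^sub>m m n) (1\<^sub>m m - (1 / z) \<cdot>\<^sub>m (B * A))) =
        z ^ n * det (1\<^sub>m m - (1 / z) \<cdot>\<^sub>m (B * A))"
      by (subst det_four_block_mat_lower_left_zero[where n = n and m = m]) (use A B in auto)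
    moreover have "det (K * R) = det (L * K)"
      using K R L calculation(1,2) by (simp add: det_mult)
    ultimately have "det (z \<cdot>\<^sub>m 1\<^sub>m n - A * B) = z ^ n * det (1\<^sub>m m - (1 / z) \<cdot>\<^sub>m (B * A))"
      by simp
    moreover have "1\<^sub>m m - (1 / z) \<cdot>\<^sub>m (B * A) = (1 / z) \<cdot>\<^sub>m (z \<cdot>\<^sub>m 1\<^sub>m m - B * A)"
      using A B z by (intro eq_matI) (auto simp: diff_divide_distrib)
    ultimately show ?thesis
      using A AB BA z by (simp add: poly_char_poly_eq_det[OF AB] poly_char_poly_eq_det[OF BA] power_divide)
  qed
  have "poly (monom 1 m * char_poly (A * B) - monom 1 n * char_poly (B * A)) z = 0" if "z \<noteq> 0" for z
    using eq[OF that] by (simp add: poly_monom)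
  then have "- {0} \<subseteq> {z. poly (monom 1 m * char_poly (A * B) - monom 1 n * char_poly (B * A)) z = 0}"
    by auto
  moreover have "infinite (- {0 :: complex})"
    by (simp add: Compl_eq_Diff_UNIV infinite_UNIV_char_0)
  ultimately have "monom 1 m * char_poly (A * B) - monom 1 n * char_poly (B * A) = 0"
    using poly_roots_finite infinite_super by blast
  then show ?thesis by simp
qed

lemma det_sample_cov_minus:
  assumes X: "X \<in> carrier_mat m n" and z: "Im z > 0"
  shows "det (sample_cov X - z \<cdot>\<^sub>m 1\<^sub>m n) \<noteq> 0"
proof
  let ?H = "sample_cov X"
  have H: "?H \<in> carrier_mat n n" by (rule sample_cov_carrier[OF X])
  assume "det (?H - z \<cdot>\<^sub>m 1\<^sub>m n) = 0"
  moreover have "?H - z \<cdot>\<^sub>m 1\<^sub>m n = (-1) \<cdot>\<^sub>m (z \<cdot>\<^sub>m 1\<^sub>m n - ?H)"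
    using H by (intro eq_matI) auto
  ultimately have "poly (char_poly ?H) z = 0"
    using H by (simp add: poly_char_poly_eq_det)
  then have "eigenvalue ?H z" using H by (simp add: eigenvalue_root_char_poly)
  then show False using eigenvalue_sample_cov(1)[OF X] z by simp
qed

lemma mat_inverse_entry:
  fixes A :: "complex mat"
  assumes A: "A \<in> carrier_mat n n" and d: "det A \<noteq> 0" and "i < n" "j < n"
  shows "the (mat_inverse A) $$ (i, j) = cofactor A j i / det A"
proof -
  have "mat_inverse A \<noteq> None"
    using mat_inverse(1)[OF A, of undefined] det_non_zero_imp_unit[OF A d, of undefined] by metis
  then obtain B where B: "mat_inverse A = Some B" by blast
  note B' = mat_inverse(2)[OF A B]
  note adj = adj_mat[OF A]
  have "adj_mat A = (adj_mat A * A) * B"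
    using assoc_mult_mat[OF adj(1) A, of B n] B' adj(1) by simp
  then have "adj_mat A = det A \<cdot>\<^sub>m B"
    unfolding adj(3) using B' by (simp add: mult_smult_assoc_mat[of _ n n _ n] left_mult_one_mat[of _ n n])
  then have "cofactor A j i = det A * B $$ (i, j)"
    using A B' assms(3,4) unfolding adj_mat_def
    by (metis (no_types, lifting) carrier_matD index_mat(1) index_smult_mat(1) old.prod.case)
  then show ?thesis using B d by simp
qed

text \<open>Cramer's rule writes the resolvent as a quotient of polynomials in \<open>z\<close> and in the entries of
  \<open>X\<close>. This gives measurability in all these variables at once, and below the trace as a
  logarithmic derivative.\<close>

lemma green_entry:
  assumes X: "X \<in> carrier_mat m n" and z: "Im z > 0" and ij: "i < n" "j < n"
  shows "green X z $$ (i, j) =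
    cofactor (sample_cov X - z \<cdot>\<^sub>m 1\<^sub>m n) j i / det (sample_cov X - z \<cdot>\<^sub>m 1\<^sub>m n)"
proof -
  have "sample_cov X - z \<cdot>\<^sub>m 1\<^sub>m n \<in> carrier_mat n n" 
    using sample_cov_carrier[OF X] by auto
  moreover have "dim_col X = n" using X by auto
  ultimately show ?thesis
    unfolding green_def using mat_inverse_entry[OF _ det_sample_cov_minus[OF X z] ij] by simp
qed

text \<open>The diagonal cofactors of \<open>H - z\<close> are, up to sign, the characteristic polynomials of the
  principal submatrices of size \<open>n - 1\<close>, and these add up to the derivative of the characteristic polynomial of \<open>H\<close>.\<close>

lemma trace_green:
  assumes X: "X \<in> carrier_mat m n" and z: "Im z > 0"
  shows "(\<Sum>k<n. green X z $$ (k, k)) =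
    - poly (pderiv (char_poly (sample_cov X))) z / poly (char_poly (sample_cov X)) z"
proof -
  let ?H = "sample_cov X"
  have H: "?H \<in> carrier_mat n n" by (rule sample_cov_carrier[OF X])
  have neg: "?H - z \<cdot>\<^sub>m 1\<^sub>m n = (-1) \<cdot>\<^sub>m (z \<cdot>\<^sub>m 1\<^sub>m n - ?H)"
    using H by (intro eq_matI) auto
  have p: "det (?H - z \<cdot>\<^sub>m 1\<^sub>m n) = (-1) ^ n * poly (char_poly ?H) z"
    unfolding neg poly_char_poly_eq_det[OF H]
    using carrier_matD(2)[OF H] by (simp only: det_smult index_minus_mat)
  have c: "cofactor (?H - z \<cdot>\<^sub>m 1\<^sub>m n) k k = (-1) ^ (n - 1) * poly (char_poly (mat_delete ?H k k)) z"
    if k: "k < n" for k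
  proof -
    have D: "mat_delete ?H k k \<in> carrier_mat (n - 1) (n - 1)"
      using H mat_delete_carrier by blast
    have del: "mat_delete (?H - z \<cdot>\<^sub>m 1\<^sub>m n) k k = (-1) \<cdot>\<^sub>m (z \<cdot>\<^sub>m 1\<^sub>m (n - 1) - mat_delete ?H k k)"
      using H k D by (intro eq_matI) (auto simp: mat_delete_def)
    have "det ((-1) \<cdot>\<^sub>m (z \<cdot>\<^sub>m 1\<^sub>m (n - 1) - mat_delete ?H k k)) =
        (-1) ^ (n - 1) * det (z \<cdot>\<^sub>m 1\<^sub>m (n - 1) - mat_delete ?H k k)"
      using carrier_matD(2)[OF D] by (simp only: det_smult index_minus_mat)
    then show ?thesis
      unfolding cofactor_def del poly_char_poly_eq_det[OF D] by simp
  qed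
  have "(\<Sum>k<n. green X z $$ (k, k)) =
      (\<Sum>k<n. (-1) ^ (n - 1) * poly (char_poly (mat_delete ?H k k)) z) / ((-1) ^ n * poly (char_poly ?H) z)"
    by (simp add: green_entry[OF X z] c p sum_divide_distrib)
  also have "\<dots> = (-1) ^ (n - 1) * poly (pderiv (char_poly ?H)) z / ((-1) ^ n * poly (char_poly ?H) z)"
    by (simp add: pderiv_char_poly[OF H] poly_sum sum_distrib_left)
  also have "\<dots> = - poly (pderiv (char_poly ?H)) z / poly (char_poly ?H) z"
  proof (cases n)
    case 0
    then have "pderiv (char_poly ?H) = 0"
      using degree_monic_char_poly[OF H] by (simp add: pderiv_eq_0_iff)
    then show ?thesis by simp
  qed simp
  finally show ?thesis .
qed

lemma log_deriv_prod_linear: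
  fixes as :: "complex list"
  assumes "\<forall>a\<in>set as. z \<noteq> a"
  shows "poly (pderiv (\<Prod>a\<leftarrow>as. [:- a, 1:])) z / poly (\<Prod>a\<leftarrow>as. [:- a, 1:]) z = (\<Sum>a\<leftarrow>as. 1 / (z - a))"
  using assms
proof (induction as)
  case (Cons a as)
  have "poly (\<Prod>a\<leftarrow>as. [:- a, 1:]) z \<noteq> 0"
    using Cons.prems by (induction as) (auto simp: )
  then show ?case
    using Cons by (simp add: pderiv_mult pderiv_pCons field_simps del: mult_pCons_left)
qed simp

lemma mset_proots_factorized:
  assumes "p = (\<Prod>a\<leftarrow>as. [:- a, 1 :: complex:])"
  shows "proots p = mset as"
proof -
  have "(\<Prod>a\<leftarrow>as. [:- a, 1 :: complex:]) \<noteq> 0 \<and> proots (\<Prod>a\<leftarrow>as. [:- a, 1 :: complex:]) = mset as"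
    by (induction as) (auto simp: proots_mult simp del: mult_pCons_left)
  then show ?thesis using assms by simp
qed

lemma eigvals_mset:
  assumes X: "X \<in> carrier_mat m n"
  shows "image_mset (cov_eigval X) (mset_set {1..n}) = image_mset Re (proots (char_poly (sample_cov X)))"
    and "\<lbrakk>1 \<le> i; i \<le> j; j \<le> n\<rbrakk> \<Longrightarrow> cov_eigval X j \<le> cov_eigval X i"
proof -
  define xs where "xs = sorted_list_of_multiset (image_mset Re (proots (char_poly (sample_cov X))))"
  have len: "length xs = n"
  proof -
    have "length xs = size (proots (char_poly (sample_cov X)))"
      unfolding xs_def by (metis mset_sorted_list_of_multiset size_image_mset size_mset)
    then show ?thesis
      using degree_monic_char_poly[OF sample_cov_carrier[OF X]] by (simp add: size_proots_complex)
  qed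
  have "image_mset (cov_eigval X) (mset_set {1..n}) = mset (map (cov_eigval X) [1..<n + 1])"
    by (simp only: mset_map mset_upt atLeastLessThanSuc_atLeastAtMost Suc_eq_plus1[symmetric])
  also have "map (cov_eigval X) [1..<n + 1] = rev xs"
    unfolding cov_eigval_def xs_def[symmetric]
    by (intro nth_equalityI) (auto simp: len simp del: upt_Suc)
  finally show "image_mset (cov_eigval X) (mset_set {1..n}) = image_mset Re (proots (char_poly (sample_cov X)))"
    by (simp add: xs_def)
  show "cov_eigval X j \<le> cov_eigval X i" if "1 \<le> i" "i \<le> j" "j \<le> n"
  proof -
    have "cov_eigval X j = xs ! (n - j)" "cov_eigval X i = xs ! (n - i)"
      using that len unfolding cov_eigval_def xs_def[symmetric] by (auto simp: rev_nth)
    moreover have "sorted xs" unfolding xs_def by simp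
    ultimately show ?thesis using that len by (auto intro!: sorted_nth_mono)
  qed
qed

lemma sum_eigvals:
  fixes f :: "real \<Rightarrow> 'b :: comm_monoid_add"
  assumes X: "X \<in> carrier_mat m n"
  shows "(\<Sum>j=1..n. f (cov_eigval X j)) = (\<Sum>a\<in>#proots (char_poly (sample_cov X)). f (Re a))"
proof -
  have "(\<Sum>j=1..n. f (cov_eigval X j)) = sum_mset (image_mset f (image_mset (cov_eigval X) (mset_set {1..n})))"
    by (simp add: sum_unfold_sum_mset image_mset.compositionality o_def)
  then show ?thesis
    unfolding eigvals_mset(1)[OF X] by (simp add: image_mset.compositionality o_def)
qed

lemma proots_sample_cov:
  assumes X: "X \<in> carrier_mat m n" and a: "a \<in># proots (char_poly (sample_cov X))"
  shows "a = of_real (Re a)" "Re a \<ge> 0"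
proof -
  have "char_poly (sample_cov X) \<noteq> 0"
    using degree_monic_char_poly[OF sample_cov_carrier[OF X]] by auto
  then have "poly (char_poly (sample_cov X)) a = 0" using a by simp
  then have "eigenvalue (sample_cov X) a"
    by (simp add: eigenvalue_root_char_poly[OF sample_cov_carrier[OF X]])
  from eigenvalue_sample_cov[OF X this] show "a = of_real (Re a)" "Re a \<ge> 0"
    by (auto simp: complex_eq_iff)
qed

lemma cov_eigval_nonneg:
  assumes X: "X \<in> carrier_mat m n" and j: "1 \<le> j" "j \<le> n"
  shows "cov_eigval X j \<ge> 0"
proof -
  have "cov_eigval X j \<in># image_mset (cov_eigval X) (mset_set {1..n})" using j by auto
  then show ?thesis
    unfolding eigvals_mset(1)[OF X] using proots_sample_cov(2)[OF X] by auto
qed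

text \<open>Comparing the order of the root \<open>0\<close> on both sides of the identity \<open>char_poly_mult_swap\<close> shows that at
  least \<open>n - m\<close> eigenvalues vanish; as all are nonnegative, these are the last ones in the ordering.\<close>

lemma cov_eigval_zero:
  assumes X: "X \<in> carrier_mat m n" and j: "m < j" "j \<le> n"
  shows "cov_eigval X j = 0"
proof (rule ccontr)
  let ?H = "sample_cov X" let ?K = "X * mat_adjoint X"
  have adj: "mat_adjoint X \<in> carrier_mat n m"
    using X by (auto simp: mat_adjoint_def mat_of_rows_def)
  have nz: "char_poly ?H \<noteq> 0" "char_poly ?K \<noteq> 0"
    using degree_monic_char_poly[OF sample_cov_carrier[OF X]] degree_monic_char_poly[of ?K m] X adj by auto
  have "monom 1 m * char_poly ?H = monom 1 n * char_poly ?K"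
    using char_poly_mult_swap[OF adj X] by (simp add: sample_cov_def)
  then have "proots (monom 1 m) + proots (char_poly ?H) = proots (monom 1 n) + proots (char_poly ?K)"
    using nz by (metis proots_mult monom_eq_0_iff zero_neq_one)
  then have "count (proots (monom 1 m) + proots (char_poly ?H)) 0 =
    count (proots (monom 1 n) + proots (char_poly ?K)) 0" by simp
  moreover have "Polynomial.order 0 (monom 1 k :: complex poly) = k" for k
    by (metis (no_types, lifting) order_0_monom zero_neq_one)
  ultimately have "n - m \<le> count (proots (char_poly ?H)) 0" using nz by simp
  also have "\<dots> \<le> count (image_mset Re (proots (char_poly ?H))) 0"
  proof (cases "0 \<in># proots (char_poly ?H)")
    case True
    then show ?thesis unfolding count_image_mset'
      by (intro member_le_sum[of 0 _ "count (proots (char_poly ?H))"]) auto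
  qed (simp add: not_in_iff)
  also have "\<dots> = card {i\<in>{1..n}. cov_eigval X i = 0}"
    unfolding eigvals_mset(1)[OF X, symmetric] by (simp add: count_image_mset' conj_commute)
  finally have *: "n - m \<le> card {i\<in>{1..n}. cov_eigval X i = 0}" .
  assume "cov_eigval X j \<noteq> 0"
  then have "cov_eigval X j > 0" using cov_eigval_nonneg[OF X, of j] j by simp
  then have "{i\<in>{1..n}. cov_eigval X i = 0} \<subseteq> {j + 1..n}"
    using eigvals_mset(2)[OF X, of _ j] j by (force simp: not_le[symmetric])
  then have "card {i\<in>{1..n}. cov_eigval X i = 0} \<le> n - j"
    by (metis card_atLeastAtMost card_mono diff_Suc_Suc finite_atLeastAtMost Suc_eq_plus1)
  with * j show False by linarith
qed

lemma emp_stieltjes_eigvals: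
  assumes X: "X \<in> carrier_mat m n" and z: "Im z > 0"
  shows "emp_stieltjes X z = (\<Sum>j=1..n. 1 / (of_real (cov_eigval X j) - z)) / of_nat n"
proof -
  let ?p = "char_poly (sample_cov X)"
  obtain as where as: "?p = (\<Prod>a\<leftarrow>as. [:- a, 1:])"
    using char_poly_factorized[OF sample_cov_carrier[OF X]] by blast
  have pr: "proots ?p = mset as" by (rule mset_proots_factorized[OF as])
  have real: "a = of_real (Re a)" if "a \<in> set as" for a
    using proots_sample_cov(1)[OF X, of a] that pr by simp
  have "(\<Sum>k<n. green X z $$ (k, k)) = - (\<Sum>a\<leftarrow>as. 1 / (z - a))"
  proof -
    have "\<forall>a\<in>set as. z \<noteq> a" using real z by (metis Im_complex_of_real less_irrefl)
    from log_deriv_prod_linear[OF this] show ?thesis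
      unfolding trace_green[OF X z] as by simp
  qed
  also have "\<dots> = (\<Sum>a\<leftarrow>as. 1 / (of_real (Re a) - z))"
    unfolding uminus_sum_list_map[unfolded o_def]
    by (intro arg_cong[where f = sum_list] map_cong refl) (metis real minus_diff_eq minus_divide_right)
  also have "\<dots> = (\<Sum>j=1..n. 1 / (of_real (cov_eigval X j) - z))"
    unfolding sum_eigvals[OF X, of "\<lambda>x. 1 / (of_real x - z)"] pr
    by (metis mset_map sum_mset_sum_list)
  finally show ?thesis using X by (simp add: emp_stieltjes_def)
qed

section \<open>Measurability\<close>

lemma borel_measurable_det:
  fixes A :: "'a \<Rightarrow> complex mat"
  assumes A: "\<And>\<omega>. \<omega> \<in> space M \<Longrightarrow> A \<omega> \<in> carrier_mat n n"
    and meas: "\<And>i j. i < n \<Longrightarrow> j < n \<Longrightarrow> (\<lambda>\<omega>. A \<omega> $$ (i, j)) \<in> borel_measurable M"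
  shows "(\<lambda>\<omega>. det (A \<omega>)) \<in> borel_measurable M"
proof -
  have "(\<lambda>\<omega>. \<Sum>p | p permutes {0..<n}. signof p * (\<Prod>i = 0..<n. A \<omega> $$ (i, p i))) \<in> borel_measurable M"
  proof (intro borel_measurable_sum borel_measurable_times borel_measurable_const borel_measurable_prod)
    fix p i assume "p \<in> {p. p permutes {0..<n}}" "i \<in> {0..<n}"
    then show "(\<lambda>\<omega>. A \<omega> $$ (i, p i)) \<in> borel_measurable M"
      using permutes_in_image[of p "{0..<n}" i] by (intro meas) auto
  qed
  then show ?thesis
    by (rule measurable_cong[THEN iffD1, rotated]) (simp add: det_def'[OF A])
qed

lemma borel_measurable_cofactor:
  fixes A :: "'a \<Rightarrow> complex mat"
  assumes A: "\<And>\<omega>. \<omega> \<in> space M \<Longrightarrow> A \<omega> \<in> carrier_mat n n"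
    and meas: "\<And>i j. i < n \<Longrightarrow> j < n \<Longrightarrow> (\<lambda>\<omega>. A \<omega> $$ (i, j)) \<in> borel_measurable M"
    and kl: "k < n" "l < n"
  shows "(\<lambda>\<omega>. cofactor (A \<omega>) k l) \<in> borel_measurable M"
  unfolding cofactor_def
proof (intro borel_measurable_times borel_measurable_const borel_measurable_det[of _ _ "n - 1"])
  show "mat_delete (A \<omega>) k l \<in> carrier_mat (n - 1) (n - 1)" if "\<omega> \<in> space M" for \<omega>
    using A[OF that] mat_delete_carrier by blast
  fix i j assume ij: "i < n - 1" "j < n - 1"
  have "(\<lambda>\<omega>. A \<omega> $$ (if i < k then i else Suc i, if j < l then j else Suc j)) \<in> borel_measurable M"
    using ij by (intro meas) auto
  then show "(\<lambda>\<omega>. mat_delete (A \<omega>) k l $$ (i, j)) \<in> borel_measurable M"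
    by (rule measurable_cong[THEN iffD1, rotated]) (use ij in \<open>simp add: mat_delete_def carrier_matD[OF A]\<close>)
qed

lemma borel_measurable_emp_stieltjes:
  assumes X: "random_mat P m n X" and \<eta>: "\<eta> > 0"
  shows "(\<lambda>(\<omega>, y). emp_stieltjes (X \<omega>) (Complex y \<eta>)) \<in> borel_measurable (P \<Otimes>\<^sub>M lborel)"
proof -
  have Xc: "X \<omega> \<in> carrier_mat m n" if "\<omega> \<in> space P" for \<omega>
    using X that by (auto simp: random_mat_def)
  have Xm: "(\<lambda>\<omega>. X \<omega> $$ (i, j)) \<in> borel_measurable P" if "i < m" "j < n" for i j
    using X that by (auto simp: random_mat_def)
  define A where "A = (\<lambda>(\<omega>, y). sample_cov (X \<omega>) - Complex y \<eta> \<cdot>\<^sub>m 1\<^sub>m n)"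
  have A: "A p \<in> carrier_mat n n" if "p \<in> space (P \<Otimes>\<^sub>M lborel)" for p
    using that sample_cov_carrier[OF Xc] by (auto simp: A_def space_pair_measure)
  have meas: "(\<lambda>p. A p $$ (i, j)) \<in> borel_measurable (P \<Otimes>\<^sub>M lborel)" if ij: "i < n" "j < n" for i j
  proof -
    have [measurable]: "(\<lambda>y. Complex y \<eta>) \<in> borel_measurable lborel"
      unfolding Complex_eq by measurable
    have H: "(\<lambda>\<omega>. \<Sum>k<m. cnj (X \<omega> $$ (k, i)) * X \<omega> $$ (k, j)) \<in> borel_measurable P"
      by (intro borel_measurable_sum borel_measurable_times Xm
          measurable_compose[OF Xm borel_measurable_continuous_onI[OF continuous_on_cnj[OF continuous_on_id]], simplified o_def])
         (use ij in auto)
    have "(\<lambda>p. (\<Sum>k<m. cnj (X (fst p) $$ (k, i)) * X (fst p) $$ (k, j))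
         - (if i = j then Complex (snd p) \<eta> else 0)) \<in> borel_measurable (P \<Otimes>\<^sub>M lborel)"
      using measurable_compose[OF measurable_fst H] by measurable
    then show ?thesis
      by (rule measurable_cong[THEN iffD1, rotated])
         (use ij sample_cov_carrier[OF Xc] in
           \<open>auto simp: A_def space_pair_measure sample_cov_index[OF Xc]\<close>)
  qed
  have "(\<lambda>p. (\<Sum>k<n. cofactor (A p) k k / det (A p)) / of_nat n) \<in> borel_measurable (P \<Otimes>\<^sub>M lborel)"
    by (intro borel_measurable_divide borel_measurable_const borel_measurable_sum
        borel_measurable_cofactor[of _ _ n] borel_measurable_det[of _ _ n]) (use A meas in auto)
  then show ?thesis
  proof (rule measurable_cong[THEN iffD1, rotated])
    fix p assume "p \<in> space (P \<Otimes>\<^sub>M (lborel :: real measure))"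
    then have *: "X (fst p) \<in> carrier_mat m n" using Xc by (auto simp: space_pair_measure)
    then show "(\<Sum>k<n. cofactor (A p) k k / det (A p)) / of_nat n =
        (case p of (\<omega>, y) \<Rightarrow> emp_stieltjes (X \<omega>) (Complex y \<eta>))"
      using green_entry[OF *, of "Complex (snd p) \<eta>"] \<eta>
      by (simp add: emp_stieltjes_def A_def case_prod_beta)
  qed
qed

lemma borel_measurable_im_integral:
  assumes X: "random_mat P m n X" and \<eta>: "\<eta> > 0" and ab: "a \<le> b"
  shows "(\<lambda>\<omega>. im_integral (X \<omega>) \<eta> a b) \<in> borel_measurable P"
proof -
  note [measurable] = borel_measurable_emp_stieltjes[OF X \<eta>]
  have "(\<lambda>(\<omega>, y). indicator (einterval (ereal a) (ereal b)) y *\<^sub>R Im (emp_stieltjes (X \<omega>) (Complex y \<eta>)))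
      \<in> borel_measurable (P \<Otimes>\<^sub>M lborel)"
    by measurable
  then have "(\<lambda>\<omega>. \<integral>y. indicator (einterval (ereal a) (ereal b)) y *\<^sub>R
      Im (emp_stieltjes (X \<omega>) (Complex y \<eta>)) \<partial>lborel) \<in> borel_measurable P"
    by (rule lborel.borel_measurable_lebesgue_integral)
  then have "(\<lambda>\<omega>. real n * (\<integral>y. indicator (einterval (ereal a) (ereal b)) y *\<^sub>R
      Im (emp_stieltjes (X \<omega>) (Complex y \<eta>)) \<partial>lborel)) \<in> borel_measurable P"
    by measurable
  then show ?thesis
    by (rule measurable_cong[THEN iffD1, rotated])
       (use X ab in \<open>auto simp: im_integral_def interval_lebesgue_integral_def set_lebesgue_integral_def random_mat_def\<close>)
qed

lemma Im_emp_stieltjes: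
  assumes X: "X \<in> carrier_mat m n" and n: "n > 0" and \<eta>: "\<eta> > 0"
  shows "real n * Im (emp_stieltjes X (Complex E \<eta>)) =
    (\<Sum>j=1..n. \<eta> / ((cov_eigval X j - E)\<^sup>2 + \<eta>\<^sup>2))"
proof -
  have "real n * Im (emp_stieltjes X (Complex E \<eta>)) =
     Im (\<Sum>j=1..n. 1 / (complex_of_real (cov_eigval X j) - Complex E \<eta>))"
    using n unfolding emp_stieltjes_eigvals[OF X, of "Complex E \<eta>", simplified, OF \<eta>] by simp
  then show ?thesis by (simp add: Im_divide)
qed

lemma im_integral_eq:
  assumes X: "X \<in> carrier_mat m n" and n: "n > 0" and \<eta>: "\<eta> > 0" and ab: "a \<le> b"
  shows "im_integral X \<eta> a b =
    (\<Sum>j=1..n. arctan ((b - cov_eigval X j) / \<eta>) - arctan ((a - cov_eigval X j) / \<eta>))"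
proof -
  let ?G = "\<lambda>y. \<Sum>j=1..n. arctan ((y - cov_eigval X j) / \<eta>)"
  let ?g = "\<lambda>y. \<Sum>j=1..n. \<eta> / ((cov_eigval X j - y)\<^sup>2 + \<eta>\<^sup>2)"
  have pos: "(cov_eigval X j - y)\<^sup>2 + \<eta>\<^sup>2 \<noteq> 0" for j y
    using \<eta> by (metis add_nonneg_pos less_irrefl zero_le_power2 zero_less_power)
  have "(LBINT y=ereal a..ereal b. ?g y) = ?G b - ?G a"
  proof (rule interval_integral_FTC_finite)
    show "continuous_on {min a b..max a b} ?g"
      by (intro continuous_intros ballI) (rule pos)
    fix y
    have "((\<lambda>y. arctan ((y - cov_eigval X j) / \<eta>)) has_real_derivative
        \<eta> / ((cov_eigval X j - y)\<^sup>2 + \<eta>\<^sup>2)) (at y within S)" for j S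
    proof -
      have "1 / \<eta> * inverse (1 + ((y - cov_eigval X j) / \<eta>)\<^sup>2) = \<eta> / ((cov_eigval X j - y)\<^sup>2 + \<eta>\<^sup>2)"
        using \<eta> pos[of j y] by (simp add: field_simps power2_eq_square)
      then show ?thesis
        using \<eta> by (auto intro!: derivative_eq_intros simp: divide_inverse mult.commute)
    qed
    then have "(?G has_real_derivative ?g y) (at y within {min a b..max a b})"
      by (intro DERIV_sum) auto
    then show "(?G has_vector_derivative ?g y) (at y within {min a b..max a b})"
      by (simp add: has_real_derivative_iff_has_vector_derivative)
  qed
  moreover have "im_integral X \<eta> a b = (LBINT y=ereal a..ereal b. ?g y)"
    unfolding im_integral_def Im_emp_stieltjes[OF X n \<eta>, symmetric]
    using X by simp
  ultimately show ?thesis by (simp add: sum_subtractf)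
qed

text \<open>As the width of the Poisson kernel tends to \<open>0\<close>, an eigenvalue contributes \<open>\<pi>\<close> or \<open>0\<close> according
  to whether it lies inside or outside the interval of integration. The left end point is kept at
  distance \<open>1 / (k + 1)\<close> from \<open>s\<close>, much larger than the width \<open>1 / (k + 1)\<^sup>2\<close>, so that an eigenvalue
  equal to \<open>s\<close> is not counted.\<close>

lemma tendsto_im_integral_count:
  assumes X: "X \<in> carrier_mat m n" and n: "n > 0"
  shows "(\<lambda>k. im_integral X (1 / (real k + 1)\<^sup>2) (s + 1 / (real k + 1)) (s + 1 / (real k + 1) + real k))
    \<longlonglongrightarrow> pi * real (card {j\<in>{1..n}. cov_eigval X j > s})"
proof -
  have lim: "(\<lambda>k. arctan ((s + 1 / (real k + 1) + real k - x) / (1 / (real k + 1)\<^sup>2)) -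
      arctan ((s + 1 / (real k + 1) - x) / (1 / (real k + 1)\<^sup>2))) \<longlonglongrightarrow> (if x > s then pi else 0)" for x :: real
  proof -
    have b: "(\<lambda>k. arctan ((s + 1 / (real k + 1) + real k - x) / (1 / (real k + 1)\<^sup>2))) \<longlonglongrightarrow> pi / 2"
      by (rule filterlim_compose[OF tendsto_arctan_at_top]) real_asymp
    have a: "(\<lambda>k. arctan ((s + 1 / (real k + 1) - x) / (1 / (real k + 1)\<^sup>2))) \<longlonglongrightarrow> (if x > s then - (pi / 2) else pi / 2)"
    proof (cases "x > s")
      case True
      define c where "c = x - s"
      have c: "c > 0" using True by (simp add: c_def)
      have "filterlim (\<lambda>k::nat. (1 / (real k + 1) - c) / (1 / (real k + 1)\<^sup>2)) at_bot sequentially"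
        using c by real_asymp
      then have "filterlim (\<lambda>k::nat. (s + 1 / (real k + 1) - x) / (1 / (real k + 1)\<^sup>2)) at_bot sequentially"
        by (simp add: c_def algebra_simps)
      from filterlim_compose[OF tendsto_arctan_at_bot this] show ?thesis using True by simp
    next
      case False
      define c where "c = s - x"
      have "filterlim (\<lambda>k::nat. (1 / (real k + 1)) / (1 / (real k + 1)\<^sup>2)) at_top sequentially"
        by real_asymp
      then have "filterlim (\<lambda>k::nat. (s + 1 / (real k + 1) - x) / (1 / (real k + 1)\<^sup>2)) at_top sequentially"
        by (rule filterlim_at_top_mono, intro always_eventually allI divide_right_mono) (use False in auto)
      from filterlim_compose[OF tendsto_arctan_at_top this] show ?thesis using False by simp
    qed
    show ?thesis using tendsto_diff[OF b a] by auto
  qed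
  have "(\<lambda>k. \<Sum>j=1..n. arctan ((s + 1 / (real k + 1) + real k - cov_eigval X j) / (1 / (real k + 1)\<^sup>2)) -
      arctan ((s + 1 / (real k + 1) - cov_eigval X j) / (1 / (real k + 1)\<^sup>2)))
    \<longlonglongrightarrow> (\<Sum>j=1..n. if cov_eigval X j > s then pi else 0)"
    by (intro tendsto_sum lim)
  also have "(\<Sum>j=1..n. if cov_eigval X j > s then pi else 0) = pi * real (card {j\<in>{1..n}. cov_eigval X j > s})"
    by (simp add: sum.If_cases Int_def)
  finally show ?thesis by (simp add: im_integral_eq[OF X n])
qed

text \<open>The event that the \<open>j\<close>-th largest eigenvalue is at most \<open>s\<close> says that fewer than \<open>j\<close> eigenvalues
  exceed \<open>s\<close>, and this count is a limit of measurable functions by the preceding lemma.\<close>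

lemma borel_measurable_cov_eigval:
  assumes X: "random_mat P m n X" and j: "1 \<le> j" "j \<le> n"
  shows "(\<lambda>\<omega>. cov_eigval (X \<omega>) j) \<in> borel_measurable P"
proof (rule borel_measurableI_le)
  fix s
  have Xc: "X \<omega> \<in> carrier_mat m n" if "\<omega> \<in> space P" for \<omega>
    using X that by (auto simp: random_mat_def)
  let ?c = "\<lambda>\<omega>. pi * real (card {i\<in>{1..n}. cov_eigval (X \<omega>) i > s})"
  have "?c \<in> borel_measurable P"
  proof (rule borel_measurable_LIMSEQ_real)
    show "(\<lambda>k. im_integral (X \<omega>) (1 / (real k + 1)\<^sup>2) (s + 1 / (real k + 1)) (s + 1 / (real k + 1) + real k))
      \<longlonglongrightarrow> ?c \<omega>" if "\<omega> \<in> space P" for \<omega>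
      using tendsto_im_integral_count[OF Xc[OF that]] j by simp
    show "(\<lambda>\<omega>. im_integral (X \<omega>) (1 / (real k + 1)\<^sup>2) (s + 1 / (real k + 1)) (s + 1 / (real k + 1) + real k))
      \<in> borel_measurable P" for k
      by (rule borel_measurable_im_integral[OF X]) auto
  qed
  then have "{\<omega> \<in> space P. ?c \<omega> < pi * real j} \<in> sets P" by measurable
  also have "{\<omega> \<in> space P. ?c \<omega> < pi * real j} = {\<omega> \<in> space P. cov_eigval (X \<omega>) j \<le> s}"
  proof (intro Collect_cong conj_cong refl)
    fix \<omega> assume \<omega>: "\<omega> \<in> space P"
    note mono = eigvals_mset(2)[OF Xc[OF \<omega>]]
    show "(?c \<omega> < pi * real j) = (cov_eigval (X \<omega>) j \<le> s)"
    proof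
      assume le: "cov_eigval (X \<omega>) j \<le> s"
      have "{i\<in>{1..n}. cov_eigval (X \<omega>) i > s} \<subseteq> {1..<j}"
        using mono[of j] le j by (force simp: not_le[symmetric])
      then have "card {i\<in>{1..n}. cov_eigval (X \<omega>) i > s} \<le> j - 1"
        by (metis card_atLeastLessThan card_mono finite_atLeastLessThan)
      then show "?c \<omega> < pi * real j" using j by auto
    next
      assume lt: "?c \<omega> < pi * real j"
      show "cov_eigval (X \<omega>) j \<le> s"
      proof (rule ccontr)
        assume "\<not> cov_eigval (X \<omega>) j \<le> s"
        then have "{1..j} \<subseteq> {i\<in>{1..n}. cov_eigval (X \<omega>) i > s}"
          using mono[of _ j] j by force
        then have "card {1..j} \<le> card {i\<in>{1..n}. cov_eigval (X \<omega>) i > s}"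
          by (intro card_mono) auto
        then show False using lt by simp
      qed
    qed
  qed
  finally show "{\<omega> \<in> space P. cov_eigval (X \<omega>) j \<le> s} \<in> sets P" .
qed

section \<open>The Marchenko--Pastur Stieltjes transform at a spectral edge\<close>

definition mp_quadratic :: "real \<Rightarrow> complex \<Rightarrow> complex \<Rightarrow> complex" where
  "mp_quadratic d z m = z * of_real d * m\<^sup>2 + (z - 1 + of_real d) * m + 1"

lemma mp_equation_iff_quadratic:
  assumes "Im m > 0"
  shows "m + 1 / (z - (1 - of_real d) + z * of_real d * m) = 0 \<longleftrightarrow> mp_quadratic d z m = 0"
proof -
  have "m \<noteq> 0" using assms by auto
  let ?w = "z - (1 - of_real d) + z * of_real d * m"
  have "mp_quadratic d z m = m * ?w + 1"
    by (simp add: mp_quadratic_def algebra_simps power2_eq_square)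
  moreover have "m + 1 / ?w = 0 \<longleftrightarrow> m * ?w + 1 = 0"
    using \<open>m \<noteq> 0\<close> by (cases "?w = 0") (auto simp: divide_simps)
  ultimately show ?thesis by simp
qed

text \<open>For a root \<open>m\<close> the quadratic equation can be solved for \<open>z\<close>, as \<open>z = - 1 / m + 1 / (1 + d m)\<close>. This
  is the imaginary part of that formula with denominators cleared.\<close>

lemma mp_root_Im_sign:
  assumes q: "mp_quadratic d z m = 0"
  shows "Im z * ((cmod m)\<^sup>2 * (cmod (1 + of_real d * m))\<^sup>2) =
    Im m * ((cmod (1 + of_real d * m))\<^sup>2 - d * (cmod m)\<^sup>2)"
proof -
  let ?w = "1 + of_real d * m"
  have "z * (m * ?w) = (1 - of_real d) * m - 1"
    using q unfolding mp_quadratic_def by (simp add: algebra_simps power2_eq_square add_eq_0_iff)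
  then have "((1 - of_real d) * m - 1) * cnj (m * ?w) = z * (m * ?w * cnj (m * ?w))" by (simp add: mult.assoc)
  also have "m * ?w * cnj (m * ?w) = of_real ((cmod m)\<^sup>2 * (cmod ?w)\<^sup>2)"
    by (simp only: complex_norm_square[symmetric] norm_mult power_mult_distrib)
  finally have "Im z * ((cmod m)\<^sup>2 * (cmod ?w)\<^sup>2) = Im (((1 - of_real d) * m - 1) * cnj (m * ?w))"
    by (metis Im_complex_of_real Re_complex_of_real add.commute add.right_neutral mult_zero_right times_complex.sel(2))
  also have "\<dots> = Im m * ((cmod ?w)\<^sup>2 - d * (cmod m)\<^sup>2)"
    by (simp only: cmod_power2) (simp add: algebra_simps power2_eq_square)
  finally show ?thesis by simp
qed

text \<open>Of the two roots of the quadratic exactly one lies in the upper half-plane: by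
  the previous lemma \<open>Im m\<close> has the sign of \<open>a - b\<close> where \<open>a = |1 + d m|\<^sup>2\<close> and \<open>b = d |m|\<^sup>2\<close>,
  and by Vieta the products of the \<open>a\<close>'s and of the \<open>b\<close>'s over both roots agree.\<close>

lemma mp_unique:
  assumes z: "Im z > 0" and d: "d > 0"
  shows "\<exists>!m. Im m > 0 \<and> mp_quadratic d z m = 0"
proof -
  have z0: "z \<noteq> 0" using z by auto
  define D where "D = csqrt ((z - 1 + of_real d)\<^sup>2 - 4 * z * of_real d)"
  have D2: "D\<^sup>2 = (z - 1 + of_real d)\<^sup>2 - 4 * z * of_real d" by (simp add: D_def)
  define m1 where "m1 = (- (z - 1 + of_real d) + D) / (2 * z * of_real d)"
  define m2 where "m2 = (- (z - 1 + of_real d) - D) / (2 * z * of_real d)"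
  have sum: "z * of_real d * (m1 + m2) = - (z - 1 + of_real d)"
    using z0 d by (simp add: m1_def m2_def field_simps)
  have prod: "z * of_real d * (m1 * m2) = 1"
  proof -
    have "(2 * z * of_real d)\<^sup>2 * (m1 * m2) = (z - 1 + of_real d)\<^sup>2 - D\<^sup>2"
      using z0 d by (simp add: m1_def m2_def power2_eq_square algebra_simps add_divide_distrib diff_divide_distrib)
    also have "\<dots> = 4 * (z * of_real d)" unfolding D2 by simp
    finally have "4 * (z * of_real d) * (z * of_real d * (m1 * m2)) = 4 * (z * of_real d) * 1"
      by (simp add: power2_eq_square algebra_simps)
    then show ?thesis using z0 d by simp
  qed
  have fact: "mp_quadratic d z m = z * of_real d * ((m - m1) * (m - m2))" for m
  proof -
    have "z * of_real d * ((m - m1) * (m - m2)) =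
        z * of_real d * m\<^sup>2 - z * of_real d * (m1 + m2) * m + z * of_real d * (m1 * m2)"
      by (simp add: power2_eq_square algebra_simps)
    then show ?thesis unfolding sum prod mp_quadratic_def by (simp add: algebra_simps)
  qed
  have root: "mp_quadratic d z m = 0 \<longleftrightarrow> m = m1 \<or> m = m2" for m
    using z0 d by (simp add: fact)
  define a where "a m = (cmod (1 + of_real d * m))\<^sup>2" for m
  define b where "b m = d * (cmod m)\<^sup>2" for m
  have "z * ((1 + of_real d * m1) * (1 + of_real d * m2)) =
      z + z * of_real d * (m1 + m2) + of_real d * (z * of_real d * (m1 * m2))"
    by (simp add: algebra_simps)
  also have "\<dots> = 1" unfolding sum prod by simp
  finally have w: "z * ((1 + of_real d * m1) * (1 + of_real d * m2)) = z * of_real d * (m1 * m2)"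
    unfolding prod .
  then have w': "(1 + of_real d * m1) * (1 + of_real d * m2) = of_real d * (m1 * m2)"
    using z0 by (simp add: mult.assoc)
  have "a m1 * a m2 = (cmod ((1 + of_real d * m1) * (1 + of_real d * m2)))\<^sup>2"
    by (simp add: a_def norm_mult power_mult_distrib)
  also have "\<dots> = b m1 * b m2"
    unfolding w' using d by (simp add: b_def norm_mult power_mult_distrib power2_eq_square)
  finally have ab: "a m1 * a m2 = b m1 * b m2" .
  have nz: "m1 \<noteq> 0" "m2 \<noteq> 0" using prod by auto
  have "of_real d * (m1 * m2) \<noteq> 0" using nz d by simp
  then have nz': "1 + of_real d * m1 \<noteq> 0" "1 + of_real d * m2 \<noteq> 0" using w' by auto
  have pos: "a m1 > 0" "a m2 > 0" "b m1 > 0" "b m2 > 0"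
    using nz nz' d by (auto simp: a_def b_def)
  have sgn: "Im z * (cmod m)\<^sup>2 * a m = Im m * (a m - b m)" if "m = m1 \<or> m = m2" for m
    using mp_root_Im_sign[of d z m] root[of m] that by (simp add: a_def b_def)
  have p1: "Im m1 * (a m1 - b m1) > 0" "Im m2 * (a m2 - b m2) > 0"
    using sgn[of m1, symmetric] sgn[of m2, symmetric] pos nz z by simp_all
  have one: "Im m1 > 0 \<longleftrightarrow> \<not> Im m2 > 0"
  proof
    assume "Im m1 > 0"
    then have "b m1 < a m1" using p1(1) by (simp add: zero_less_mult_iff)
    then have "\<not> b m2 \<le> a m2" using ab pos by (metis less_irrefl mult_less_le_imp_less less_eq_real_def)
    then show "\<not> Im m2 > 0" using p1(2) by (simp add: zero_less_mult_iff)
  next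
    assume "\<not> Im m2 > 0"
    then have "a m2 < b m2" using p1(2) by (simp add: zero_less_mult_iff)
    then have "\<not> a m1 \<le> b m1" using ab pos by (metis less_irrefl mult_le_less_imp_less less_eq_real_def)
    then show "Im m1 > 0" using p1(1) by (simp add: zero_less_mult_iff)
  qed
  show ?thesis
  proof (cases "Im m1 > 0")
    case True then show ?thesis using one root by metis
  next
    case False then show ?thesis using one root by metis
  qed
qed

lemma mp_stieltjes_root:
  assumes "Im z > 0" "d > 0"
  shows "Im (mp_stieltjes d z) > 0" "mp_quadratic d z (mp_stieltjes d z) = 0"
proof -
  have "(\<lambda>m. Im m > 0 \<and> m + 1 / (z - (1 - of_real d) + z * of_real d * m) = 0) =
      (\<lambda>m. Im m > 0 \<and> mp_quadratic d z m = 0)"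
    using mp_equation_iff_quadratic by blast
  then have "mp_stieltjes d z = (THE m. Im m > 0 \<and> mp_quadratic d z m = 0)"
    unfolding mp_stieltjes_def by simp
  then show "Im (mp_stieltjes d z) > 0" "mp_quadratic d z (mp_stieltjes d z) = 0"
    using theI'[OF mp_unique[OF assms]] by auto
qed

text \<open>A square-root singularity: if \<open>u\<^sup>2 \<approx> i A \<eta>\<close> with real \<open>A \<noteq> 0\<close>, then \<open>u\<close> lies close to a
  diagonal of the complex plane, so \<open>Im u\<close> is comparable to \<open>\<surd>\<eta>\<close>.\<close>

lemma sqrt_singularity:
  fixes u :: complex and A b g B a0 \<eta> :: real
  assumes eq: "u\<^sup>2 = \<i> * of_real \<eta> * (of_real A + of_real b * u + of_real g * u\<^sup>2)"
    and u: "Im u > 0" and a0: "a0 > 0" "a0 \<le> \<bar>A\<bar>" and B: "\<bar>A\<bar> \<le> B" "\<bar>b\<bar> \<le> B" "\<bar>g\<bar> \<le> B"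
    and \<eta>: "\<eta> > 0" "4 * B * \<eta> \<le> 1" "64 * B * sqrt B * sqrt \<eta> \<le> a0"
  shows "sqrt a0 / 4 * sqrt \<eta> \<le> Im u" "Im u \<le> 2 * sqrt B * sqrt \<eta>"
proof -
  have B0: "B > 0" using a0 B by linarith
  define t where "t = cmod u"
  have t0: "t \<ge> 0" by (simp add: t_def)
  have "t\<^sup>2 = cmod (u\<^sup>2)" by (simp add: t_def norm_power)
  also have "\<dots> = \<eta> * cmod (of_real A + of_real b * u + of_real g * u\<^sup>2)"
    using \<eta>(1) by (subst eq) (simp add: norm_mult)
  also have "\<dots> \<le> \<eta> * (\<bar>A\<bar> + \<bar>b\<bar> * t + \<bar>g\<bar> * t\<^sup>2)"
    using \<eta>(1) by (intro mult_left_mono norm_triangle_le add_mono) (auto simp: norm_mult t_def norm_power)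
  also have "\<dots> \<le> \<eta> * (B + B * t + B * t\<^sup>2)"
    using \<eta>(1) B t0 by (intro mult_left_mono add_mono mult_right_mono) auto
  finally have 1: "t\<^sup>2 \<le> \<eta> * B + \<eta> * B * t + \<eta> * B * t\<^sup>2" by (simp add: algebra_simps)
  have 2: "\<eta> * B * t\<^sup>2 \<le> 1 / 4 * t\<^sup>2" using \<eta>(2) by (intro mult_right_mono) (auto simp: mult_ac)
  have 3: "\<eta> * B * t \<le> t\<^sup>2 / 4 + (\<eta> * B)\<^sup>2"
    using zero_le_power2[of "t / 2 - \<eta> * B"] by (simp add: power2_eq_square algebra_simps)
  have 4: "(\<eta> * B)\<^sup>2 \<le> \<eta> * B"
    using \<eta> B0 by (simp add: power2_eq_square mult_ac mult_left_le)
  have "t\<^sup>2 \<le> 4 * (\<eta> * B)" using 1 2 3 4 by linarith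
  then have t2: "t\<^sup>2 \<le> 4 * B * \<eta>" by (simp only: mult_ac)
  then have "t \<le> sqrt (4 * B * \<eta>)" by (simp add: real_le_rsqrt)
  then have t: "t \<le> 2 * sqrt B * sqrt \<eta>" by (simp add: real_sqrt_mult)
  then show "Im u \<le> 2 * sqrt B * sqrt \<eta>"
    using abs_Im_le_cmod[of u] by (simp add: t_def)
  have "t\<^sup>2 \<le> 1\<^sup>2" using t2 \<eta>(2) by simp
  then have t1: "t \<le> 1" by (rule power2_le_imp_le) simp
  define R where "R = \<i> * of_real \<eta> * (of_real b * u + of_real g * u\<^sup>2)"
  have "cmod R = \<eta> * cmod (of_real b * u + of_real g * u\<^sup>2)"
    using \<eta>(1) by (simp add: R_def norm_mult)
  also have "\<dots> \<le> \<eta> * (\<bar>b\<bar> * t + \<bar>g\<bar> * t\<^sup>2)"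
    using \<eta>(1) by (intro mult_left_mono norm_triangle_le add_mono) (auto simp: norm_mult t_def norm_power)
  also have "\<dots> \<le> \<eta> * (B * t + B * t)"
    using \<eta>(1) B t0 t1 B0 by (intro mult_left_mono add_mono mult_mono) (auto simp: power2_eq_square mult_left_le)
  also have "\<dots> \<le> \<eta> * (B * (2 * sqrt B * sqrt \<eta>) + B * (2 * sqrt B * sqrt \<eta>))"
    using \<eta>(1) B0 t by (intro mult_left_mono add_mono) auto
  also have "\<dots> = \<eta> * (64 * B * sqrt B * sqrt \<eta>) / 16" by simp
  also have "\<dots> \<le> \<eta> * a0 / 16"
    using \<eta>(1,3) by (intro divide_right_mono mult_left_mono) auto
  finally have R: "cmod R \<le> a0 * \<eta> / 16" by (simp add: mult.commute)
  have uR: "u\<^sup>2 = \<i> * of_real (\<eta> * A) + R" using eq by (simp add: R_def algebra_simps)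
  define x y where "x = Re u" and "y = Im u"
  have y0: "y > 0" using u by (simp add: y_def)
  have "x\<^sup>2 - y\<^sup>2 = Re R" "2 * x * y = \<eta> * A + Im R"
    using arg_cong[OF uR, of Re] arg_cong[OF uR, of Im]
    by (simp_all add: x_def y_def power2_eq_square mult_ac)
  then have xy: "x\<^sup>2 \<le> y\<^sup>2 + a0 * \<eta> / 16" "\<bar>2 * x * y\<bar> \<ge> a0 * \<eta> * (15 / 16)"
  proof -
    show "x\<^sup>2 \<le> y\<^sup>2 + a0 * \<eta> / 16"
      using \<open>x\<^sup>2 - y\<^sup>2 = Re R\<close> complex_Re_le_cmod[of R] R by linarith
    have "\<bar>\<eta> * A\<bar> \<ge> a0 * \<eta>" using a0 \<eta>(1) by (simp add: abs_mult)
    then show "\<bar>2 * x * y\<bar> \<ge> a0 * \<eta> * (15 / 16)"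
      using \<open>2 * x * y = \<eta> * A + Im R\<close> abs_Im_le_cmod[of R] R by linarith
  qed
  have "y\<^sup>2 \<ge> a0 * \<eta> / 16"
  proof (rule ccontr)
    define k where "k = a0 * \<eta> / 16"
    have k: "k > 0" using a0 \<eta> by (simp add: k_def)
    assume "\<not> y\<^sup>2 \<ge> a0 * \<eta> / 16"
    then have yk: "y\<^sup>2 \<le> k" by (simp add: k_def)
    then have xk: "x\<^sup>2 \<le> 2 * k" using xy(1) unfolding k_def by linarith
    have "\<bar>2 * x * y\<bar> \<le> x\<^sup>2 + y\<^sup>2"
      using zero_le_power2[of "x + y"] zero_le_power2[of "x - y"]
      by (auto simp: abs_if power2_eq_square algebra_simps)
    moreover have "15 * k \<le> \<bar>2 * x * y\<bar>" using xy(2) by (simp add: k_def)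
    ultimately have "15 * k \<le> 3 * k" using xk yk by linarith
    then show False using k by simp
  qed
  then have "sqrt (a0 * \<eta> / 16) \<le> y" using y0 by (intro real_le_lsqrt) auto
  moreover have "sqrt (a0 * \<eta> / 16) = sqrt a0 / 4 * sqrt \<eta>"
    by (simp add: real_sqrt_divide real_sqrt_mult)
  ultimately show "sqrt a0 / 4 * sqrt \<eta> \<le> Im u" by (simp add: y_def)
qed

text \<open>Both edges are treated at once by allowing the square root \<open>\<rho> = \<plusminus>\<surd>d\<close> to have either
  sign: the edge is \<open>(1 + \<rho>)\<^sup>2\<close>, where the quadratic has the double root
  \<open>- 1 / (\<rho> (1 + \<rho>))\<close>. Displacing \<open>z\<close> by \<open>i \<eta>\<close> turns the square of the difference \<open>u\<close> to this root into
  \<open>- i \<eta> \<mu>\<^sup>2 m (1 + d m)\<close>, which is expanded here in powers of \<open>u\<close>.\<close>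

lemma mp_edge_expansion:
  assumes \<rho>: "\<rho> \<noteq> 0" "\<rho> \<noteq> -1" and q: "mp_quadratic (\<rho>\<^sup>2) (Complex ((1 + \<rho>)\<^sup>2) \<eta>) m = 0"
  defines "\<mu> \<equiv> 1 / (\<rho> * (1 + \<rho>))"
  defines "u \<equiv> m + of_real \<mu>"
  shows "u\<^sup>2 = \<i> * of_real \<eta> * (of_real (\<rho> * \<mu> ^ 4) + of_real (\<mu>\<^sup>2 * (\<rho> - 1) / (1 + \<rho>)) * u
    + of_real (- 1 / (1 + \<rho>)\<^sup>2) * u\<^sup>2)"
proof -
  have \<rho>1: "1 + \<rho> \<noteq> 0" using \<rho>(2) by linarith
  \<comment> \<open>Inverses are named to reduce the claim to polynomial identities modulo \<open>r v = 1\<close> and \<open>(1 + r) w = 1\<close>.\<close>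
  define r where "r = complex_of_real \<rho>"
  define h where "h = complex_of_real \<eta>"
  define v w where "v = inverse r" and "w = inverse (1 + r)"
  have r: "r \<noteq> 0" "1 + r \<noteq> 0"
    using \<rho>(1) \<rho>1 unfolding r_def by (simp, metis of_real_1 of_real_add of_real_eq_0_iff)
  then have vw: "r * v = 1" "(1 + r) * w = 1" by (simp_all add: v_def w_def)
  have um: "u = m + v * w" by (simp add: u_def \<mu>_def r_def v_def w_def divide_inverse)
  have z: "Complex ((1 + \<rho>)\<^sup>2) \<eta> = (1 + r)\<^sup>2 + \<i> * h" by (simp add: Complex_eq r_def h_def)
  have Q: "((1 + r)\<^sup>2 + \<i> * h) * r\<^sup>2 * m\<^sup>2 + ((1 + r)\<^sup>2 + \<i> * h - 1 + r\<^sup>2) * m + 1 = 0"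
    using q unfolding mp_quadratic_def z by (simp add: r_def)
  have "((1 + r) * r * m + 1)\<^sup>2 + \<i> * h * (m * (1 + r\<^sup>2 * m)) =
      ((1 + r)\<^sup>2 + \<i> * h) * r\<^sup>2 * m\<^sup>2 + ((1 + r)\<^sup>2 + \<i> * h - 1 + r\<^sup>2) * m + 1"
    by (simp add: algebra_simps power2_eq_square)
  then have 1: "((1 + r) * r * m + 1)\<^sup>2 = - (\<i> * h) * (m * (1 + r\<^sup>2 * m))"
    unfolding Q by (simp add: add_eq_0_iff2)
  have "v * w * ((1 + r) * r * m + 1) = (r * v) * ((1 + r) * w) * m + v * w"
    by (simp add: algebra_simps)
  then have "u = v * w * ((1 + r) * r * m + 1)" by (simp add: vw um)
  then have "u\<^sup>2 = (v * w)\<^sup>2 * (- (\<i> * h) * (m * (1 + r\<^sup>2 * m)))"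
    by (simp add: power_mult_distrib 1)
  also have "m = u - v * w" using um by simp
  also have "(v * w)\<^sup>2 * (- (\<i> * h) * ((u - v * w) * (1 + r\<^sup>2 * (u - v * w)))) =
      \<i> * h * (r * (v * w) ^ 4 + (v * w)\<^sup>2 * (r - 1) * w * u + (- (w\<^sup>2)) * u\<^sup>2)"
  proof -
    define X where "X = (v * w)\<^sup>2"
    define Y where "Y = X * (v * w) * w"
    have rw: "1 - r * w = w" using vw(2) by (simp add: algebra_simps)
    have "r\<^sup>2 * (v * w) = (r * v) * (r * w)" by (simp add: power2_eq_square)
    then have h1: "r\<^sup>2 * (v * w) = r * w" by (simp add: vw)
    have h2: "1 + r\<^sup>2 * (u - v * w) = w + r\<^sup>2 * u"
      unfolding right_diff_distrib h1 using rw by (simp add: algebra_simps)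
    have "X * ((u - v * w) * (w + r\<^sup>2 * u)) =
      X * w * u - X * (r\<^sup>2 * (v * w)) * u + (r * v)\<^sup>2 * w\<^sup>2 * u\<^sup>2 - Y"
      unfolding X_def Y_def by (simp add: power2_eq_square algebra_simps)
    then have h3: "X * ((u - v * w) * (w + r\<^sup>2 * u)) = X * w * u - X * (r * w) * u + w\<^sup>2 * u\<^sup>2 - Y"
      unfolding h1 vw by simp
    have "r * (v * w) ^ 4 = (r * v) * Y"
      unfolding X_def Y_def by (simp add: power2_eq_square power4_eq_xxxx mult_ac)
    then have h4: "r * (v * w) ^ 4 = Y" by (simp add: vw)
    have "X * (- (\<i> * h) * ((u - v * w) * (1 + r\<^sup>2 * (u - v * w)))) =
        - (\<i> * h) * (X * ((u - v * w) * (w + r\<^sup>2 * u)))"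
      unfolding h2 by (simp only: mult_ac)
    also have "\<dots> = \<i> * h * (Y + X * (r - 1) * w * u + (- (w\<^sup>2)) * u\<^sup>2)"
      unfolding h3 by (simp add: algebra_simps)
    finally show ?thesis unfolding h4 X_def .
  qed
  finally show ?thesis by (simp add: r_def h_def \<mu>_def v_def w_def divide_inverse power_inverse)
qed

text \<open>At an edge \<open>Im m\<^sub>c\<close> is of order \<open>\<surd>\<eta>\<close>. The coefficients of the expansion converge along \<open>\<rho> N\<close>,
  the leading one to a nonzero limit, so the constants can be taken uniformly in \<open>N\<close>.\<close>

lemma mp_stieltjes_edge:
  fixes \<rho> :: "nat \<Rightarrow> real"
  assumes lim: "\<rho> \<longlonglongrightarrow> r" and r: "r \<noteq> 0" "r \<noteq> -1"
  shows "\<exists>c>0. \<exists>C>0. \<exists>\<eta>0>0. \<forall>\<^sub>F N in sequentially. \<forall>\<eta>. 0 < \<eta> \<longrightarrow> \<eta> \<le> \<eta>0 \<longrightarrow>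
    c * sqrt \<eta> \<le> Im (mp_stieltjes ((\<rho> N)\<^sup>2) (Complex ((1 + \<rho> N)\<^sup>2) \<eta>)) \<and>
    Im (mp_stieltjes ((\<rho> N)\<^sup>2) (Complex ((1 + \<rho> N)\<^sup>2) \<eta>)) \<le> C * sqrt \<eta>"
proof -
  define A where "A \<rho> = \<rho> * (1 / (\<rho> * (1 + \<rho>))) ^ 4" for \<rho> :: real
  define b where "b \<rho> = (1 / (\<rho> * (1 + \<rho>)))\<^sup>2 * (\<rho> - 1) / (1 + \<rho>)" for \<rho> :: real
  define g where "g \<rho> = - 1 / (1 + \<rho>)\<^sup>2" for \<rho> :: real
  have r1: "1 + r \<noteq> 0" using r(2) by linarith
  have limA: "(\<lambda>N. A (\<rho> N)) \<longlonglongrightarrow> A r" and limb: "(\<lambda>N. b (\<rho> N)) \<longlonglongrightarrow> b r" and limg: "(\<lambda>N. g (\<rho> N)) \<longlonglongrightarrow> g r"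
    unfolding A_def b_def g_def by (intro tendsto_intros lim; use r r1 in simp)+
  define a0 where "a0 = \<bar>A r\<bar> / 2"
  have "A r \<noteq> 0" using r r1 by (simp add: A_def)
  then have a0: "a0 > 0" by (simp add: a0_def)
  define B where "B = \<bar>A r\<bar> + \<bar>b r\<bar> + \<bar>g r\<bar> + 1"
  have B: "B > 0" by (simp add: B_def)
  define \<eta>0 where "\<eta>0 = min (1 / (4 * B)) ((a0 / (64 * B * sqrt B))\<^sup>2)"
  have \<eta>0: "\<eta>0 > 0" using a0 B by (simp add: \<eta>0_def)
  have ev: "\<forall>\<^sub>F N in sequentially. a0 < \<bar>A (\<rho> N)\<bar> \<and> \<bar>A (\<rho> N)\<bar> < B \<and> \<bar>b (\<rho> N)\<bar> < B \<and> \<bar>g (\<rho> N)\<bar> < B \<and>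
      \<rho> N \<noteq> 0 \<and> \<rho> N \<noteq> -1"
    using order_tendstoD(1)[OF tendsto_rabs[OF limA], of a0] order_tendstoD(2)[OF tendsto_rabs[OF limA], of B]
      order_tendstoD(2)[OF tendsto_rabs[OF limb], of B] order_tendstoD(2)[OF tendsto_rabs[OF limg], of B]
      tendsto_imp_eventually_ne[OF lim r(1)] tendsto_imp_eventually_ne[OF lim r(2)] a0
    by (auto simp: a0_def B_def intro!: eventually_conj)
  have "\<forall>\<^sub>F N in sequentially. \<forall>\<eta>. 0 < \<eta> \<longrightarrow> \<eta> \<le> \<eta>0 \<longrightarrow>
    sqrt a0 / 4 * sqrt \<eta> \<le> Im (mp_stieltjes ((\<rho> N)\<^sup>2) (Complex ((1 + \<rho> N)\<^sup>2) \<eta>)) \<and>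
    Im (mp_stieltjes ((\<rho> N)\<^sup>2) (Complex ((1 + \<rho> N)\<^sup>2) \<eta>)) \<le> 2 * sqrt B * sqrt \<eta>"
    using ev
  proof (rule eventually_mono, intro allI impI)
    fix N \<eta>
    assume N: "a0 < \<bar>A (\<rho> N)\<bar> \<and> \<bar>A (\<rho> N)\<bar> < B \<and> \<bar>b (\<rho> N)\<bar> < B \<and> \<bar>g (\<rho> N)\<bar> < B \<and>
      \<rho> N \<noteq> 0 \<and> \<rho> N \<noteq> -1" and \<eta>: "0 < \<eta>" "\<eta> \<le> \<eta>0"
    let ?m = "mp_stieltjes ((\<rho> N)\<^sup>2) (Complex ((1 + \<rho> N)\<^sup>2) \<eta>)"
    have m: "Im ?m > 0" "mp_quadratic ((\<rho> N)\<^sup>2) (Complex ((1 + \<rho> N)\<^sup>2) \<eta>) ?m = 0"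
      using mp_stieltjes_root[of "Complex ((1 + \<rho> N)\<^sup>2) \<eta>" "(\<rho> N)\<^sup>2"] N \<eta> by auto
    define u where "u = ?m + of_real (1 / (\<rho> N * (1 + \<rho> N)))"
    have "u\<^sup>2 = \<i> * of_real \<eta> * (of_real (A (\<rho> N)) + of_real (b (\<rho> N)) * u + of_real (g (\<rho> N)) * u\<^sup>2)"
      using mp_edge_expansion[OF _ _ m(2)] N unfolding u_def A_def b_def g_def by blast
    moreover have "Im u > 0" "Im u = Im ?m" using m(1) by (auto simp: u_def)
    moreover have "4 * B * \<eta> \<le> 1"
      using \<eta> B by (simp add: \<eta>0_def field_simps)
    moreover have "64 * B * sqrt B * sqrt \<eta> \<le> a0"
    proof -
      have "sqrt \<eta> \<le> a0 / (64 * B * sqrt B)"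
        using \<eta> a0 B by (intro real_le_lsqrt) (auto simp: \<eta>0_def)
      then show ?thesis using B by (simp add: field_simps)
    qed
    ultimately show "sqrt a0 / 4 * sqrt \<eta> \<le> Im ?m \<and> Im ?m \<le> 2 * sqrt B * sqrt \<eta>"
      using sqrt_singularity[of u \<eta> "A (\<rho> N)" "b (\<rho> N)" "g (\<rho> N)" a0 B] N a0 \<eta>(1) by auto
  qed
  moreover have "sqrt a0 / 4 > 0" "2 * sqrt B > 0" using a0 B by auto
  ultimately show ?thesis using \<eta>0 by blast
qed

section \<open>Poisson-smoothed eigenvalue counts\<close>

definition poisson_sum :: "(nat \<Rightarrow> real) \<Rightarrow> nat \<Rightarrow> real \<Rightarrow> real \<Rightarrow> real" where
  "poisson_sum x n E \<eta> = (\<Sum>j=1..n. \<eta> / ((x j - E)\<^sup>2 + \<eta>\<^sup>2))"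

text \<open>The integral of the Poisson sum over \<open>[a, b]\<close>, which is \<open>\<pi>\<close> times a smoothed count of the points in
  \<open>[a, b]\<close>.\<close>

definition smoothed_count :: "(nat \<Rightarrow> real) \<Rightarrow> nat \<Rightarrow> real \<Rightarrow> real \<Rightarrow> real \<Rightarrow> real" where
  "smoothed_count x n \<eta> a b = (\<Sum>j=1..n. arctan ((b - x j) / \<eta>) - arctan ((a - x j) / \<eta>))"

lemma arctan_diff_nonneg: "\<lbrakk>\<eta> > 0; a \<le> b\<rbrakk> \<Longrightarrow> 0 \<le> arctan ((b - x) / \<eta>) - arctan ((a - x) / \<eta>)" for a b x \<eta> :: real
  by (simp add: arctan_le_iff divide_right_mono)

lemma smoothed_count_nonneg: "\<lbrakk>\<eta> > 0; a \<le> b\<rbrakk> \<Longrightarrow> 0 \<le> smoothed_count x n \<eta> a b"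
  unfolding smoothed_count_def by (intro sum_nonneg arctan_diff_nonneg)

text \<open>If no point \<open>x j\<close> is near \<open>e\<close>, the Poisson sum at \<open>e\<close> is at most linear in \<open>\<eta>\<close>. A lower bound of
  order \<open>\<surd>\<eta>\<close>, as it holds at a spectral edge, therefore forces a point close to \<open>e\<close>.\<close>

lemma poisson_sum_gap:
  assumes gap: "\<And>j. j \<in> {1..n} \<Longrightarrow> \<kappa> \<le> \<bar>x j - e\<bar>" and \<eta>: "0 < \<eta>" "\<eta> \<le> \<kappa>"
  shows "poisson_sum x n e \<eta> \<le> 2 * (\<eta> / \<kappa>) * poisson_sum x n e \<kappa>"
  unfolding poisson_sum_def sum_distrib_left
proof (rule sum_mono)
  fix j assume "j \<in> {1..n}"
  define t where "t = (x j - e)\<^sup>2"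
  have "\<kappa>\<^sup>2 \<le> t" using gap[OF \<open>j \<in> {1..n}\<close>] \<eta> by (simp add: t_def abs_le_square_iff[symmetric])
  then have "\<eta> / (t + \<eta>\<^sup>2) \<le> 2 * \<eta> / (t + \<kappa>\<^sup>2)"
    using \<eta> by (simp add: divide_simps add_nonneg_pos) (smt (verit) mult_left_mono zero_le_power2 distrib_left)
  then show "\<eta> / ((x j - e)\<^sup>2 + \<eta>\<^sup>2) \<le> 2 * (\<eta> / \<kappa>) * (\<kappa> / ((x j - e)\<^sup>2 + \<kappa>\<^sup>2))"
    using \<eta> by (simp add: t_def)
qed

text \<open>If no \<open>x j\<close> is closer than \<open>w\<close> to the interval, the Poisson kernels of width \<open>\<eta>\<close> contribute
  to the count only through their tails, which are compared with kernels of width \<open>\<kappa>\<close> at \<open>e\<close>.\<close>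

lemma smoothed_count_le_poisson_sum:
  assumes far: "\<And>j y. \<lbrakk>j \<in> {1..n}; a \<le> y; y \<le> b\<rbrakk> \<Longrightarrow> w \<le> \<bar>x j - y\<bar>"
    and ab: "a \<le> b" "e - \<kappa> \<le> a" "b \<le> e + \<kappa>" and pos: "0 < \<eta>" "0 < w" "w \<le> \<kappa>"
  shows "smoothed_count x n \<eta> a b \<le> 10 * (\<kappa>\<^sup>2 * \<eta> / w\<^sup>2) * poisson_sum x n e \<kappa>"
  unfolding smoothed_count_def poisson_sum_def sum_distrib_left
proof (rule sum_mono)
  fix j assume j: "j \<in> {1..n}"
  let ?f = "\<lambda>y. arctan ((y - x j) / \<eta>)"
  let ?B = "10 * (\<kappa>\<^sup>2 * \<eta> / w\<^sup>2) * (\<kappa> / ((x j - e)\<^sup>2 + \<kappa>\<^sup>2))"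
  have B0: "?B \<ge> 0" using pos by simp
  show "?f b - ?f a \<le> ?B"
  proof (cases "a = b")
    case False
    then have "a < b" using ab by simp
    moreover have "(?f has_real_derivative inverse (1 + ((y - x j) / \<eta>)\<^sup>2) * (1 / \<eta>)) (at y)" for y
      using pos by (auto intro!: derivative_eq_intros simp: divide_inverse)
    ultimately obtain y where y: "a < y" "y < b"
      "?f b - ?f a = (b - a) * (inverse (1 + ((y - x j) / \<eta>)\<^sup>2) * (1 / \<eta>))"
      using MVT2[of a b ?f "\<lambda>y. inverse (1 + ((y - x j) / \<eta>)\<^sup>2) * (1 / \<eta>)"] by auto
    define t where "t = (x j - y)\<^sup>2"
    have "\<bar>x j - y\<bar> \<ge> w" using far[OF j, of y] y by simp
    then have t: "w\<^sup>2 \<le> t" using pos by (simp add: t_def abs_le_square_iff[symmetric])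
    have w2: "w\<^sup>2 > 0" using pos by simp
    then have t0: "t > 0" using t by linarith
    have "(y - e)\<^sup>2 \<le> \<kappa>\<^sup>2" using y ab by (intro power2_le_iff_abs_le[THEN iffD2]) (auto simp: abs_le_iff)
    moreover have "(x j - e)\<^sup>2 \<le> 2 * t + 2 * (y - e)\<^sup>2"
      using zero_le_power2[of "(x j - y) - (y - e)"] unfolding t_def
      by (simp add: power2_eq_square algebra_simps)
    ultimately have 1: "(x j - e)\<^sup>2 + \<kappa>\<^sup>2 \<le> 2 * t + 3 * \<kappa>\<^sup>2" by simp
    have "w\<^sup>2 \<le> \<kappa>\<^sup>2" using pos by (simp add: power_mono)
    then have "w\<^sup>2 * t \<le> \<kappa>\<^sup>2 * t" "\<kappa>\<^sup>2 * w\<^sup>2 \<le> \<kappa>\<^sup>2 * t" using t t0 by (auto intro: mult_right_mono mult_left_mono)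
    then have "w\<^sup>2 * (2 * t + 3 * \<kappa>\<^sup>2) \<le> 5 * \<kappa>\<^sup>2 * t" by (simp add: algebra_simps)
    then have 2: "w\<^sup>2 * ((x j - e)\<^sup>2 + \<kappa>\<^sup>2) \<le> 5 * \<kappa>\<^sup>2 * t"
      using mult_left_mono[OF 1, of "w\<^sup>2"] w2 by linarith
    have q0: "(x j - e)\<^sup>2 + \<kappa>\<^sup>2 > 0" using pos by (simp add: add_nonneg_pos)
    have 3: "1 / t \<le> 5 * \<kappa>\<^sup>2 / (w\<^sup>2 * ((x j - e)\<^sup>2 + \<kappa>\<^sup>2))"
      using 2 q0 w2 by (subst pos_divide_le_eq[OF t0]) (simp add: le_divide_eq)
    have "inverse (1 + ((y - x j) / \<eta>)\<^sup>2) * (1 / \<eta>) = \<eta> / (\<eta>\<^sup>2 + t)"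
      using pos unfolding t_def power2_commute[of "x j" y] by (simp add: field_simps power2_eq_square)
    also have "\<dots> \<le> \<eta> * (1 / t)" using pos t0 by (simp add: frac_le)
    also have "\<dots> \<le> \<eta> * (5 * \<kappa>\<^sup>2 / (w\<^sup>2 * ((x j - e)\<^sup>2 + \<kappa>\<^sup>2)))"
      using 3 pos by (intro mult_left_mono) auto
    finally have "(b - a) * (inverse (1 + ((y - x j) / \<eta>)\<^sup>2) * (1 / \<eta>)) \<le>
        (2 * \<kappa>) * (\<eta> * (5 * \<kappa>\<^sup>2 / (w\<^sup>2 * ((x j - e)\<^sup>2 + \<kappa>\<^sup>2))))"
      by (rule mult_mono[rotated]) (use ab pos in auto)
    then have "?f b - ?f a \<le> (2 * \<kappa>) * (\<eta> * (5 * \<kappa>\<^sup>2 / (w\<^sup>2 * ((x j - e)\<^sup>2 + \<kappa>\<^sup>2))))"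
      unfolding y(3) .
    then show ?thesis by (simp add: power2_eq_square mult_ac)
  qed (use B0 in simp)
qed

text \<open>A point well inside the interval contributes at least \<open>2 arctan 1 = \<pi> / 2\<close>.\<close>

lemma one_le_smoothed_count:
  assumes j: "j \<in> {1..n}" "a + w \<le> x j" "x j \<le> b - w" and \<eta>: "0 < \<eta>" "\<eta> \<le> w"
  shows "1 \<le> smoothed_count x n \<eta> a b"
proof -
  have "1 \<le> (b - x j) / \<eta>" "(a - x j) / \<eta> \<le> - 1"
    using assms by (auto simp: field_simps)
  then have "arctan 1 \<le> arctan ((b - x j) / \<eta>)" "arctan ((a - x j) / \<eta>) \<le> arctan (-1)"
    by (simp_all only: arctan_le_iff)
  then have "1 \<le> arctan ((b - x j) / \<eta>) - arctan ((a - x j) / \<eta>)"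
    using pi_gt3 unfolding arctan_minus arctan_one by linarith
  also have "\<dots> \<le> smoothed_count x n \<eta> a b"
    unfolding smoothed_count_def using j \<eta>
    by (intro member_le_sum[of j "{1..n}" "\<lambda>j. arctan ((b - x j) / \<eta>) - arctan ((a - x j) / \<eta>)"] arctan_diff_nonneg) auto
  finally show ?thesis .
qed

section \<open>A cutoff function\<close>

text \<open>The fifth power of the positive part is four times differentiable. The function is unbounded on
  the left, which the polynomial growth condition permits; it is only evaluated at nonnegative
  arguments, where it decreases from \<open>1\<close> to \<open>0\<close> and vanishes from \<open>1\<close> on.\<close>

definition cutoff :: "real \<Rightarrow> real" where
  "cutoff x = max 0 (1 - x) ^ 5"

lemma has_derivative_pos_part_power:
  assumes "p > 0"
  shows "((\<lambda>x. max 0 (1 - x) ^ Suc p) has_real_derivative - (real (Suc p) * max 0 (1 - x) ^ p)) (at x)"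
proof -
  consider "x < 1" | "x > 1" | "x = 1" by linarith
  then show ?thesis
  proof cases
    case 1
    have "((\<lambda>x. 1 - x) has_real_derivative - 1) (at x)"
      by (auto intro!: derivative_eq_intros)
    from DERIV_power_Suc[OF this, of p]
    have "((\<lambda>x. (1 - x) ^ Suc p) has_real_derivative - (real (Suc p) * (1 - x) ^ p)) (at x)"
      by simp
    then have "((\<lambda>x. (1 - x) ^ Suc p) has_real_derivative - (real (Suc p) * max 0 (1 - x) ^ p)) (at x)"
      using 1 by simp
    then show ?thesis
      by (rule DERIV_cong_ev[THEN iffD2, rotated 3])
         (use 1 eventually_nhds_in_open[of "{..<1}" x] in \<open>auto elim!: eventually_mono\<close>)
  next
    case 2
    have "((\<lambda>x. 0) has_real_derivative - (real (Suc p) * max 0 (1 - x) ^ p)) (at x)"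
      using 2 assms by (simp add: zero_power)
    then show ?thesis
      by (rule DERIV_cong_ev[THEN iffD2, rotated 3])
         (use 2 eventually_nhds_in_open[of "{1<..}" x] in \<open>auto elim!: eventually_mono\<close>)
  next
    case 3
    \<comment> \<open>At the kink the difference quotient is bounded by \<open>|h|\<^sup>p\<close>.\<close>
    have "(\<lambda>h. max 0 (- h) ^ Suc p / h) \<midarrow>0\<rightarrow> (0 :: real)"
    proof (rule Lim_null_comparison)
      show "\<forall>\<^sub>F h in at 0. norm (max 0 (- h) ^ Suc p / h) \<le> \<bar>h\<bar> ^ p"
        using assms by (intro always_eventually allI) (auto simp: max_def power_abs)
      show "(\<lambda>h. \<bar>h\<bar> ^ p) \<midarrow>0\<rightarrow> (0 :: real)"
      proof -
        have "(\<lambda>h. \<bar>h\<bar> ^ p) \<midarrow>0\<rightarrow> (0 :: real) ^ p"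
          by (intro tendsto_power tendsto_rabs_zero tendsto_ident_at)
        then show ?thesis using assms by (simp add: zero_power)
      qed
    qed
    then show ?thesis using 3 assms by (simp add: DERIV_def zero_power)
  qed
qed

lemma deriv_pos_part_power:
  assumes "p > 0"
  shows "deriv (\<lambda>x. c * max 0 (1 - x) ^ Suc p) = (\<lambda>x. - (c * real (Suc p)) * max 0 (1 - x) ^ p)"
    and "(\<lambda>x. c * max 0 (1 - x) ^ Suc p) differentiable at (x :: real)"
proof -
  have *: "((\<lambda>x. c * max 0 (1 - x) ^ Suc p) has_real_derivative - (c * real (Suc p)) * max 0 (1 - x) ^ p) (at x)" for x
    using DERIV_cmult[OF has_derivative_pos_part_power[OF assms], of c] by (simp add: mult.assoc)
  show "deriv (\<lambda>x. c * max 0 (1 - x) ^ Suc p) = (\<lambda>x. - (c * real (Suc p)) * max 0 (1 - x) ^ p)"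
    using DERIV_imp_deriv[OF *] by blast
  show "(\<lambda>x. c * max 0 (1 - x) ^ Suc p) differentiable at x"
    using * real_differentiable_def by blast
qed

text \<open>The \<open>i\<close>-th derivative is a multiple of \<open>(1 - x)\<^sub>+\<^bsup>5 - i\<^esup>\<close> with factor at most \<open>5! = 120\<close>.\<close>

lemma C4_growth_cutoff: "C4_growth 120 cutoff"
proof -
  have 0: "(deriv ^^ 0) cutoff = (\<lambda>x. 1 * max 0 (1 - x) ^ Suc 4)"
    by (simp add: cutoff_def[abs_def])
  have 1: "(deriv ^^ Suc 0) cutoff = (\<lambda>x. - 5 * max 0 (1 - x) ^ Suc 3)"
    by (subst funpow.simps, unfold o_apply 0, subst deriv_pos_part_power) auto
  have 2: "(deriv ^^ Suc (Suc 0)) cutoff = (\<lambda>x. 20 * max 0 (1 - x) ^ Suc 2)"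
    by (subst funpow.simps, unfold o_apply 1, subst deriv_pos_part_power) auto
  have 3: "(deriv ^^ Suc (Suc (Suc 0))) cutoff = (\<lambda>x. - 60 * max 0 (1 - x) ^ Suc 1)"
    by (subst funpow.simps, unfold o_apply 2, subst deriv_pos_part_power) (auto simp: power2_eq_square)
  have 4: "(deriv ^^ Suc (Suc (Suc (Suc 0)))) cutoff = (\<lambda>x. 120 * max 0 (1 - x) ^ 1)"
    by (subst funpow.simps, unfold o_apply 3, subst deriv_pos_part_power) auto
  have diff: "(deriv ^^ \<alpha>) cutoff differentiable at x" if "\<alpha> < 4" for \<alpha> x
  proof -
    have "\<alpha> \<in> {0, Suc 0, Suc (Suc 0), Suc (Suc (Suc 0))}" using that by auto
    then show ?thesis
      using 0 1 2 3 by (elim insertE emptyE) (simp_all only: deriv_pos_part_power(2) zero_less_numeral zero_less_one)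
  qed
  have growth: "\<bar>c * max 0 (1 - x) ^ p\<bar> * (\<bar>x\<bar> + 1) powr (- 120) \<le> 120"
    if "\<bar>c\<bar> \<le> 120" "p \<le> 4" for c x :: real and p :: nat
  proof -
    have "\<bar>c * max 0 (1 - x) ^ p\<bar> \<le> 120 * (\<bar>x\<bar> + 1) ^ p"
      unfolding abs_mult power_abs using that by (intro mult_mono power_mono) auto
    also have "\<dots> \<le> 120 * (\<bar>x\<bar> + 1) powr 120"
    proof -
      have "(\<bar>x\<bar> + 1) ^ p = (\<bar>x\<bar> + 1) powr real p" by (simp add: powr_realpow)
      also have "\<dots> \<le> (\<bar>x\<bar> + 1) powr 120" using that by (intro powr_mono) auto
      finally show ?thesis by simp
    qed
    finally have "\<bar>c * max 0 (1 - x) ^ p\<bar> * (\<bar>x\<bar> + 1) powr (- 120) \<le>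
        120 * (\<bar>x\<bar> + 1) powr 120 * (\<bar>x\<bar> + 1) powr (- 120)" by (intro mult_right_mono) auto
    also have "\<dots> = 120 * (\<bar>x\<bar> + 1) powr (120 + - 120)" by (simp only: powr_add mult.assoc)
    also have "\<dots> = 120" by simp
    finally show ?thesis .
  qed
  have "\<bar>(deriv ^^ \<alpha>) cutoff x\<bar> * (\<bar>x\<bar> + 1) powr (- 120) \<le> 120" if "\<alpha> \<in> {1..4}" for \<alpha> x
  proof -
    have "\<alpha> \<in> {Suc 0, Suc (Suc 0), Suc (Suc (Suc 0)), Suc (Suc (Suc (Suc 0)))}" using that by auto
    then show ?thesis
      by (elim insertE emptyE; simp only: 1 2 3 4; intro growth; simp)
  qed
  with diff show ?thesis by (simp add: C4_growth_def)
qed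

lemma cutoff_bounds: "0 \<le> cutoff x" "x \<ge> 0 \<Longrightarrow> cutoff x \<le> 1" "x \<ge> 1 \<Longrightarrow> cutoff x = 0"
  "x \<ge> 0 \<Longrightarrow> 1 - 5 * x \<le> cutoff x"
proof -
  show "0 \<le> cutoff x" by (simp add: cutoff_def)
  show "cutoff x \<le> 1" if "x \<ge> 0" using that by (simp add: cutoff_def power_le_one)
  show *: "cutoff x = 0" if "x \<ge> 1" using that by (simp add: cutoff_def)
  show "1 - 5 * x \<le> cutoff x" if "x \<ge> 0"
  proof (cases "x \<le> 1")
    case True
    then show ?thesis using Bernoulli_inequality[of "- x" 5] by (simp add: cutoff_def)
  qed (use * in simp)
qed

lemma borel_measurable_cutoff [measurable]: "cutoff \<in> borel_measurable borel"
  unfolding cutoff_def by measurable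

section \<open>The spectrum near an edge\<close>

text \<open>Powers of \<open>\<phi>\<close> are subpolynomial, yet \<open>\<phi>\<close> exceeds every multiple of \<open>log N\<close>, so that the
  exceptional probability \<open>N\<^sup>C exp (- \<phi>)\<close> is polynomially small.\<close>

lemma phi_powr_le:
  fixes C k \<alpha> :: real
  assumes "k > 0" "\<alpha> > 0"
  shows "\<forall>\<^sub>F N in sequentially. phi N powr C \<le> k * real N powr \<alpha>"
  unfolding phi_def using assms by real_asymp

lemma exp_phi_le:
  fixes C :: real
  shows "\<forall>\<^sub>F N in sequentially. real N powr C * exp (- (phi N powr 1)) \<le> 1 / real N"
  unfolding phi_def by real_asymp

text \<open>The flag \<open>up\<close> selects the upper or the lower edge; both are of the form \<open>(1 + \<rho>)\<^sup>2\<close> with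
  \<open>\<rho> = \<plusminus>\<surd>d\<close>.\<close>

definition edge_root :: "bool \<Rightarrow> real \<Rightarrow> real" where
  "edge_root up d = (if up then sqrt d else - sqrt d)"

definition edge :: "bool \<Rightarrow> real \<Rightarrow> real" where
  "edge up d = (1 + edge_root up d)\<^sup>2"

definition edge_index :: "bool \<Rightarrow> nat \<Rightarrow> nat \<Rightarrow> nat" where
  "edge_index up m n = (if up then 1 else min m n)"

lemma edge_simps: "edge True d = lam_plus d" "edge False d = lam_minus d"
  by (simp_all add: edge_def edge_root_def lam_plus_def lam_minus_def)

lemma edge_between:
  assumes "d \<ge> 0"
  shows "lam_minus d \<le> edge up d" "edge up d \<le> lam_plus d" "0 \<le> lam_minus d"
proof -
  show "lam_minus d \<le> edge up d" "edge up d \<le> lam_plus d"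
    using assms by (auto simp: edge_def edge_root_def lam_plus_def lam_minus_def power2_eq_square algebra_simps)
  show "0 \<le> lam_minus d" by (simp add: lam_minus_def)
qed

text \<open>What the local law says at energies equal to the edge. Its error \<open>\<phi>\<^sup>K / (N \<eta>)\<close> is negligible
  against \<open>Im m\<^sub>c \<approx> \<surd>\<eta>\<close> as soon as \<open>N \<eta>\<^bsup>3/2\<^esup>\<close> is a positive power of \<open>N\<close>, that is for
  \<open>\<eta> \<ge> N\<^bsup>-2/3 + \<alpha>\<^esup>\<close>.\<close>

lemma local_law_at_edge:
  fixes M :: "nat \<Rightarrow> nat" and P :: "nat \<Rightarrow> 'a measure" and X :: "nat \<Rightarrow> 'a \<Rightarrow> complex mat"
  defines "d \<equiv> \<lambda>N. aspect (M N) N"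
  assumes M_pos: "\<forall>N\<ge>1. M N \<ge> 1" and lim: "d \<longlonglongrightarrow> L" "L > 0" "L \<noteq> 1"
    and X: "\<forall>N\<ge>1. random_mat (P N) (M N) N (X N)" and law: "local_law M P X" and \<alpha>: "\<alpha> > 0"
  shows "\<exists>c>0. \<exists>C>0. \<forall>\<^sub>F N in sequentially. \<exists>\<Omega>\<in>sets (P N).
    measure (P N) (space (P N) - \<Omega>) \<le> 1 / real N \<and>
    (\<forall>\<omega>\<in>\<Omega>.
      (\<forall>\<eta>. real N powr (- 2 / 3 + \<alpha>) \<le> \<eta> \<longrightarrow> \<eta> \<le> real N powr (- 1 / 3) \<longrightarrow>
        c * (real N * sqrt \<eta>) \<le> poisson_sum (cov_eigval (X N \<omega>)) N (edge up (d N)) \<eta> \<and>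
        poisson_sum (cov_eigval (X N \<omega>)) N (edge up (d N)) \<eta> \<le> C * (real N * sqrt \<eta>)) \<and>
      (\<forall>j\<in>{1..min (M N) N}. lam_minus (d N) - real N powr (- 2 / 3 + \<alpha>) \<le> cov_eigval (X N \<omega>) j) \<and>
      (\<forall>j\<in>{1..N}. cov_eigval (X N \<omega>) j \<le> lam_plus (d N) + real N powr (- 2 / 3 + \<alpha>)))"
proof -
  define \<rho> where "\<rho> N = edge_root up (d N)" for N
  define r where "r = edge_root up L"
  have lim\<rho>: "\<rho> \<longlonglongrightarrow> r"
    unfolding \<rho>_def r_def edge_root_def by (cases up) (auto intro!: tendsto_intros lim(1))
  define q where "q = sqrt L"
  have "q > 0" "q \<noteq> 1" using lim(2,3) by (auto simp: q_def)
  then have r: "r \<noteq> 0" "r \<noteq> -1" by (auto simp: r_def edge_root_def simp flip: q_def)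
  obtain c0 C0 \<eta>0 where c0: "c0 > 0" "C0 > 0" "\<eta>0 > 0" and mc: "\<forall>\<^sub>F N in sequentially. \<forall>\<eta>. 0 < \<eta> \<longrightarrow> \<eta> \<le> \<eta>0 \<longrightarrow>
    c0 * sqrt \<eta> \<le> Im (mp_stieltjes ((\<rho> N)\<^sup>2) (Complex ((1 + \<rho> N)\<^sup>2) \<eta>)) \<and>
    Im (mp_stieltjes ((\<rho> N)\<^sup>2) (Complex ((1 + \<rho> N)\<^sup>2) \<eta>)) \<le> C0 * sqrt \<eta>"
    using mp_stieltjes_edge[OF lim\<rho> r] by blast
  \<comment> \<open>Half of the lower bound for \<open>Im m\<^sub>c\<close> is given away to the error of the local law.\<close>
  define c where "c = c0 / 2"
  have c: "c > 0" using c0 by (simp add: c_def)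
  define \<Omega> where "\<Omega> K N = {\<omega> \<in> space (P N).
       let d = aspect (M N) N in
       (\<forall>z \<in> spec_dom d N K.
          Lam d (X N \<omega>) z \<le> phi N powr K * (1 / (real N * Im z))) \<and>
       (\<forall>z \<in> spec_dom d N K.
          Lam_o (X N \<omega>) z + Lam_d d (X N \<omega>) z
            \<le> phi N powr K * (sqrt (Im (mp_stieltjes d z) / (real N * Im z)) + 1 / (real N * Im z))) \<and>
       lam_minus d - real N powr (-2/3) * phi N powr K \<le> Min (cov_eigval (X N \<omega>) ` {1..min (M N) N}) \<and>
       Min (cov_eigval (X N \<omega>) ` {1..min (M N) N}) \<le> Max (cov_eigval (X N \<omega>) ` {1..N}) \<and>
       Max (cov_eigval (X N \<omega>) ` {1..N}) \<le> lam_plus d + real N powr (-2/3) * phi N powr K}" for K N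
  have "\<forall>\<zeta>>0. \<exists>K. high_prob P \<zeta> (\<Omega> K)"
    using law unfolding local_law_def \<Omega>_def .
  from this[THEN spec, THEN mp, of 1] obtain K where "high_prob P 1 (\<Omega> K)" by force
  then obtain K' where hp: "\<forall>\<^sub>F N in sequentially. \<Omega> K N \<in> sets (P N) \<and>
      measure (P N) (space (P N) - \<Omega> K N) \<le> real N powr K' * exp (- (phi N powr 1))"
    unfolding high_prob_def by blast
  have dpos: "\<forall>\<^sub>F N in sequentially. d N > 0"
    using order_tendstoD(1)[OF lim(1), of 0] lim(2) by simp
  have small: "\<forall>\<^sub>F N in sequentially. real N powr (- 1 / 3) < \<eta>0"
    using c0(3) by real_asymp
  have small': "\<forall>\<^sub>F N in sequentially. real N powr (- 1 / 3) < 10"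
    by real_asymp
  have "\<forall>\<^sub>F N in sequentially. \<exists>\<Omega>\<in>sets (P N).
    measure (P N) (space (P N) - \<Omega>) \<le> 1 / real N \<and>
    (\<forall>\<omega>\<in>\<Omega>.
      (\<forall>\<eta>. real N powr (- 2 / 3 + \<alpha>) \<le> \<eta> \<longrightarrow> \<eta> \<le> real N powr (- 1 / 3) \<longrightarrow>
        c * (real N * sqrt \<eta>) \<le> poisson_sum (cov_eigval (X N \<omega>)) N (edge up (d N)) \<eta> \<and>
        poisson_sum (cov_eigval (X N \<omega>)) N (edge up (d N)) \<eta> \<le> (C0 + c) * (real N * sqrt \<eta>)) \<and>
      (\<forall>j\<in>{1..min (M N) N}. lam_minus (d N) - real N powr (- 2 / 3 + \<alpha>) \<le> cov_eigval (X N \<omega>) j) \<and>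
      (\<forall>j\<in>{1..N}. cov_eigval (X N \<omega>) j \<le> lam_plus (d N) + real N powr (- 2 / 3 + \<alpha>)))"
    using mc hp dpos small small' exp_phi_le[of K'] phi_powr_le[OF c \<alpha>, of K]
      phi_powr_le[of 1 \<alpha> K, OF _ \<alpha>, simplified] eventually_ge_at_top[of 1]
  proof eventually_elim
    case (elim N)
    have N: "real N \<ge> 1" using elim(9) by simp
    note phi1 = elim(8) and sm = elim(5) and d0 = elim(3)
    have rho2: "(\<rho> N)\<^sup>2 = d N" using d0 by (simp add: \<rho>_def edge_root_def)
    have e: "(1 + \<rho> N)\<^sup>2 = edge up (d N)" by (simp add: \<rho>_def edge_def)
    have pw: "real N powr (- 2 / 3 + \<alpha>) = real N powr (- 2 / 3) * real N powr \<alpha>" by (rule powr_add)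
    show ?case
    proof (intro bexI[of _ "\<Omega> K N"] conjI ballI allI impI)
      show "measure (P N) (space (P N) - \<Omega> K N) \<le> 1 / real N" using elim(2,6) by linarith
      show "\<Omega> K N \<in> sets (P N)" using elim(2) by blast
    next
      fix \<omega> \<eta> assume \<omega>: "\<omega> \<in> \<Omega> K N" and \<eta>: "real N powr (- 2 / 3 + \<alpha>) \<le> \<eta>" "\<eta> \<le> real N powr (- 1 / 3)"
      have Xc: "X N \<omega> \<in> carrier_mat (M N) N" using X[rule_format, OF elim(9)] \<omega> by (simp add: random_mat_def \<Omega>_def)
      have N0: "real N powr (- 2 / 3 + \<alpha>) > 0" using N by simp
      then have \<eta>0: "\<eta> > 0" using \<eta> by linarith
      have N\<alpha>: "real N powr \<alpha> \<le> real N * (\<eta> * sqrt \<eta>)"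
      proof -
        have "real N powr \<alpha> \<le> real N powr (1 + (- 2 / 3 + \<alpha>) * (3 / 2))"
          using N \<alpha> by (intro powr_mono) (simp_all add: algebra_simps)
        also have "\<dots> = real N * (real N powr (- 2 / 3 + \<alpha>)) powr (3 / 2)"
          using N by (simp only: powr_add[of _ 1] powr_powr powr_one)
        also have "\<dots> \<le> real N * \<eta> powr (3 / 2)"
          using \<eta> by (intro mult_left_mono powr_mono2) auto
        also have "\<eta> powr (3 / 2) = \<eta> powr (1 + 1 / 2)" by simp
        also have "\<dots> = \<eta> * sqrt \<eta>"
          using \<eta>0 by (simp only: powr_add powr_half_sqrt[OF less_imp_le] powr_one)
        finally show ?thesis .
      qed
      define z where "z = Complex (edge up (d N)) \<eta>"
      have "phi N powr K / real N \<le> \<eta>"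
      proof -
        have "phi N powr K / real N \<le> real N powr \<alpha> / real N" using phi1 by (simp add: divide_right_mono)
        also have "\<dots> = real N powr (\<alpha> - 1)" using N by (simp add: powr_diff)
        also have "\<dots> \<le> real N powr (- 2 / 3 + \<alpha>)" using N by (intro powr_mono) auto
        finally show ?thesis using \<eta> by simp
      qed
      moreover have "\<eta> \<le> 10 * (1 + d N)"
      proof -
        have "\<eta> \<le> 10" using \<eta>(2) sm by (rule order.trans[OF _ less_imp_le])
        also have "10 \<le> 10 * (1 + d N)" using d0 by simp
        finally show ?thesis .
      qed
      ultimately have "z \<in> spec_dom (d N) N K"
        using edge_between(1,2)[of "d N" up] edge_between(3)[of "d N"] d0 by (auto simp: spec_dom_def z_def)
      then have "Lam (d N) (X N \<omega>) z \<le> phi N powr K * (1 / (real N * \<eta>))"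
        using \<omega> by (auto simp: z_def Let_def d_def \<Omega>_def)
      also have "\<dots> \<le> c * (real N powr \<alpha>) * (1 / (real N * \<eta>))"
        using elim(7) \<eta>0 N by (intro mult_right_mono) auto
      also have "\<dots> \<le> c * (real N * (\<eta> * sqrt \<eta>)) * (1 / (real N * \<eta>))"
        using N\<alpha> c \<eta>0 N by (intro mult_right_mono mult_left_mono) auto
      also have "\<dots> = c * sqrt \<eta>" using \<eta>0 N by simp
      finally have "cmod (emp_stieltjes (X N \<omega>) z - mp_stieltjes (d N) z) \<le> c * sqrt \<eta>"
        by (simp add: Lam_def)
      then have "\<bar>Im (emp_stieltjes (X N \<omega>) z) - Im (mp_stieltjes (d N) z)\<bar> \<le> c * sqrt \<eta>"
        using abs_Im_le_cmod[of "emp_stieltjes (X N \<omega>) z - mp_stieltjes (d N) z"] by simp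
      moreover have "c0 * sqrt \<eta> \<le> Im (mp_stieltjes (d N) z) \<and> Im (mp_stieltjes (d N) z) \<le> C0 * sqrt \<eta>"
        using elim(1)[rule_format, of \<eta>] \<eta>0 less_imp_le[OF le_less_trans[OF \<eta>(2) elim(4)]]
        unfolding rho2 e z_def by simp
      moreover have "c0 * sqrt \<eta> = c * sqrt \<eta> + c * sqrt \<eta>" by (simp add: c_def)
      ultimately have m: "c * sqrt \<eta> \<le> Im (emp_stieltjes (X N \<omega>) z)"
        "Im (emp_stieltjes (X N \<omega>) z) \<le> (C0 + c) * sqrt \<eta>"
        unfolding distrib_right by linarith+
      have ps: "poisson_sum (cov_eigval (X N \<omega>)) N (edge up (d N)) \<eta> = real N * Im (emp_stieltjes (X N \<omega>) z)"
        using Im_emp_stieltjes[OF Xc _ \<eta>0] elim(9) by (simp add: poisson_sum_def z_def)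
      show "c * (real N * sqrt \<eta>) \<le> poisson_sum (cov_eigval (X N \<omega>)) N (edge up (d N)) \<eta>"
        unfolding ps using mult_left_mono[OF m(1), of "real N"] by (simp add: mult_ac)
      show "poisson_sum (cov_eigval (X N \<omega>)) N (edge up (d N)) \<eta> \<le> (C0 + c) * (real N * sqrt \<eta>)"
        unfolding ps using mult_left_mono[OF m(2), of "real N"] by (simp add: mult_ac)
    next
      fix \<omega> j assume \<omega>: "\<omega> \<in> \<Omega> K N" and j: "j \<in> {1..min (M N) N}"
      have "lam_minus (d N) - real N powr (- 2 / 3) * phi N powr K \<le> Min (cov_eigval (X N \<omega>) ` {1..min (M N) N})"
        using \<omega> unfolding \<Omega>_def Let_def d_def by blast
      also have "\<dots> \<le> cov_eigval (X N \<omega>) j" using j by (intro Min_le) auto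
      finally show "lam_minus (d N) - real N powr (- 2 / 3 + \<alpha>) \<le> cov_eigval (X N \<omega>) j"
        unfolding pw using mult_left_mono[OF phi1, of "real N powr (- 2 / 3)"] by simp
    next
      fix \<omega> j assume \<omega>: "\<omega> \<in> \<Omega> K N" and j: "j \<in> {1..N}"
      have "cov_eigval (X N \<omega>) j \<le> Max (cov_eigval (X N \<omega>) ` {1..N})" using j by (intro Max_ge) auto
      also have "\<dots> \<le> lam_plus (d N) + real N powr (- 2 / 3) * phi N powr K"
        using \<omega> unfolding \<Omega>_def Let_def d_def by blast
      finally show "cov_eigval (X N \<omega>) j \<le> lam_plus (d N) + real N powr (- 2 / 3 + \<alpha>)"
        unfolding pw using mult_left_mono[OF phi1, of "real N powr (- 2 / 3)"] by simp
    qed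
  qed
  note bounds = this
  show ?thesis
    by (intro exI[of _ c] exI[of _ "C0 + c"] conjI c add_pos_pos c0 bounds)
qed

text \<open>A smooth substitute for the indicator that the extreme eigenvalue is at most \<open>E\<close>. At the upper
  edge this says that no eigenvalue lies in the window \<open>[E, e + \<kappa>]\<close>, at the lower edge that some
  eigenvalue lies in \<open>[e - \<kappa>, E]\<close>.\<close>

definition edge_test :: "bool \<Rightarrow> complex mat \<Rightarrow> real \<Rightarrow> real \<Rightarrow> real \<Rightarrow> real \<Rightarrow> real" where
  "edge_test up X \<eta> \<kappa> e E =
    (if up then cutoff (im_integral X \<eta> E (e + \<kappa>)) else 1 - cutoff (im_integral X \<eta> (e - \<kappa>) E))"

text \<open>The test is accurate up to an uncertainty \<open>w\<close> in \<open>E\<close>: an eigenvalue deep inside the window makes the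
  cutoff vanish, and if the window is free of eigenvalues then only Poisson tails remain. At the
  lower edge the eigenvalues of index larger than \<open>m\<close> vanish, and they do not interfere as the
  window stays away from \<open>0\<close>.\<close>

lemma edge_test_eigval:
  assumes X: "X \<in> carrier_mat m n" and mn: "m > 0" "n > 0"
    and low: "up \<or> \<kappa> + w \<le> e"
    and U: "U = cov_eigval X (edge_index up m n)" "\<bar>U - e\<bar> \<le> k"
    and E: "\<bar>E - e\<bar> \<le> 2 * k" and k: "2 * k \<le> \<kappa>" "k + w \<le> \<kappa>" "w \<le> \<kappa>" and \<eta>: "0 < \<eta>" "\<eta> \<le> w"
    and S: "poisson_sum (cov_eigval X) n e \<kappa> \<le> S"
  defines "\<tau> \<equiv> 50 * (\<kappa>\<^sup>2 * \<eta> / w\<^sup>2) * S"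
  shows "U \<le> E - w \<Longrightarrow> 1 - \<tau> \<le> edge_test up X \<eta> \<kappa> e E" "E + w \<le> U \<Longrightarrow> edge_test up X \<eta> \<kappa> e E \<le> \<tau>"
proof -
  let ?x = "cov_eigval X"
  have w: "w > 0" using \<eta> by linarith
  have \<kappa>0: "\<kappa> > 0" using w k by linarith
  have "poisson_sum ?x n e \<kappa> \<ge> 0" using \<kappa>0 unfolding poisson_sum_def by (intro sum_nonneg) auto
  then have S0: "S \<ge> 0" using S by linarith
  then have \<tau>0: "\<tau> \<ge> 0" using \<eta> by (simp add: \<tau>_def)
  have im: "im_integral X \<eta> a b = smoothed_count ?x n \<eta> a b" if "a \<le> b" for a b
    using im_integral_eq[OF X mn(2) \<eta>(1) that] by (simp add: smoothed_count_def)
  have far: "1 - \<tau> \<le> cutoff (im_integral X \<eta> a b)"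
    if "\<And>j y. \<lbrakk>j \<in> {1..n}; a \<le> y; y \<le> b\<rbrakk> \<Longrightarrow> w \<le> \<bar>?x j - y\<bar>"
      and ab: "a \<le> b" "e - \<kappa> \<le> a" "b \<le> e + \<kappa>" for a b
  proof -
    have "smoothed_count ?x n \<eta> a b \<le> 10 * (\<kappa>\<^sup>2 * \<eta> / w\<^sup>2) * poisson_sum ?x n e \<kappa>"
      by (rule smoothed_count_le_poisson_sum) (use that w k \<eta> in auto)
    also have "\<dots> \<le> 10 * (\<kappa>\<^sup>2 * \<eta> / w\<^sup>2) * S" using S \<eta> by (intro mult_left_mono) auto
    finally have "5 * im_integral X \<eta> a b \<le> \<tau>" by (simp add: im[OF ab(1)] \<tau>_def)
    moreover have "im_integral X \<eta> a b \<ge> 0" using smoothed_count_nonneg[OF \<eta>(1) ab(1)] im[OF ab(1)] by simp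
    ultimately show ?thesis using cutoff_bounds(4)[of "im_integral X \<eta> a b"] by linarith
  qed
  have near: "cutoff (im_integral X \<eta> a b) = 0" if "a + w \<le> U" "U \<le> b - w" for a b
  proof -
    have "edge_index up m n \<in> {1..n}" using mn by (auto simp: edge_index_def)
    then have "1 \<le> smoothed_count ?x n \<eta> a b"
      using that \<eta> unfolding U(1) by (intro one_le_smoothed_count) auto
    then show ?thesis using im[of a b] that w cutoff_bounds(3) by simp
  qed
  show "1 - \<tau> \<le> edge_test up X \<eta> \<kappa> e E" if "U \<le> E - w"
  proof (cases up)
    case True
    have "1 - \<tau> \<le> cutoff (im_integral X \<eta> E (e + \<kappa>))"
    proof (rule far)
      fix j y assume j: "j \<in> {1..n}" and y: "E \<le> y"
      have "?x j \<le> U" using eigvals_mset(2)[OF X, of 1 j] j True by (simp add: U(1) edge_index_def)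
      then show "w \<le> \<bar>?x j - y\<bar>" using that y by linarith
    qed (use E k \<kappa>0 in linarith)+
    then show ?thesis using True by (simp add: edge_test_def)
  next
    case False
    have "cutoff (im_integral X \<eta> (e - \<kappa>) E) = 0"
      by (rule near) (use U(2) k that in linarith)+
    then show ?thesis using False \<tau>0 by (simp add: edge_test_def)
  qed
  show "edge_test up X \<eta> \<kappa> e E \<le> \<tau>" if "E + w \<le> U"
  proof (cases up)
    case True
    have "cutoff (im_integral X \<eta> E (e + \<kappa>)) = 0"
      by (rule near) (use U(2) k that in linarith)+
    then show ?thesis using True \<tau>0 by (simp add: edge_test_def)
  next
    case False
    have "1 - \<tau> \<le> cutoff (im_integral X \<eta> (e - \<kappa>) E)"
    proof (rule far)
      fix j y assume j: "j \<in> {1..n}" and y: "e - \<kappa> \<le> y" "y \<le> E"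
      show "w \<le> \<bar>?x j - y\<bar>"
      proof (cases "j \<le> m")
        case True
        then have "U \<le> ?x j"
          using eigvals_mset(2)[OF X, of j "min m n"] j False by (simp add: U(1) edge_index_def)
        then show ?thesis using that y by linarith
      next
        case False
        then have "?x j = 0" using cov_eigval_zero[OF X, of j] j by simp
        then show ?thesis using y low \<open>\<not> up\<close> by linarith
      qed
    qed (use E k \<kappa>0 in linarith)+
    then show ?thesis using False by (simp add: edge_test_def)
  qed
qed

text \<open>The scales are ordered as \<open>\<eta> \<lless> w \<lless> h \<lless> k \<lless> \<kappa>\<close>, with exponents \<open>-2/3\<close> plus \<open>- \<epsilon>\<close>, \<open>- \<epsilon>/10\<close>, \<open>\<epsilon>/40\<close>,
  \<open>\<epsilon>/20\<close> and \<open>\<epsilon>/10\<close>. On scale \<open>k\<close> the extreme eigenvalue sticks to the edge: otherwise the spectrum has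
  a gap of size \<open>k\<close> around the edge, and then \<open>N \<surd>h \<lesssim> (h / k) N \<surd>k\<close>, which fails as \<open>h\<close> is much
  smaller than \<open>k\<close>. The error of the test is of order \<open>\<kappa>\<^sup>2 \<eta> / w\<^sup>2 \<cdot> N \<surd>\<kappa> = N\<^bsup>-11\<epsilon>/20\<^esup>\<close>.\<close>

lemma edge_test_regular:
  fixes M :: "nat \<Rightarrow> nat" and P :: "nat \<Rightarrow> 'a measure" and X :: "nat \<Rightarrow> 'a \<Rightarrow> complex mat" and \<epsilon> :: real and up :: bool
  defines "d \<equiv> \<lambda>N. aspect (M N) N"
  assumes M_pos: "\<forall>N\<ge>1. M N \<ge> 1" and lim: "d \<longlonglongrightarrow> L" "L > 0" "L \<noteq> 1"
    and X: "\<forall>N\<ge>1. random_mat (P N) (M N) N (X N)" and law: "local_law M P X" and \<epsilon>: "0 < \<epsilon>" "\<epsilon> \<le> 1"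
  defines "U \<equiv> \<lambda>N \<omega>. cov_eigval (X N \<omega>) (edge_index up (M N) N)" and "e \<equiv> \<lambda>N. edge up (d N)"
    and "k \<equiv> \<lambda>N. real N powr (- 2 / 3 + \<epsilon> / 20)" and "\<kappa> \<equiv> \<lambda>N. real N powr (- 2 / 3 + \<epsilon> / 10)"
    and "w \<equiv> \<lambda>N. real N powr (- 2 / 3 - \<epsilon> / 10)" and "\<eta> \<equiv> \<lambda>N. real N powr (- 2 / 3 - \<epsilon>)"
  shows "\<forall>\<^sub>F N in sequentially. \<exists>\<Omega>\<in>sets (P N). measure (P N) (space (P N) - \<Omega>) \<le> 1 / real N \<and>
    (\<forall>\<omega>\<in>\<Omega>. \<bar>U N \<omega> - e N\<bar> \<le> k N \<and> (\<forall>E. \<bar>E - e N\<bar> \<le> 2 * k N \<longrightarrow>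
      (U N \<omega> \<le> E - w N \<longrightarrow> 1 - real N powr (- (\<epsilon> / 2)) \<le> edge_test up (X N \<omega>) (\<eta> N) (\<kappa> N) (e N) E) \<and>
      (E + w N \<le> U N \<omega> \<longrightarrow> edge_test up (X N \<omega>) (\<eta> N) (\<kappa> N) (e N) E \<le> real N powr (- (\<epsilon> / 2)))))"
proof -
  define h where "h N = real N powr (- 2 / 3 + \<epsilon> / 40)" for N
  have "\<epsilon> / 40 > 0" using \<epsilon> by simp
  from local_law_at_edge[OF M_pos lim(1)[unfolded d_def] lim(2,3) X law this, of up]
  obtain c C where c: "c > 0" "C > 0" and law: "\<forall>\<^sub>F N in sequentially. \<exists>\<Omega>\<in>sets (P N).
    measure (P N) (space (P N) - \<Omega>) \<le> 1 / real N \<and>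
    (\<forall>\<omega>\<in>\<Omega>.
      (\<forall>\<eta>. h N \<le> \<eta> \<longrightarrow> \<eta> \<le> real N powr (- 1 / 3) \<longrightarrow>
        c * (real N * sqrt \<eta>) \<le> poisson_sum (cov_eigval (X N \<omega>)) N (e N) \<eta> \<and>
        poisson_sum (cov_eigval (X N \<omega>)) N (e N) \<eta> \<le> C * (real N * sqrt \<eta>)) \<and>
      (\<forall>j\<in>{1..min (M N) N}. lam_minus (d N) - h N \<le> cov_eigval (X N \<omega>) j) \<and>
      (\<forall>j\<in>{1..N}. cov_eigval (X N \<omega>) j \<le> lam_plus (d N) + h N))"
    unfolding h_def e_def d_def by blast
  \<comment> \<open>At the lower edge \<open>L \<noteq> 1\<close> keeps the window away from the eigenvalue \<open>0\<close>.\<close>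
  have "e \<longlonglongrightarrow> edge up L"
    unfolding e_def edge_def edge_root_def by (cases up) (auto intro!: tendsto_intros lim(1))
  moreover have "edge up L > 0"
  proof -
    define q where "q = sqrt L"
    have "q > 0" "q \<noteq> 1" using lim(2,3) by (auto simp: q_def)
    then show ?thesis by (auto simp: edge_def edge_root_def simp flip: q_def)
  qed
  ultimately have e_pos: "\<forall>\<^sub>F N in sequentially. edge up L / 2 < e N"
    by (intro order_tendstoD(1)[of _ "edge up L"]) auto
  have "\<forall>\<^sub>F N in sequentially. \<kappa> N + w N < edge up L / 2"
    using \<epsilon> \<open>edge up L > 0\<close> unfolding \<kappa>_def w_def by real_asymp
  with e_pos have low: "\<forall>\<^sub>F N in sequentially. \<kappa> N + w N \<le> e N" by eventually_elim linarith
  have sq: "sqrt (real N powr a) = real N powr (a / 2)" for N a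
    by (simp add: powr_half_sqrt[symmetric] powr_powr)
  have powr2: "(real N powr a)\<^sup>2 = real N powr (a + a)" for N a
    by (simp only: power2_eq_square powr_add)
  have contra: "\<forall>\<^sub>F N in sequentially. 2 * (h N / k N) * (C * (real N * sqrt (k N))) < c * (real N * sqrt (h N))"
  proof -
    have "\<forall>\<^sub>F N in sequentially. 2 * C < c * real N powr (\<epsilon> / 80)"
      using \<epsilon> c by real_asymp
    then show ?thesis using eventually_gt_at_top[of 0]
    proof eventually_elim
      case (elim N)
      have "real N powr a / real N powr b * (real N powr 1 * real N powr (b / 2)) = real N powr (a - b + (1 + b / 2))" for a b
        by (simp only: powr_add powr_diff)
      from this[of "- 2 / 3 + \<epsilon> / 40" "- 2 / 3 + \<epsilon> / 20"]
      have 1: "h N / k N * (real N * sqrt (k N)) = real N powr (2 / 3)"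
        unfolding h_def k_def sq by (simp add: field_simps)
      have "real N powr 1 * real N powr (a / 2) = real N powr (1 + a / 2)" for a
        by (simp only: powr_add)
      from this[of "- 2 / 3 + \<epsilon> / 40"]
      have "real N * sqrt (h N) = real N powr (2 / 3 + \<epsilon> / 80)"
        unfolding h_def sq by (simp add: field_simps)
      then have 2: "real N * sqrt (h N) = real N powr (2 / 3) * real N powr (\<epsilon> / 80)"
        by (simp only: powr_add)
      have "2 * (h N / k N) * (C * (real N * sqrt (k N))) = (2 * C) * (h N / k N * (real N * sqrt (k N)))"
        by (simp only: mult_ac)
      also have "\<dots> < (c * real N powr (\<epsilon> / 80)) * (h N / k N * (real N * sqrt (k N)))"
        unfolding 1 using elim by (intro mult_strict_right_mono) auto
      also have "\<dots> = c * (real N * sqrt (h N))" unfolding 1 2 by (simp only: mult_ac)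
      finally show ?case .
    qed
  qed
  have sizes: "\<forall>\<^sub>F N in sequentially. h N \<le> k N" "\<forall>\<^sub>F N in sequentially. 2 * k N \<le> \<kappa> N"
    "\<forall>\<^sub>F N in sequentially. k N + w N \<le> \<kappa> N" "\<forall>\<^sub>F N in sequentially. w N \<le> \<kappa> N"
    "\<forall>\<^sub>F N in sequentially. \<eta> N \<le> w N" "\<forall>\<^sub>F N in sequentially. \<kappa> N \<le> real N powr (- 1 / 3)"
    using \<epsilon> unfolding h_def k_def \<kappa>_def w_def \<eta>_def by (real_asymp; fail)+
  have \<tau>: "\<forall>\<^sub>F N in sequentially. 50 * ((\<kappa> N)\<^sup>2 * \<eta> N / (w N)\<^sup>2) * (C * (real N * sqrt (\<kappa> N))) \<le> real N powr (- (\<epsilon> / 2))"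
  proof -
    have "\<forall>\<^sub>F N in sequentially. 50 * C \<le> real N powr (\<epsilon> / 20)"
      using \<epsilon> by real_asymp
    then show ?thesis using eventually_gt_at_top[of 0]
    proof eventually_elim
      case (elim N)
      have "real N powr (a + a) * real N powr b / real N powr (c + c) * (real N powr 1 * real N powr (a / 2)) =
          real N powr (a + a + b - (c + c) + (1 + a / 2))" for a b c
        by (simp only: powr_add powr_diff)
      from this[of "- 2 / 3 + \<epsilon> / 10" "- 2 / 3 - \<epsilon>" "- 2 / 3 - \<epsilon> / 10"]
      have 1: "(\<kappa> N)\<^sup>2 * \<eta> N / (w N)\<^sup>2 * (real N * sqrt (\<kappa> N)) = real N powr (- (\<epsilon> / 20) + - (\<epsilon> / 2))"
        unfolding \<kappa>_def \<eta>_def w_def sq powr2 by (simp add: field_simps)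
      have "50 * ((\<kappa> N)\<^sup>2 * \<eta> N / (w N)\<^sup>2) * (C * (real N * sqrt (\<kappa> N))) =
          (50 * C) * ((\<kappa> N)\<^sup>2 * \<eta> N / (w N)\<^sup>2 * (real N * sqrt (\<kappa> N)))"
        by (simp only: mult_ac)
      also have "\<dots> \<le> real N powr (\<epsilon> / 20) * real N powr (- (\<epsilon> / 20) + - (\<epsilon> / 2))"
        unfolding 1 using elim by (intro mult_right_mono) auto
      also have "\<dots> = real N powr (\<epsilon> / 20 + (- (\<epsilon> / 20) + - (\<epsilon> / 2)))"
        by (rule powr_add[symmetric])
      finally show ?case by simp
    qed
  qed
  show ?thesis
    using law low contra sizes \<tau> eventually_ge_at_top[of 1]
  proof eventually_elim
    case (elim N)
    have N: "N \<ge> 1" using elim(11) .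
    have pos: "h N > 0" "k N > 0" "\<kappa> N > 0" "w N > 0" "\<eta> N > 0"
      using N by (auto simp: h_def k_def \<kappa>_def w_def \<eta>_def)
    have MN: "M N > 0" using M_pos N by (auto simp: Suc_le_eq)
    obtain \<Omega> where \<Omega>: "\<Omega> \<in> sets (P N)" "measure (P N) (space (P N) - \<Omega>) \<le> 1 / real N"
      and S: "\<And>\<omega> \<eta>. \<lbrakk>\<omega> \<in> \<Omega>; h N \<le> \<eta>; \<eta> \<le> real N powr (- 1 / 3)\<rbrakk> \<Longrightarrow>
        c * (real N * sqrt \<eta>) \<le> poisson_sum (cov_eigval (X N \<omega>)) N (e N) \<eta>"
        "\<And>\<omega> \<eta>. \<lbrakk>\<omega> \<in> \<Omega>; h N \<le> \<eta>; \<eta> \<le> real N powr (- 1 / 3)\<rbrakk> \<Longrightarrow>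
        poisson_sum (cov_eigval (X N \<omega>)) N (e N) \<eta> \<le> C * (real N * sqrt \<eta>)"
      and ext: "\<And>\<omega> j. \<lbrakk>\<omega> \<in> \<Omega>; j \<in> {1..min (M N) N}\<rbrakk> \<Longrightarrow> lam_minus (d N) - h N \<le> cov_eigval (X N \<omega>) j"
        "\<And>\<omega> j. \<lbrakk>\<omega> \<in> \<Omega>; j \<in> {1..N}\<rbrakk> \<Longrightarrow> cov_eigval (X N \<omega>) j \<le> lam_plus (d N) + h N"
      using elim(1) by blast
    have idx: "edge_index up (M N) N \<in> {1..N}" "edge_index up (M N) N \<in> {1..min (M N) N}"
      using MN N by (auto simp: edge_index_def)
    show ?case
    proof (intro bexI[of _ \<Omega>] conjI ballI allI impI \<Omega>)
      fix \<omega> assume \<omega>: "\<omega> \<in> \<Omega>"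
      then have "\<omega> \<in> space (P N)" using \<Omega>(1) sets.sets_into_space by blast
      then have Xc: "X N \<omega> \<in> carrier_mat (M N) N"
        using X[rule_format, OF N] by (simp add: random_mat_def)
      note mono = eigvals_mset(2)[OF Xc]
      have "\<exists>j\<in>{1..N}. \<bar>cov_eigval (X N \<omega>) j - e N\<bar> < k N"
      proof (rule ccontr)
        assume "\<not> ?thesis"
        then have "poisson_sum (cov_eigval (X N \<omega>)) N (e N) (h N) \<le>
            2 * (h N / k N) * poisson_sum (cov_eigval (X N \<omega>)) N (e N) (k N)"
          by (intro poisson_sum_gap pos elim) (auto simp: not_less)
        also have "\<dots> \<le> 2 * (h N / k N) * (C * (real N * sqrt (k N)))"
          by (intro mult_left_mono S(2) \<omega>) (use elim pos in auto)
        also have "\<dots> < c * (real N * sqrt (h N))" by (rule elim(3))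
        also have "\<dots> \<le> poisson_sum (cov_eigval (X N \<omega>)) N (e N) (h N)"
          by (intro S(1) \<omega>) (use elim pos in auto)
        finally show False by simp
      qed
      then obtain j where j: "j \<in> {1..N}" "\<bar>cov_eigval (X N \<omega>) j - e N\<bar> < k N" by blast
      show loc: "\<bar>U N \<omega> - e N\<bar> \<le> k N"
      proof (cases up)
        case True
        have "cov_eigval (X N \<omega>) j \<le> U N \<omega>" using mono[of 1 j] j(1) True by (simp add: U_def edge_index_def)
        moreover have "U N \<omega> \<le> e N + h N"
          using ext(2)[OF \<omega> idx(1)] True by (simp add: U_def e_def edge_simps)
        ultimately show ?thesis using j(2) elim(4) by linarith
      next
        case False
        have "j \<le> M N"
        proof (rule ccontr)
          assume "\<not> j \<le> M N"
          then have "cov_eigval (X N \<omega>) j = 0" using cov_eigval_zero[OF Xc, of j] j(1) by simp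
          then show False using j(2) elim(2,6) pos by linarith
        qed
        then have "U N \<omega> \<le> cov_eigval (X N \<omega>) j"
          using mono[of j "min (M N) N"] j(1) False by (simp add: U_def edge_index_def)
        moreover have "e N - h N \<le> U N \<omega>"
          using ext(1)[OF \<omega> idx(2)] False by (simp add: U_def e_def edge_simps)
        ultimately show ?thesis using j(2) elim(4) by linarith
      qed
      fix E assume E: "\<bar>E - e N\<bar> \<le> 2 * k N"
      have "poisson_sum (cov_eigval (X N \<omega>)) N (e N) (\<kappa> N) \<le> C * (real N * sqrt (\<kappa> N))"
        by (intro S(2) \<omega>) (use elim pos in auto)
      note test = edge_test_eigval[where up = up and w = "w N" and \<eta> = "\<eta> N", OF Xc MN _ _ _ loc E _ _ _ _ _ this]
      have test1: "U N \<omega> \<le> E - w N \<Longrightarrow> 1 - 50 * ((\<kappa> N)\<^sup>2 * \<eta> N / (w N)\<^sup>2) * (C * (real N * sqrt (\<kappa> N)))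
          \<le> edge_test up (X N \<omega>) (\<eta> N) (\<kappa> N) (e N) E"
        and test2: "E + w N \<le> U N \<omega> \<Longrightarrow> edge_test up (X N \<omega>) (\<eta> N) (\<kappa> N) (e N) E
          \<le> 50 * ((\<kappa> N)\<^sup>2 * \<eta> N / (w N)\<^sup>2) * (C * (real N * sqrt (\<kappa> N)))"
        using test N elim pos by (auto simp: U_def)
      show "1 - real N powr (- (\<epsilon> / 2)) \<le> edge_test up (X N \<omega>) (\<eta> N) (\<kappa> N) (e N) E"
        if "U N \<omega> \<le> E - w N" using test1[OF that] elim(10) by linarith
      show "edge_test up (X N \<omega>) (\<eta> N) (\<kappa> N) (e N) E \<le> real N powr (- (\<epsilon> / 2))"
        if "E + w N \<le> U N \<omega>" using test2[OF that] elim(10) by linarith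
    qed
  qed
qed

section \<open>Transferring distribution functions\<close>

lemma expectation_test_between_cdfs:
  fixes U W :: "'a \<Rightarrow> real"
  assumes P: "prob_space P" and [measurable]: "U \<in> borel_measurable P" "W \<in> borel_measurable P"
    and W: "\<And>\<omega>. \<omega> \<in> space P \<Longrightarrow> 0 \<le> W \<omega> \<and> W \<omega> \<le> 1"
    and \<Omega> [measurable]: "\<Omega> \<in> sets P" and p: "measure P (space P - \<Omega>) \<le> p" and \<tau>: "\<tau> \<ge> 0"
    and test: "\<And>\<omega>. \<lbrakk>\<omega> \<in> \<Omega>; U \<omega> \<le> E - w\<rbrakk> \<Longrightarrow> 1 - \<tau> \<le> W \<omega>" "\<And>\<omega>. \<lbrakk>\<omega> \<in> \<Omega>; E + w \<le> U \<omega>\<rbrakk> \<Longrightarrow> W \<omega> \<le> \<tau>"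
  shows "measure P {\<omega> \<in> space P. U \<omega> \<le> E - w} - \<tau> - p \<le> (\<integral>\<omega>. W \<omega> \<partial>P)"
    and "(\<integral>\<omega>. W \<omega> \<partial>P) \<le> measure P {\<omega> \<in> space P. U \<omega> \<le> E + w} + \<tau> + p"
proof -
  interpret prob_space P by (rule P)
  let ?A = "{\<omega> \<in> space P. U \<omega> \<le> E - w}" and ?B = "{\<omega> \<in> space P. U \<omega> \<le> E + w}" and ?C = "space P - \<Omega>"
  have A: "?A \<in> sets P" and B: "?B \<in> sets P" and C: "?C \<in> sets P" by measurable
  have int: "integrable P W"
    by (rule integrable_const_bound[of _ 1]) (use W in auto)
  have ind: "integrable P (indicat_real S)" "(\<integral>\<omega>. indicat_real S \<omega> \<partial>P) = measure P S" if "S \<in> sets P" for S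
    using that by (auto simp: less_top[symmetric] Int_absorb1 sets.sets_into_space)
  have "measure P ?A - \<tau> - measure P ?C = (\<integral>\<omega>. indicat_real ?A \<omega> - \<tau> - indicat_real ?C \<omega> \<partial>P)"
    using ind[OF A] ind[OF C] by (simp add: prob_space)
  also have "\<dots> \<le> (\<integral>\<omega>. W \<omega> \<partial>P)"
    by (intro integral_mono int Bochner_Integration.integrable_diff ind A C integrable_const)
       (use W test(1) \<tau> in \<open>fastforce simp: indicator_def\<close>)
  finally show "measure P ?A - \<tau> - p \<le> (\<integral>\<omega>. W \<omega> \<partial>P)" using p by linarith
  have "(\<integral>\<omega>. W \<omega> \<partial>P) \<le> (\<integral>\<omega>. indicat_real ?B \<omega> + \<tau> + indicat_real ?C \<omega> \<partial>P)"
    by (intro integral_mono int Bochner_Integration.integrable_add ind B C integrable_const)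
       (use W test(2) \<tau> in \<open>fastforce simp: indicator_def not_le\<close>)
  also have "\<dots> = measure P ?B + \<tau> + measure P ?C"
    using ind[OF B] ind[OF C] by (simp add: prob_space)
  finally show "(\<integral>\<omega>. W \<omega> \<partial>P) \<le> measure P ?B + \<tau> + p" using p by linarith
qed

text \<open>For \<open>E = t - w\<close> near \<open>e\<close> the distribution functions are compared through the expected tests. For
  other \<open>E\<close> nothing is left to compare: \<open>U\<close> and \<open>V\<close> are within \<open>k\<close> of \<open>e\<close> up to probability \<open>p\<close>, so either the
  probability on the left is at most \<open>p\<close> or the one on the right is at least \<open>1 - p\<close>.\<close>

lemma cdf_transfer:
  fixes U :: "'a \<Rightarrow> real" and V :: "'b \<Rightarrow> real" and W :: "real \<Rightarrow> 'a \<Rightarrow> real" and T :: "real \<Rightarrow> 'b \<Rightarrow> real"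
  assumes P: "prob_space P" and Q: "prob_space Q" and [measurable]: "U \<in> borel_measurable P" "V \<in> borel_measurable Q"
    and W: "\<And>E. \<bar>E - e\<bar> \<le> 2 * k \<Longrightarrow> W E \<in> borel_measurable P \<and> (\<forall>\<omega>\<in>space P. 0 \<le> W E \<omega> \<and> W E \<omega> \<le> 1)"
    and T: "\<And>E. \<bar>E - e\<bar> \<le> 2 * k \<Longrightarrow> T E \<in> borel_measurable Q \<and> (\<forall>\<omega>\<in>space Q. 0 \<le> T E \<omega> \<and> T E \<omega> \<le> 1)"
    and UW: "\<exists>\<Omega>\<in>sets P. measure P (space P - \<Omega>) \<le> p \<and> (\<forall>\<omega>\<in>\<Omega>. \<bar>U \<omega> - e\<bar> \<le> k \<and> (\<forall>E. \<bar>E - e\<bar> \<le> 2 * k \<longrightarrow>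
      (U \<omega> \<le> E - w \<longrightarrow> 1 - \<tau> \<le> W E \<omega>) \<and> (E + w \<le> U \<omega> \<longrightarrow> W E \<omega> \<le> \<tau>)))"
    and VT: "\<exists>\<Omega>\<in>sets Q. measure Q (space Q - \<Omega>) \<le> p \<and> (\<forall>\<omega>\<in>\<Omega>. \<bar>V \<omega> - e\<bar> \<le> k \<and> (\<forall>E. \<bar>E - e\<bar> \<le> 2 * k \<longrightarrow>
      (V \<omega> \<le> E - w \<longrightarrow> 1 - \<tau> \<le> T E \<omega>) \<and> (E + w \<le> V \<omega> \<longrightarrow> T E \<omega> \<le> \<tau>)))"
    and cmp: "\<And>E. \<bar>E - e\<bar> \<le> 2 * k \<Longrightarrow> \<bar>(\<integral>\<omega>. W E \<omega> \<partial>P) - (\<integral>\<omega>. T E \<omega> \<partial>Q)\<bar> \<le> \<delta>"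
    and pos: "k > 0" "w > 0" "\<tau> \<ge> 0"
  shows "measure P {\<omega> \<in> space P. U \<omega> \<le> t - 2 * w} - (2 * \<tau> + 2 * p + \<delta>) \<le> measure Q {\<omega> \<in> space Q. V \<omega> \<le> t}"
proof -
  interpret P: prob_space P by (rule P)
  interpret Q: prob_space Q by (rule Q)
  obtain \<Omega> where \<Omega>: "\<Omega> \<in> sets P" "measure P (space P - \<Omega>) \<le> p" "\<And>\<omega>. \<omega> \<in> \<Omega> \<Longrightarrow> \<bar>U \<omega> - e\<bar> \<le> k"
    and UW': "\<And>\<omega> E. \<lbrakk>\<omega> \<in> \<Omega>; \<bar>E - e\<bar> \<le> 2 * k; U \<omega> \<le> E - w\<rbrakk> \<Longrightarrow> 1 - \<tau> \<le> W E \<omega>"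
      "\<And>\<omega> E. \<lbrakk>\<omega> \<in> \<Omega>; \<bar>E - e\<bar> \<le> 2 * k; E + w \<le> U \<omega>\<rbrakk> \<Longrightarrow> W E \<omega> \<le> \<tau>" using UW by blast
  obtain \<Omega>' where \<Omega>': "\<Omega>' \<in> sets Q" "measure Q (space Q - \<Omega>') \<le> p" "\<And>\<omega>. \<omega> \<in> \<Omega>' \<Longrightarrow> \<bar>V \<omega> - e\<bar> \<le> k"
    and VT': "\<And>\<omega> E. \<lbrakk>\<omega> \<in> \<Omega>'; \<bar>E - e\<bar> \<le> 2 * k; V \<omega> \<le> E - w\<rbrakk> \<Longrightarrow> 1 - \<tau> \<le> T E \<omega>"
      "\<And>\<omega> E. \<lbrakk>\<omega> \<in> \<Omega>'; \<bar>E - e\<bar> \<le> 2 * k; E + w \<le> V \<omega>\<rbrakk> \<Longrightarrow> T E \<omega> \<le> \<tau>" using VT by blast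
  note [measurable] = \<Omega>(1) \<Omega>'(1)
  have \<delta>: "\<delta> \<ge> 0" using cmp[of e] pos(1) by fastforce
  have p: "p \<ge> 0" using \<Omega>(2) measure_nonneg[of P "space P - \<Omega>"] by linarith
  define E where "E = t - w"
  consider "\<bar>E - e\<bar> \<le> 2 * k" | "E > e + 2 * k" | "E < e - 2 * k" by linarith
  then show ?thesis
  proof cases
    case 1
    have "measure P {\<omega> \<in> space P. U \<omega> \<le> E - w} - \<tau> - p \<le> (\<integral>\<omega>. W E \<omega> \<partial>P)"
      by (rule expectation_test_between_cdfs(1)[where \<Omega> = \<Omega>])
         (use P W[OF 1] \<Omega> pos UW'[OF _ 1] in auto)
    moreover have "(\<integral>\<omega>. T E \<omega> \<partial>Q) \<le> measure Q {\<omega> \<in> space Q. V \<omega> \<le> E + w} + \<tau> + p"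
      by (rule expectation_test_between_cdfs(2)[where \<Omega> = \<Omega>'])
         (use Q T[OF 1] \<Omega>' pos VT'[OF _ 1] in auto)
    ultimately show ?thesis using cmp[OF 1] by (simp add: E_def algebra_simps)
  next
    case 2
    have "1 - p \<le> measure Q \<Omega>'" using \<Omega>'(1,2) Q.prob_compl[of \<Omega>'] by simp
    also have "\<dots> \<le> measure Q {\<omega> \<in> space Q. V \<omega> \<le> t}"
    proof (rule Q.finite_measure_mono)
      show "\<Omega>' \<subseteq> {\<omega> \<in> space Q. V \<omega> \<le> t}"
        using \<Omega>'(3) sets.sets_into_space[OF \<Omega>'(1)] 2 pos by (force simp: E_def abs_le_iff)
    qed measurable
    finally show ?thesis
      using P.prob_le_1[of "{\<omega> \<in> space P. U \<omega> \<le> t - 2 * w}"] \<delta> p pos by linarith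
  next
    case 3
    have "measure P {\<omega> \<in> space P. U \<omega> \<le> t - 2 * w} \<le> measure P (space P - \<Omega>)"
    proof (rule P.finite_measure_mono)
      show "{\<omega> \<in> space P. U \<omega> \<le> t - 2 * w} \<subseteq> space P - \<Omega>"
        using \<Omega>(3) 3 pos by (force simp: E_def abs_le_iff)
    qed measurable
    then show ?thesis
      using \<Omega>(2) measure_nonneg[of Q "{\<omega> \<in> space Q. V \<omega> \<le> t}"] \<delta> p pos by linarith
  qed
qed

lemma edge_test_expectation:
  assumes X: "random_mat P m n X" and n: "n > 0" and \<eta>: "\<eta> > 0" and E: "\<bar>E - e\<bar> \<le> \<kappa>"
  shows "(\<lambda>\<omega>. edge_test up (X \<omega>) \<eta> \<kappa> e E) \<in> borel_measurable P"
    and "\<omega> \<in> space P \<Longrightarrow> 0 \<le> edge_test up (X \<omega>) \<eta> \<kappa> e E \<and> edge_test up (X \<omega>) \<eta> \<kappa> e E \<le> 1"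
    and "(\<integral>\<omega>. edge_test up (X \<omega>) \<eta> \<kappa> e E \<partial>P) =
      (if up then (\<integral>\<omega>. cutoff (im_integral (X \<omega>) \<eta> E (e + \<kappa>)) \<partial>P)
       else 1 - (\<integral>\<omega>. cutoff (im_integral (X \<omega>) \<eta> (e - \<kappa>) E) \<partial>P))"
proof -
  have P: "prob_space P" and Xc: "\<And>\<omega>. \<omega> \<in> space P \<Longrightarrow> X \<omega> \<in> carrier_mat m n"
    using X by (auto simp: random_mat_def)
  interpret prob_space P by (rule P)
  have le: "E \<le> e + \<kappa>" "e - \<kappa> \<le> E" using E by linarith+
  note [measurable] = borel_measurable_im_integral[OF X \<eta> le(1)] borel_measurable_im_integral[OF X \<eta> le(2)]
  show "(\<lambda>\<omega>. edge_test up (X \<omega>) \<eta> \<kappa> e E) \<in> borel_measurable P"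
    unfolding edge_test_def by (cases up) (simp_all, measurable)
  have nn: "0 \<le> im_integral (X \<omega>) \<eta> a b" if "\<omega> \<in> space P" "a \<le> b" for \<omega> a b
    unfolding im_integral_eq[OF Xc[OF that(1)] n \<eta> that(2)] by (intro sum_nonneg arctan_diff_nonneg \<eta> that)
  show "0 \<le> edge_test up (X \<omega>) \<eta> \<kappa> e E \<and> edge_test up (X \<omega>) \<eta> \<kappa> e E \<le> 1" if "\<omega> \<in> space P"
    using cutoff_bounds(1,2) nn[OF that le(1)] nn[OF that le(2)] by (simp add: edge_test_def)
  have "integrable P (\<lambda>\<omega>. cutoff (im_integral (X \<omega>) \<eta> (e - \<kappa>) E))"
    by (rule integrable_const_bound[of _ 1]) (use cutoff_bounds(1,2) nn le in auto)
  then show "(\<integral>\<omega>. edge_test up (X \<omega>) \<eta> \<kappa> e E \<partial>P) =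
      (if up then (\<integral>\<omega>. cutoff (im_integral (X \<omega>) \<eta> E (e + \<kappa>)) \<partial>P)
       else 1 - (\<integral>\<omega>. cutoff (im_integral (X \<omega>) \<eta> (e - \<kappa>) E) \<partial>P))"
    by (simp add: edge_test_def prob_space)
qed

lemma green_comparison_sym: "green_comparison e P Y Q Z \<Longrightarrow> green_comparison e Q Z P Y"
  unfolding green_comparison_def by (subst abs_minus_commute, subst (2) abs_minus_commute)

text \<open>One half of the asserted comparison. The other half is the same statement with the two ensembles
  exchanged and \<open>s\<close> shifted.\<close>

definition cdf_le_shifted ::
  "nat \<Rightarrow> 'a measure \<Rightarrow> ('a \<Rightarrow> complex mat) \<Rightarrow> 'b measure \<Rightarrow> ('b \<Rightarrow> complex mat) \<Rightarrow>
   nat \<Rightarrow> real \<Rightarrow> real \<Rightarrow> real \<Rightarrow> bool" where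
  "cdf_le_shifted N P Y Q Z j e \<epsilon> \<delta> \<longleftrightarrow> (\<forall>s.
     edge_cdf N P Y j e (s - real N powr (-\<epsilon>)) - real N powr (-\<delta>) \<le> edge_cdf N Q Z j e s)"

lemma cdf_le_shifted_mono:
  assumes le: "cdf_le_shifted N P Y Q Z j e \<epsilon> \<delta>" and Y: "random_mat P m N Y" and j: "1 \<le> j" "j \<le> N"
    and "\<epsilon>' \<le> \<epsilon>" "\<delta>' \<le> \<delta>"
  shows "cdf_le_shifted N P Y Q Z j e \<epsilon>' \<delta>'"
  unfolding cdf_le_shifted_def
proof
  fix s
  interpret prob_space P using Y by (simp add: random_mat_def)
  note [measurable] = borel_measurable_cov_eigval[OF Y j]
  have "real N powr (- \<epsilon>) \<le> real N powr (- \<epsilon>')" "real N powr (- \<delta>) \<le> real N powr (- \<delta>')"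
    using assms by (auto intro!: powr_mono)
  moreover from this(1) have "edge_cdf N P Y j e (s - real N powr (- \<epsilon>')) \<le> edge_cdf N P Y j e (s - real N powr (- \<epsilon>))"
    unfolding edge_cdf_def by (intro finite_measure_mono) auto
  ultimately show "edge_cdf N P Y j e (s - real N powr (- \<epsilon>')) - real N powr (- \<delta>') \<le> edge_cdf N Q Z j e s"
    using le[unfolded cdf_le_shifted_def, THEN spec, of s] by linarith
qed

lemma edge_cdf_le_shifted:
  fixes M :: "nat \<Rightarrow> nat" and P :: "nat \<Rightarrow> 'a measure" and Q :: "nat \<Rightarrow> 'b measure"
    and Y :: "nat \<Rightarrow> 'a \<Rightarrow> complex mat" and Z :: "nat \<Rightarrow> 'b \<Rightarrow> complex mat"
  defines "d \<equiv> \<lambda>N. aspect (M N) N"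
  assumes M_pos: "\<forall>N\<ge>1. M N \<ge> 1" and lim: "d \<longlonglongrightarrow> L" "L > 0" "L \<noteq> 1"
    and Y: "\<forall>N\<ge>1. random_mat (P N) (M N) N (Y N)" and Z: "\<forall>N\<ge>1. random_mat (Q N) (M N) N (Z N)"
    and A_Y: "local_law M P Y" and A_Z: "local_law M Q Z"
    and B: "green_comparison (\<lambda>N. edge up (d N)) P Y Q Z"
  shows "\<exists>\<epsilon>>0. \<exists>\<delta>>0. \<forall>\<^sub>F N in sequentially.
    cdf_le_shifted N (P N) (Y N) (Q N) (Z N) (edge_index up (M N) N) (edge up (d N)) \<epsilon> \<delta>"
proof -
  obtain \<epsilon>0 N0 where \<epsilon>0: "\<epsilon>0 > 0" and B': "\<forall>F. C4_growth 120 F \<longrightarrow> (\<exists>C::real.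
      \<forall>\<epsilon> N. 0 < \<epsilon> \<longrightarrow> \<epsilon> < \<epsilon>0 \<longrightarrow> N \<ge> N0 \<longrightarrow>
      (\<forall>E E1 E2. \<bar>E - edge up (d N)\<bar> \<le> real N powr (-2/3 + \<epsilon>) \<longrightarrow>
         \<bar>E1 - edge up (d N)\<bar> \<le> real N powr (-2/3 + \<epsilon>) \<longrightarrow> \<bar>E2 - edge up (d N)\<bar> \<le> real N powr (-2/3 + \<epsilon>) \<longrightarrow>
       (let \<eta> = real N powr (-2/3 - \<epsilon>) in
         \<bar>(\<integral>\<omega>. F (real N * \<eta> * Im (emp_stieltjes (Y N \<omega>) (Complex E \<eta>))) \<partial>P N)
          - (\<integral>\<omega>. F (real N * \<eta> * Im (emp_stieltjes (Z N \<omega>) (Complex E \<eta>))) \<partial>Q N)\<bar>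
           \<le> C * real N powr (-1/6 + C * \<epsilon>) \<and>
         \<bar>(\<integral>\<omega>. F (im_integral (Y N \<omega>) \<eta> E1 E2) \<partial>P N)
          - (\<integral>\<omega>. F (im_integral (Z N \<omega>) \<eta> E1 E2) \<partial>Q N)\<bar>
           \<le> C * real N powr (-1/6 + C * \<epsilon>))))"
  proof -
    have "(120 :: real) > 0" by simp
    from B[unfolded green_comparison_def, THEN spec, THEN mp, OF this] show ?thesis
      by (elim exE conjE) (rule that)
  qed
  from B'[THEN spec, THEN mp, OF C4_growth_cutoff]
  obtain C where C: "\<And>\<epsilon> N E1 E2. \<lbrakk>0 < \<epsilon>; \<epsilon> < \<epsilon>0; N \<ge> N0; \<bar>E1 - edge up (d N)\<bar> \<le> real N powr (-2/3 + \<epsilon>);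
      \<bar>E2 - edge up (d N)\<bar> \<le> real N powr (-2/3 + \<epsilon>)\<rbrakk> \<Longrightarrow>
      \<bar>(\<integral>\<omega>. cutoff (im_integral (Y N \<omega>) (real N powr (-2/3 - \<epsilon>)) E1 E2) \<partial>P N)
          - (\<integral>\<omega>. cutoff (im_integral (Z N \<omega>) (real N powr (-2/3 - \<epsilon>)) E1 E2) \<partial>Q N)\<bar>
           \<le> C * real N powr (-1/6 + C * \<epsilon>)"
    unfolding Let_def by metis
  \<comment> \<open>The last bound makes the comparison error at most of order \<open>N\<^bsup>-1/6 + 1/12\<^esup>\<close>; it can be met
    because \<open>C\<close> does not depend on \<open>\<epsilon>\<close>.\<close>
  define \<epsilon> where "\<epsilon> = min (\<epsilon>0 / 2) (min 1 (1 / (12 * (\<bar>C\<bar> + 1))))"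
  have \<epsilon>: "0 < \<epsilon>" "\<epsilon> \<le> 1" "\<epsilon> < \<epsilon>0"
    using \<epsilon>0 min.cobounded1[of 1 "1 / (12 * (\<bar>C\<bar> + 1))"] unfolding \<epsilon>_def by (simp, linarith, linarith)
  have C\<epsilon>: "C * \<epsilon> \<le> 1 / 12"
  proof -
    have "C * \<epsilon> \<le> (\<bar>C\<bar> + 1) * (1 / (12 * (\<bar>C\<bar> + 1)))"
      using \<epsilon>(1) by (intro mult_mono) (auto simp: \<epsilon>_def)
    also have "\<dots> = 1 / 12" by (simp add: divide_simps)
    finally show ?thesis .
  qed
  define \<delta> where "\<delta> = min (\<epsilon> / 4) (1 / 24)"
  have \<delta>: "\<delta> > 0" "\<delta> \<le> \<epsilon> / 4" "\<delta> \<le> 1 / 24" using \<epsilon> by (auto simp: \<delta>_def)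
  define e where "e N = edge up (d N)" for N
  define k \<kappa> w \<eta> where "k N = real N powr (- 2 / 3 + \<epsilon> / 20)" and "\<kappa> N = real N powr (- 2 / 3 + \<epsilon> / 10)"
    and "w N = real N powr (- 2 / 3 - \<epsilon> / 10)" and "\<eta> N = real N powr (- 2 / 3 - \<epsilon>)" for N
  have e_eq: "edge up (aspect (M N) N) = e N" for N by (simp add: e_def d_def)
  note reg = edge_test_regular[where \<epsilon> = \<epsilon> and up = up, OF M_pos lim(1)[unfolded d_def] lim(2,3) _ _ \<epsilon>(1,2),
      unfolded e_eq, folded k_def \<kappa>_def w_def \<eta>_def]
  have sizes: "\<forall>\<^sub>F N in sequentially. 2 * k N \<le> \<kappa> N"
    "\<forall>\<^sub>F N in sequentially. 2 \<le> real N powr (\<epsilon> / 20)"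
    "\<forall>\<^sub>F N in sequentially. 2 * real N powr (- (\<epsilon> / 2)) \<le> real N powr (- (\<epsilon> / 4)) / 2"
    "\<forall>\<^sub>F N in sequentially. 2 * (1 / real N) + \<bar>C\<bar> * real N powr (- 1 / 12) \<le> real N powr (- 1 / 24) / 2"
    using \<epsilon> unfolding k_def \<kappa>_def by (real_asymp; fail)+
  have "\<forall>\<^sub>F N in sequentially. \<forall>s.
     edge_cdf N (P N) (Y N) (edge_index up (M N) N) (e N) (s - real N powr (- (\<epsilon> / 20))) - real N powr (-\<delta>)
       \<le> edge_cdf N (Q N) (Z N) (edge_index up (M N) N) (e N) s"
    using reg[OF Y A_Y] reg[OF Z A_Z] sizes eventually_ge_at_top[of N0] eventually_ge_at_top[of 1]
  proof eventually_elim
    case (elim N)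
    have N: "N \<ge> 1" and N0: "N > 0" using elim(8) by auto
    have YN: "random_mat (P N) (M N) N (Y N)" and ZN: "random_mat (Q N) (M N) N (Z N)" using Y Z N by auto
    then have prob: "prob_space (P N)" "prob_space (Q N)" by (auto simp: random_mat_def)
    have pos: "k N > 0" "w N > 0" "\<eta> N > 0" using N by (auto simp: k_def w_def \<eta>_def)
    have idx: "1 \<le> edge_index up (M N) N" "edge_index up (M N) N \<le> N"
      using M_pos N by (auto simp: edge_index_def)
    let ?U = "\<lambda>\<omega>. cov_eigval (Y N \<omega>) (edge_index up (M N) N)"
    let ?V = "\<lambda>\<omega>. cov_eigval (Z N \<omega>) (edge_index up (M N) N)"
    have [measurable]: "?U \<in> borel_measurable (P N)" "?V \<in> borel_measurable (Q N)"
      using borel_measurable_cov_eigval[OF YN idx] borel_measurable_cov_eigval[OF ZN idx] .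
    have win: "\<bar>E - e N\<bar> \<le> \<kappa> N" if "\<bar>E - e N\<bar> \<le> 2 * k N" for E using that elim(3) by linarith
    have \<kappa>\<epsilon>: "\<kappa> N \<le> real N powr (-2/3 + \<epsilon>)" unfolding \<kappa>_def using N \<epsilon> by (intro powr_mono) auto
    have \<kappa>0: "\<kappa> N \<ge> 0" by (simp add: \<kappa>_def)
    have CN: "C * real N powr (-1/6 + C * \<epsilon>) \<le> \<bar>C\<bar> * real N powr (- 1 / 12)"
      using N C\<epsilon> by (intro mult_mono powr_mono) auto
    have cmp: "\<bar>(\<integral>\<omega>. edge_test up (Y N \<omega>) (\<eta> N) (\<kappa> N) (e N) E \<partial>P N) -
        (\<integral>\<omega>. edge_test up (Z N \<omega>) (\<eta> N) (\<kappa> N) (e N) E \<partial>Q N)\<bar> \<le> \<bar>C\<bar> * real N powr (- 1 / 12)"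
      if "\<bar>E - e N\<bar> \<le> 2 * k N" for E
    proof -
      have E: "\<bar>E - edge up (d N)\<bar> \<le> real N powr (-2/3 + \<epsilon>)"
        "\<bar>e N + \<kappa> N - edge up (d N)\<bar> \<le> real N powr (-2/3 + \<epsilon>)"
        "\<bar>e N - \<kappa> N - edge up (d N)\<bar> \<le> real N powr (-2/3 + \<epsilon>)"
        using win[OF that] \<kappa>\<epsilon> \<kappa>0 by (auto simp: e_def)
      show ?thesis
        using C[OF \<epsilon>(1,3) elim(7) E(1,2)] C[OF \<epsilon>(1,3) elim(7) E(3,1)] CN N
        unfolding edge_test_expectation(3)[OF YN N0 pos(3) win[OF that]] edge_test_expectation(3)[OF ZN N0 pos(3) win[OF that]]
        by (auto simp: \<eta>_def abs_minus_commute)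
    qed
    have transfer: "measure (P N) {\<omega> \<in> space (P N). ?U \<omega> \<le> t - 2 * w N} -
        (2 * real N powr (- (\<epsilon> / 2)) + 2 * (1 / real N) + \<bar>C\<bar> * real N powr (- 1 / 12))
        \<le> measure (Q N) {\<omega> \<in> space (Q N). ?V \<omega> \<le> t}" for t
      by (rule cdf_transfer[where W = "\<lambda>E \<omega>. edge_test up (Y N \<omega>) (\<eta> N) (\<kappa> N) (e N) E"
            and T = "\<lambda>E \<omega>. edge_test up (Z N \<omega>) (\<eta> N) (\<kappa> N) (e N) E", OF prob _ _ _ _ elim(1,2) cmp pos(1,2)])
         (use edge_test_expectation(1,2)[OF YN _ pos(3) win] edge_test_expectation(1,2)[OF ZN _ pos(3) win] N in auto)
    show ?case
    proof
      fix s
      define t where "t = e N + s * real N powr (- 2 / 3)"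
      have cdf: "edge_cdf N R X j (e N) u =
          measure R {\<omega> \<in> space R. cov_eigval (X \<omega>) j \<le> e N + u * real N powr (- 2 / 3)}" for R X j u
      proof -
        have "real N powr (2 / 3) * (x - e N) \<le> u \<longleftrightarrow> x \<le> e N + u * real N powr (- 2 / 3)" for x
          using N by (simp add: powr_minus field_simps)
        then show ?thesis by (simp add: edge_cdf_def)
      qed
      interpret P: prob_space "P N" by (rule prob)
      have "2 * w N \<le> real N powr (- (\<epsilon> / 20)) * real N powr (- 2 / 3)"
      proof -
        have "2 * w N \<le> real N powr (\<epsilon> / 20) * w N" using elim(4) pos by (intro mult_right_mono) auto
        also have "\<dots> = real N powr (\<epsilon> / 20 + (- 2 / 3 - \<epsilon> / 10))" unfolding w_def by (rule powr_add[symmetric])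
        also have "\<dots> = real N powr (- (\<epsilon> / 20) + - 2 / 3)" by (rule arg_cong[where f = "(powr) (real N)"]) simp
        finally show ?thesis unfolding powr_add .
      qed
      then have "edge_cdf N (P N) (Y N) (edge_index up (M N) N) (e N) (s - real N powr (- (\<epsilon> / 20)))
          \<le> measure (P N) {\<omega> \<in> space (P N). ?U \<omega> \<le> t - 2 * w N}"
        unfolding cdf t_def by (intro P.finite_measure_mono) (auto simp: algebra_simps)
      moreover have "real N powr (- (\<epsilon> / 4)) \<le> real N powr (- \<delta>)" "real N powr (- 1 / 24) \<le> real N powr (- \<delta>)"
        using N \<delta> by (auto intro!: powr_mono)
      ultimately show "edge_cdf N (P N) (Y N) (edge_index up (M N) N) (e N) (s - real N powr (- (\<epsilon> / 20))) - real N powr (-\<delta>)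
         \<le> edge_cdf N (Q N) (Z N) (edge_index up (M N) N) (e N) s"
        using transfer[of t] elim(5,6) unfolding cdf[of "Q N"] t_def by linarith
    qed
  qed
  then have ev: "\<forall>\<^sub>F N in sequentially.
      cdf_le_shifted N (P N) (Y N) (Q N) (Z N) (edge_index up (M N) N) (edge up (d N)) (\<epsilon> / 20) \<delta>"
    unfolding cdf_le_shifted_def e_def .
  have "\<epsilon> / 20 > 0" using \<epsilon>(1) by simp
  with ev \<delta>(1) show ?thesis by blast
qed

theorem theorem4p5:
  fixes M :: "nat \<Rightarrow> nat" and \<theta> L :: real
    and P :: "nat \<Rightarrow> 'a measure" and Q :: "nat \<Rightarrow> 'b measure"
    and Y :: "nat \<Rightarrow> 'a \<Rightarrow> complex mat" and Z :: "nat \<Rightarrow> 'b \<Rightarrow> complex mat"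
  defines "d \<equiv> \<lambda>N. aspect (M N) N"
  assumes M_pos: "\<forall>N\<ge>1. M N \<ge> 1"
    and theta: "\<theta> > 0" "\<forall>N\<ge>1. \<theta> < d N \<and> d N < 1 / \<theta>"
    and lim_d: "d \<longlonglongrightarrow> L" "L > 0" "L \<noteq> 1"
    and Y: "\<forall>N\<ge>1. random_mat (P N) (M N) N (Y N)"
    and Z: "\<forall>N\<ge>1. random_mat (Q N) (M N) N (Z N)"
    and A_Y: "local_law M P Y"
    and A_Z: "local_law M Q Z"
    and B_upper: "green_comparison (\<lambda>N. lam_plus (d N)) P Y Q Z"
    and C_upper: "multi_comparison_upper (\<lambda>N. lam_plus (d N)) P Y Q Z"
    and B_lower: "green_comparison (\<lambda>N. lam_minus (d N)) P Y Q Z"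
    and C_lower: "multi_comparison_lower (\<lambda>N. lam_minus (d N)) P Y Q Z"
  shows "\<exists>\<epsilon>>0. \<exists>\<delta>>0. \<exists>N0. \<forall>N\<ge>N0. \<forall>s.
     edge_cdf N (P N) (Y N) 1 (lam_plus (d N)) (s - real N powr (-\<epsilon>)) - real N powr (-\<delta>)
       \<le> edge_cdf N (Q N) (Z N) 1 (lam_plus (d N)) s \<and>
     edge_cdf N (Q N) (Z N) 1 (lam_plus (d N)) s
       \<le> edge_cdf N (P N) (Y N) 1 (lam_plus (d N)) (s + real N powr (-\<epsilon>)) + real N powr (-\<delta>) \<and>
     edge_cdf N (P N) (Y N) (min (M N) N) (lam_minus (d N)) (s - real N powr (-\<epsilon>)) - real N powr (-\<delta>)
       \<le> edge_cdf N (Q N) (Z N) (min (M N) N) (lam_minus (d N)) s \<and>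
     edge_cdf N (Q N) (Z N) (min (M N) N) (lam_minus (d N)) s
       \<le> edge_cdf N (P N) (Y N) (min (M N) N) (lam_minus (d N)) (s + real N powr (-\<epsilon>)) + real N powr (-\<delta>)"
proof -
  note lim = lim_d[unfolded d_def]
  have one_edge: "\<exists>\<epsilon>>0. \<exists>\<delta>>0. \<forall>\<^sub>F N in sequentially.
      cdf_le_shifted N (P N) (Y N) (Q N) (Z N) (edge_index up (M N) N) (edge up (d N)) \<epsilon> \<delta> \<and>
      cdf_le_shifted N (Q N) (Z N) (P N) (Y N) (edge_index up (M N) N) (edge up (d N)) \<epsilon> \<delta>" for up
  proof -
    have B: "green_comparison (\<lambda>N. edge up (aspect (M N) N)) P Y Q Z"
      using B_upper B_lower by (cases up) (simp_all add: edge_simps d_def)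
    obtain \<epsilon>1 \<delta>1 where 1: "\<epsilon>1 > 0" "\<delta>1 > 0" "\<forall>\<^sub>F N in sequentially.
        cdf_le_shifted N (P N) (Y N) (Q N) (Z N) (edge_index up (M N) N) (edge up (aspect (M N) N)) \<epsilon>1 \<delta>1"
      using edge_cdf_le_shifted[OF M_pos lim Y Z A_Y A_Z B] by blast
    obtain \<epsilon>2 \<delta>2 where 2: "\<epsilon>2 > 0" "\<delta>2 > 0" "\<forall>\<^sub>F N in sequentially.
        cdf_le_shifted N (Q N) (Z N) (P N) (Y N) (edge_index up (M N) N) (edge up (aspect (M N) N)) \<epsilon>2 \<delta>2"
      using edge_cdf_le_shifted[OF M_pos lim Z Y A_Z A_Y green_comparison_sym[OF B]] by blast
    have ev: "\<forall>\<^sub>F N in sequentially.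
      cdf_le_shifted N (P N) (Y N) (Q N) (Z N) (edge_index up (M N) N) (edge up (d N)) (min \<epsilon>1 \<epsilon>2) (min \<delta>1 \<delta>2) \<and>
      cdf_le_shifted N (Q N) (Z N) (P N) (Y N) (edge_index up (M N) N) (edge up (d N)) (min \<epsilon>1 \<epsilon>2) (min \<delta>1 \<delta>2)"
      using 1(3) 2(3) eventually_ge_at_top[of 1]
    proof eventually_elim
      case (elim N)
      have idx: "1 \<le> edge_index up (M N) N" "edge_index up (M N) N \<le> N"
        using M_pos elim(3) by (auto simp: edge_index_def)
      show ?case
        using cdf_le_shifted_mono[OF elim(1) Y[rule_format, OF elim(3)] idx]
          cdf_le_shifted_mono[OF elim(2) Z[rule_format, OF elim(3)] idx]
        by (simp add: d_def)
    qed
    have "min \<epsilon>1 \<epsilon>2 > 0" "min \<delta>1 \<delta>2 > 0" using 1(1,2) 2(1,2) by auto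
    with ev show ?thesis by blast
  qed
  obtain \<epsilon>1 \<delta>1 where 1: "\<epsilon>1 > 0" "\<delta>1 > 0" "\<forall>\<^sub>F N in sequentially.
      cdf_le_shifted N (P N) (Y N) (Q N) (Z N) (edge_index True (M N) N) (edge True (d N)) \<epsilon>1 \<delta>1 \<and>
      cdf_le_shifted N (Q N) (Z N) (P N) (Y N) (edge_index True (M N) N) (edge True (d N)) \<epsilon>1 \<delta>1"
    using one_edge[of True] by blast
  obtain \<epsilon>2 \<delta>2 where 2: "\<epsilon>2 > 0" "\<delta>2 > 0" "\<forall>\<^sub>F N in sequentially.
      cdf_le_shifted N (P N) (Y N) (Q N) (Z N) (edge_index False (M N) N) (edge False (d N)) \<epsilon>2 \<delta>2 \<and>
      cdf_le_shifted N (Q N) (Z N) (P N) (Y N) (edge_index False (M N) N) (edge False (d N)) \<epsilon>2 \<delta>2"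
    using one_edge[of False] by blast
  define \<epsilon> where "\<epsilon> = min \<epsilon>1 \<epsilon>2"
  define \<delta> where "\<delta> = min \<delta>1 \<delta>2"
  have "\<forall>\<^sub>F N in sequentially.
      cdf_le_shifted N (P N) (Y N) (Q N) (Z N) 1 (lam_plus (d N)) \<epsilon> \<delta> \<and>
      cdf_le_shifted N (Q N) (Z N) (P N) (Y N) 1 (lam_plus (d N)) \<epsilon> \<delta> \<and>
      cdf_le_shifted N (P N) (Y N) (Q N) (Z N) (min (M N) N) (lam_minus (d N)) \<epsilon> \<delta> \<and>
      cdf_le_shifted N (Q N) (Z N) (P N) (Y N) (min (M N) N) (lam_minus (d N)) \<epsilon> \<delta>"
    using 1(3) 2(3) eventually_ge_at_top[of 1]
  proof eventually_elim
    case (elim N)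
    have le: "\<epsilon> \<le> \<epsilon>1" "\<epsilon> \<le> \<epsilon>2" "\<delta> \<le> \<delta>1" "\<delta> \<le> \<delta>2" by (auto simp: \<epsilon>_def \<delta>_def)
    have "1 \<le> min (M N) N" "min (M N) N \<le> N" using M_pos elim(3) by auto
    then show ?case
      using elim(1,2) Y[rule_format, OF elim(3)] Z[rule_format, OF elim(3)] elim(3) le
      unfolding edge_simps edge_index_def if_True if_False
      by (auto intro: cdf_le_shifted_mono)
  qed
  then obtain N0 where N0: "\<And>N. N \<ge> N0 \<Longrightarrow>
      cdf_le_shifted N (P N) (Y N) (Q N) (Z N) 1 (lam_plus (d N)) \<epsilon> \<delta> \<and>
      cdf_le_shifted N (Q N) (Z N) (P N) (Y N) 1 (lam_plus (d N)) \<epsilon> \<delta> \<and>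
      cdf_le_shifted N (P N) (Y N) (Q N) (Z N) (min (M N) N) (lam_minus (d N)) \<epsilon> \<delta> \<and>
      cdf_le_shifted N (Q N) (Z N) (P N) (Y N) (min (M N) N) (lam_minus (d N)) \<epsilon> \<delta>"
    unfolding eventually_sequentially by blast
  have shift: "edge_cdf N R X j e s \<le> edge_cdf N R' X' j e (s + real N powr (- \<epsilon>)) + real N powr (- \<delta>)"
    if "cdf_le_shifted N R X R' X' j e \<epsilon> \<delta>" for N and R :: "'c measure" and R' :: "'d measure" and X X' j e s
    using that[unfolded cdf_le_shifted_def, THEN spec, of "s + real N powr (- \<epsilon>)"] by simp
  have "\<epsilon> > 0" "\<delta> > 0" using 1 2 by (auto simp: \<epsilon>_def \<delta>_def)
  show ?thesis
  proof (rule exI[of _ \<epsilon>], rule conjI[OF \<open>\<epsilon> > 0\<close>], rule exI[of _ \<delta>], rule conjI[OF \<open>\<delta> > 0\<close>],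
      rule exI[of _ N0], intro allI impI conjI)
    fix N s assume "N \<ge> N0"
    note le = N0[OF this]
    show "edge_cdf N (P N) (Y N) 1 (lam_plus (d N)) (s - real N powr (-\<epsilon>)) - real N powr (-\<delta>)
        \<le> edge_cdf N (Q N) (Z N) 1 (lam_plus (d N)) s"
      "edge_cdf N (P N) (Y N) (min (M N) N) (lam_minus (d N)) (s - real N powr (-\<epsilon>)) - real N powr (-\<delta>)
        \<le> edge_cdf N (Q N) (Z N) (min (M N) N) (lam_minus (d N)) s"
      using le unfolding cdf_le_shifted_def by blast+
    show "edge_cdf N (Q N) (Z N) 1 (lam_plus (d N)) s
        \<le> edge_cdf N (P N) (Y N) 1 (lam_plus (d N)) (s + real N powr (-\<epsilon>)) + real N powr (-\<delta>)"
      "edge_cdf N (Q N) (Z N) (min (M N) N) (lam_minus (d N)) s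
        \<le> edge_cdf N (P N) (Y N) (min (M N) N) (lam_minus (d N)) (s + real N powr (-\<epsilon>)) + real N powr (-\<delta>)"
      using le by (blast intro: shift)+
  qed
qed

end
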